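(* Let $\mathcal H$ be a class of graphs on which a minimum vertex cover can be computed in polynomial time. Let $\mathcal G$ be a class of connected graphs such that for every $G\in\mathcal G$ and all subsets $U,W\subseteq V(G)$ with $U\cap W=\emptyset$ we have $(G-U)-E(G[W])\in\mathcal H$. Then a minimum-size simultaneous dominating set of a graph in $\mathcal G$ can be computed in polynomial time.
   Context: All graphs are finite, simple and undirected. For a connected graph $G$, a subset $S\subseteq V(G)$ is a simultaneous dominating set of $G$ if $S$ is a dominating set (every vertex not in $S$ has a neighbour in $S$) in every spanning tree of $G$. $(G-U)-E(G[W])$ denotes the graph obtained from $G$ by deleting the vertices in $U$ and then all edges with both endpoints in $W$. *)

theory Defs
  imports "HOL-Computational_Algebra.Polynomial"
begin

section \<open>Graphs\<close>

record 'a ugraph =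
  verts :: "'a set"
  edges :: "'a set set"

definition simple_graph :: "'a ugraph \<Rightarrow> bool" where
  "simple_graph G \<longleftrightarrow> finite (verts G) \<and> (\<forall>e\<in>edges G. e \<subseteq> verts G \<and> card e = 2)"

definition adjacent :: "'a ugraph \<Rightarrow> 'a rel" where
  "adjacent G = {(u, v). {u, v} \<in> edges G}"

text \<open>The graph without vertices is a simple graph, but it does not count as connected.\<close>

definition connected_graph :: "'a ugraph \<Rightarrow> bool" where
  "connected_graph G \<longleftrightarrow>
     verts G \<noteq> {} \<and> (\<forall>u\<in>verts G. \<forall>v\<in>verts G. (u, v) \<in> (adjacent G)\<^sup>*)"

definition is_cycle :: "'a ugraph \<Rightarrow> 'a list \<Rightarrow> bool" where
  "is_cycle G xs \<longleftrightarrow> length xs \<ge> 3 \<and> distinct xs \<and> set xs \<subseteq> verts G \<and>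
     (\<forall>i. Suc i < length xs \<longrightarrow> (xs ! i, xs ! Suc i) \<in> adjacent G) \<and>
     (last xs, hd xs) \<in> adjacent G"

definition tree :: "'a ugraph \<Rightarrow> bool" where
  "tree T \<longleftrightarrow> simple_graph T \<and> connected_graph T \<and> (\<nexists>xs. is_cycle T xs)"

definition spanning_tree :: "'a ugraph \<Rightarrow> 'a ugraph \<Rightarrow> bool" where
  "spanning_tree T G \<longleftrightarrow> tree T \<and> verts T = verts G \<and> edges T \<subseteq> edges G"

definition dominating_set :: "'a ugraph \<Rightarrow> 'a set \<Rightarrow> bool" where
  "dominating_set G S \<longleftrightarrow>
     S \<subseteq> verts G \<and> (\<forall>v\<in>verts G - S. \<exists>u\<in>S. (v, u) \<in> adjacent G)"

definition simultaneous_dominating_set :: "'a ugraph \<Rightarrow> 'a set \<Rightarrow> bool" where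
  "simultaneous_dominating_set G S \<longleftrightarrow>
     S \<subseteq> verts G \<and> (\<forall>T. spanning_tree T G \<longrightarrow> dominating_set T S)"

definition vertex_cover :: "'a ugraph \<Rightarrow> 'a set \<Rightarrow> bool" where
  "vertex_cover G S \<longleftrightarrow> S \<subseteq> verts G \<and> (\<forall>e\<in>edges G. e \<inter> S \<noteq> {})"

definition delete_vertices :: "'a ugraph \<Rightarrow> 'a set \<Rightarrow> 'a ugraph" where
  "delete_vertices G U = \<lparr>verts = verts G - U, edges = {e \<in> edges G. e \<inter> U = {}}\<rparr>"

definition induced_subgraph :: "'a ugraph \<Rightarrow> 'a set \<Rightarrow> 'a ugraph" where
  "induced_subgraph G W = \<lparr>verts = verts G \<inter> W, edges = {e \<in> edges G. e \<subseteq> W}\<rparr>"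

definition delete_edges :: "'a ugraph \<Rightarrow> 'a set set \<Rightarrow> 'a ugraph" where
  "delete_edges G F = \<lparr>verts = verts G, edges = edges G - F\<rparr>"

definition minimum_set :: "('a ugraph \<Rightarrow> 'a set \<Rightarrow> bool) \<Rightarrow> 'a ugraph \<Rightarrow> 'a set \<Rightarrow> bool" where
  "minimum_set P G S \<longleftrightarrow> P G S \<and> (\<forall>S'. P G S' \<longrightarrow> card S \<le> card S')"


section \<open>Model of computation\<close>

text \<open>
  Programs are those of the language WHILE of N. D. Jones (Computability and Complexity from a
  Programming Perspective, MIT Press 1997), the data being binary trees over a single atom.
  Evaluating an expression takes one step per operator, constant or variable, and a pair is built
  or taken apart, or a tree tested for being the atom, in constant time, as on a machine with
  pointers. A run of \<open>t\<close> steps allocates at most \<open>t\<close> new cells, so this machine and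
  Turing machines simulate each other with polynomial overhead, and the two notions of
  polynomial time agree.
\<close>

datatype data = Atom | Pair data data

fun first :: "data \<Rightarrow> data" where
  "first Atom = Atom"
| "first (Pair a b) = a"

fun second :: "data \<Rightarrow> data" where
  "second Atom = Atom"
| "second (Pair a b) = b"

datatype expr = Var nat | Nil_E | Cons_E expr expr | Hd_E expr | Tl_E expr

type_synonym store = "nat \<Rightarrow> data"

primrec eval_expr :: "expr \<Rightarrow> store \<Rightarrow> data" where
  "eval_expr (Var x) s = s x"
| "eval_expr Nil_E s = Atom"
| "eval_expr (Cons_E e f) s = Pair (eval_expr e s) (eval_expr f s)"
| "eval_expr (Hd_E e) s = first (eval_expr e s)"
| "eval_expr (Tl_E e) s = second (eval_expr e s)"

primrec expr_cost :: "expr \<Rightarrow> nat" where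
  "expr_cost (Var x) = 1"
| "expr_cost Nil_E = 1"
| "expr_cost (Cons_E e f) = 1 + expr_cost e + expr_cost f"
| "expr_cost (Hd_E e) = 1 + expr_cost e"
| "expr_cost (Tl_E e) = 1 + expr_cost e"

datatype com = Assign nat expr | Seq com com | If expr com com | While expr com

text \<open>\<open>exec c s t s'\<close>: started in store \<open>s\<close>, the program \<open>c\<close> halts after exactly \<open>t\<close> steps in
  store \<open>s'\<close>. In tests the atom is false and every pair is true.\<close>

inductive exec :: "com \<Rightarrow> store \<Rightarrow> nat \<Rightarrow> store \<Rightarrow> bool" where
  Assign: "exec (Assign x e) s (1 + expr_cost e) (s(x := eval_expr e s))"
| Seq: "exec c s t s' \<Longrightarrow> exec d s' t' s'' \<Longrightarrow> exec (Seq c d) s (1 + t + t') s''"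
| If_True: "eval_expr e s \<noteq> Atom \<Longrightarrow> exec c s t s' \<Longrightarrow>
    exec (If e c d) s (1 + expr_cost e + t) s'"
| If_False: "eval_expr e s = Atom \<Longrightarrow> exec d s t s' \<Longrightarrow>
    exec (If e c d) s (1 + expr_cost e + t) s'"
| While_True: "eval_expr e s \<noteq> Atom \<Longrightarrow> exec c s t s' \<Longrightarrow> exec (While e c) s' t' s'' \<Longrightarrow>
    exec (While e c) s (1 + expr_cost e + t + t') s''"
| While_False: "eval_expr e s = Atom \<Longrightarrow> exec (While e c) s (1 + expr_cost e) s"

inductive_cases exec_AssignE: "exec (Assign x e) s t s'"
inductive_cases exec_SeqE: "exec (Seq c d) s t s'"
inductive_cases exec_IfE: "exec (If e c d) s t s'"
inductive_cases exec_WhileE: "exec (While e c) s t s'"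

lemma exec_deterministic:
  "exec c s t r \<Longrightarrow> exec c s t' r' \<Longrightarrow> t = t' \<and> r = r'"
proof (induction arbitrary: t' r' rule: exec.induct)
  case Assign
  then show ?case by (auto elim!: exec_AssignE)
next
  case Seq
  from Seq.prems show ?case by (rule exec_SeqE) (fastforce dest: Seq.IH)
next
  case If_True
  from If_True.prems show ?case
    by (rule exec_IfE) (use If_True.hyps in \<open>fastforce dest: If_True.IH\<close>)+
next
  case If_False
  from If_False.prems show ?case
    by (rule exec_IfE) (use If_False.hyps in \<open>fastforce dest: If_False.IH\<close>)+
next
  case While_True
  from While_True.prems show ?case
    by (rule exec_WhileE) (use While_True.hyps in \<open>fastforce dest: While_True.IH\<close>)+
next
  case While_False
  from While_False.prems show ?case
    by (rule exec_WhileE) (use While_False.hyps in auto)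
qed

text \<open>Input and output are passed in variable 0; all other variables initially hold the atom.
  The length of an input \<open>x\<close> is \<open>size x\<close>, its number of pairs when written out as a tree.\<close>

definition initial_store :: "data \<Rightarrow> store" where
  "initial_store x = (\<lambda>_. Atom)(0 := x)"

definition computes_in :: "com \<Rightarrow> nat \<Rightarrow> data \<Rightarrow> data \<Rightarrow> bool" where
  "computes_in c n x y \<longleftrightarrow> (\<exists>t s. exec c (initial_store x) t s \<and> t \<le> n \<and> s 0 = y)"


section \<open>Encoding of graphs and polynomial-time computation of minimum sets\<close>

text \<open>Vertices are natural numbers, written in binary with the least significant bit first.\<close>

fun enc_nat :: "nat \<Rightarrow> data" where
  "enc_nat n = (if n = 0 then Atom
     else Pair (if odd n then Pair Atom Atom else Atom) (enc_nat (n div 2)))"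

declare enc_nat.simps [simp del]

primrec enc_list :: "('a \<Rightarrow> data) \<Rightarrow> 'a list \<Rightarrow> data" where
  "enc_list f [] = Atom"
| "enc_list f (x # xs) = Pair (f x) (enc_list f xs)"

definition enc_edge :: "nat \<times> nat \<Rightarrow> data" where
  "enc_edge e = Pair (enc_nat (fst e)) (enc_nat (snd e))"

text \<open>A graph is given by its list of vertices and its list of edges, in any order; each edge
  occurs once, with its two endpoints in either order.\<close>

definition encodes_graph :: "data \<Rightarrow> nat ugraph \<Rightarrow> bool" where
  "encodes_graph x G \<longleftrightarrow> (\<exists>vs es.
     distinct vs \<and> set vs = verts G \<and>
     distinct (map (\<lambda>(u, v). {u, v}) es) \<and> set (map (\<lambda>(u, v). {u, v}) es) = edges G \<and>
     x = Pair (enc_list enc_nat vs) (enc_list enc_edge es))"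

definition encodes_set :: "data \<Rightarrow> nat set \<Rightarrow> bool" where
  "encodes_set y S \<longleftrightarrow> (\<exists>xs. distinct xs \<and> set xs = S \<and> y = enc_list enc_nat xs)"

text \<open>Correctness and the time bound are required on graphs of the class \<open>\<C>\<close> only; a
  program may behave arbitrarily on other inputs.\<close>

definition minimum_set_in_poly_time ::
    "(nat ugraph \<Rightarrow> nat set \<Rightarrow> bool) \<Rightarrow> nat ugraph set \<Rightarrow> bool" where
  "minimum_set_in_poly_time P \<C> \<longleftrightarrow> (\<exists>(c :: com) (p :: nat poly). \<forall>G\<in>\<C>. \<forall>x.
     encodes_graph x G \<longrightarrow>
     (\<exists>y S. computes_in c (poly p (size x)) x y \<and> encodes_set y S \<and> minimum_set P G S))"

end

theory Submission
  imports Defs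
begin

text \<open>
  A set \<open>S\<close> dominates every spanning tree of \<open>G\<close> iff each vertex \<open>v \<notin> S\<close> has all its neighbours in
  some component of \<open>G - v\<close> in \<open>S\<close>. Take a vertex \<open>v\<close> and a component \<open>C\<close> of \<open>G - v\<close> such that \<open>C\<close> has
  minimum size. Then no vertex of \<open>C\<close> is a cut vertex, so on \<open>C\<close> the condition is that of a vertex
  cover. How few vertices of \<open>C\<close> suffice depends only on whether \<open>v\<close> is chosen and, if not, on
  whether \<open>v\<close> is dominated from \<open>C\<close>; the three optima are minimum vertex covers of graphs of the form
  \<open>(G - U) - E(G[W])\<close>. Choosing \<open>v\<close> costs a single vertex, so comparing the optima tells which partial
  solution on \<open>C\<close> to fix, and \<open>C\<close> is removed. Vertices chosen so far are deleted in later queries, and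
  between vertices that are already dominated no edge needs to be covered. One vertex is left in the
  end.
\<close>

section \<open>Polynomial-time functions\<close>

text \<open>The characterisation of domination comes from deleting all edges between
  \<open>v\<close> and \<open>S\<close>: if what is left is connected, one of its spanning trees
  leaves \<open>v\<close> undominated. A vertex \<open>w\<close> of a minimum \<open>C\<close> is no
  cut vertex, since a part of the graph cut off from \<open>v\<close> by \<open>w\<close> would lie
  strictly inside \<open>C\<close>. For the comparison let x1, x2, x3 be the optima on
  \<open>C\<close> with \<open>v\<close> chosen, with \<open>v\<close> not chosen, and with
  \<open>v\<close> not chosen but dominated from \<open>C\<close>; then x1 \<le> x2 \<le> x3. If x3
  = x1, the domination of \<open>v\<close> is free. If x2 = x1 < x3, domination of \<open>v\<close>
  from \<open>C\<close> costs at least one extra vertex, for which \<open>v\<close> itself could be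
  taken, so \<open>v\<close> is left to the rest. If x1 < x2, already not choosing \<open>v\<close>
  costs an extra vertex, so \<open>v\<close> is chosen. On the machine side there are no procedures,
  and the given program is reliable only on its class. Calls therefore need variables beyond its
  reach and a clean-up, and every closure rule for polynomial time is relative to the set of inputs
  that really occur.\<close>

primrec expr_bound :: "expr \<Rightarrow> nat" where
  "expr_bound (Var x) = Suc x"
| "expr_bound Nil_E = 0"
| "expr_bound (Cons_E e f) = max (expr_bound e) (expr_bound f)"
| "expr_bound (Hd_E e) = expr_bound e"
| "expr_bound (Tl_E e) = expr_bound e"

text \<open>A strict bound on the indices of all variables that occur, so that a caller may keep
  data from this index on.\<close>

primrec com_bound :: "com \<Rightarrow> nat" where
  "com_bound (Assign x e) = max (Suc x) (expr_bound e)"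
| "com_bound (Seq c d) = max (com_bound c) (com_bound d)"
| "com_bound (If e c d) = max (expr_bound e) (max (com_bound c) (com_bound d))"
| "com_bound (While e c) = max (expr_bound e) (com_bound c)"

definition merge :: "nat \<Rightarrow> store \<Rightarrow> store \<Rightarrow> store" where
  "merge n s r = (\<lambda>v. if v < n then s v else r v)"

lemma eval_expr_merge: "expr_bound e \<le> n \<Longrightarrow> eval_expr e (merge n s r) = eval_expr e s"
  by (induction e) (auto simp: merge_def)

text \<open>Variables beyond the bound are neither read nor written, so the same run, with the same
  number of steps, takes place whatever they contain. This makes a program callable from a larger
  one.\<close>

lemma exec_merge:
  "exec c s t s' \<Longrightarrow> com_bound c \<le> n \<Longrightarrow> exec c (merge n s r) t (merge n s' r)"
proof (induction rule: exec.induct)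
  case (Assign x e s)
  then have "merge n (s(x := eval_expr e s)) r
      = (merge n s r)(x := eval_expr e (merge n s r))"
    by (auto simp: merge_def eval_expr_merge[unfolded merge_def])
  then show ?case by (metis exec.Assign)
next
  case (If_True e s c t s' d)
  then show ?case by (intro exec.If_True) (auto simp: eval_expr_merge)
next
  case (If_False e s d t s' c)
  then show ?case by (intro exec.If_False) (auto simp: eval_expr_merge)
next
  case (While_True e s c t s' t' s'')
  then show ?case by (intro exec.While_True[of _ _ _ _ "merge n s' r"]) (auto simp: eval_expr_merge)
next
  case (While_False e s c)
  then show ?case by (intro exec.While_False) (auto simp: eval_expr_merge)
next
  case (Seq c s t s' d t' s'')
  then show ?case by (intro exec.Seq[of _ _ _ "merge n s' r"]) auto
qed

definition runs :: "com \<Rightarrow> nat \<Rightarrow> store \<Rightarrow> store \<Rightarrow> bool" where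
  "runs c n s s' \<longleftrightarrow> (\<exists>t\<le>n. exec c s t s')"

lemma computes_in_iff: "computes_in c n x y \<longleftrightarrow> (\<exists>s. runs c n (initial_store x) s \<and> s 0 = y)"
  by (auto simp: computes_in_def runs_def)

lemma runs_mono: "runs c m s s' \<Longrightarrow> m \<le> n \<Longrightarrow> runs c n s s'"
  unfolding runs_def by (meson le_trans)

lemma runs_Assign: "runs (Assign x e) (1 + expr_cost e) s (s(x := eval_expr e s))"
  unfolding runs_def by (blast intro: exec.Assign)

lemma runs_Seq: "runs c m s s' \<Longrightarrow> runs d n s' s'' \<Longrightarrow> runs (Seq c d) (1 + m + n) s s''"
  unfolding runs_def by (meson add_le_mono exec.Seq order_refl)

lemma runs_If:
  assumes "if eval_expr e s \<noteq> Atom then runs c n s s' else runs d n s s'"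
  shows "runs (If e c d) (1 + expr_cost e + n) s s'"
proof (cases "eval_expr e s = Atom")
  case True
  with assms obtain t where "t \<le> n" "exec d s t s'" by (auto simp: runs_def)
  with True show ?thesis unfolding runs_def by (meson add_le_mono exec.If_False order_refl)
next
  case False
  with assms obtain t where "t \<le> n" "exec c s t s'" by (auto simp: runs_def)
  with False show ?thesis unfolding runs_def by (meson add_le_mono exec.If_True order_refl)
qed

lemma runs_While_True:
  assumes "eval_expr e s \<noteq> Atom" "runs c m s s'" "runs (While e c) n s' s''"
  shows "runs (While e c) (1 + expr_cost e + m + n) s s''"
proof -
  from assms(2,3) obtain t t' where "t \<le> m" "exec c s t s'" "t' \<le> n" "exec (While e c) s' t' s''"
    by (auto simp: runs_def)
  with assms(1) show ?thesis
    unfolding runs_def by (meson add_le_mono exec.While_True order_refl)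
qed

lemma runs_While_False: "eval_expr e s = Atom \<Longrightarrow> runs (While e c) (1 + expr_cost e) s s"
  unfolding runs_def by (blast intro: exec.While_False)

text \<open>There is no skip command; assigning variable 0 to itself replaces it. Variable 0 is
  spared because it carries the result.\<close>

primrec clear :: "nat \<Rightarrow> com" where
  "clear 0 = Assign 0 (Var 0)"
| "clear (Suc n) = Seq (clear n) (Assign (Suc n) Nil_E)"

lemma runs_clear: "runs (clear n) (2 + 3 * n) s (\<lambda>v. if 1 \<le> v \<and> v \<le> n then Atom else s v)"
proof (induction n)
  case 0
  have "(\<lambda>v. if 1 \<le> v \<and> v \<le> 0 then Atom else s v) = s(0 := eval_expr (Var 0) s)" by auto
  then show ?case using runs_Assign[of 0 "Var 0" s] by (simp add: eval_nat_numeral)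
next
  case (Suc n)
  let ?s = "\<lambda>v. if 1 \<le> v \<and> v \<le> n then Atom else s v"
  have "(\<lambda>v. if 1 \<le> v \<and> v \<le> Suc n then Atom else s v) = ?s(Suc n := eval_expr Nil_E ?s)" by auto
  then show ?case using runs_Seq[OF Suc runs_Assign[of "Suc n" Nil_E]] by (auto elim: runs_mono)
qed

text \<open>A program expects the atom in all its variables except 0. Clearing after the run
  restores this, so that calls can follow each other, in particular in a loop.\<close>

definition call :: "com \<Rightarrow> com" where
  "call c = Seq c (clear (com_bound c))"

definition call_cost :: "com \<Rightarrow> nat" where
  "call_cost c = 3 + 3 * com_bound c"

lemma runs_in_store:
  assumes "computes_in c m (s 0) y" "\<And>v. 0 < v \<Longrightarrow> v \<le> com_bound c \<Longrightarrow> s v = Atom"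
  obtains s' where "runs c m s s'" "s' 0 = y" "\<And>v. com_bound c < v \<Longrightarrow> s' v = s v"
proof -
  obtain t s' where s': "exec c (initial_store (s 0)) t s'" "t \<le> m" "s' 0 = y"
    using assms(1) by (auto simp: computes_in_def)
  \<comment> \<open>With \<open>Suc\<close>, variable 0 lies in the part taken from the run without
    any argument that the bound is positive.\<close>
  have "merge (Suc (com_bound c)) (initial_store (s 0)) s = s"
    using assms(2) by (auto simp: merge_def initial_store_def fun_eq_iff)
  then have "exec c s t (merge (Suc (com_bound c)) s' s)"
    using exec_merge[OF s'(1), of "Suc (com_bound c)" s] by simp
  with s' show ?thesis by (intro that[of "merge (Suc (com_bound c)) s' s"])
      (auto simp: runs_def merge_def)
qed

lemma runs_call:
  assumes "computes_in c m (s 0) y" "\<And>v. 0 < v \<Longrightarrow> v \<le> com_bound c \<Longrightarrow> s v = Atom"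
  shows "runs (call c) (m + call_cost c) s (s(0 := y))"
proof -
  obtain s' where s': "runs c m s s'" "s' 0 = y" "\<And>v. com_bound c < v \<Longrightarrow> s' v = s v"
    using runs_in_store assms by metis
  have "(\<lambda>v. if 1 \<le> v \<and> v \<le> com_bound c then Atom else s' v) = s(0 := y)"
    using s'(2,3) assms(2) by (auto simp: fun_eq_iff not_le)
  then show ?thesis
    using runs_Seq[OF s'(1) runs_clear[of "com_bound c" s']]
    by (auto simp: call_def call_cost_def elim: runs_mono)
qed

section \<open>Closure of polynomial time under composition, pairing and branching\<close>

lemma poly_nat_mono: "m \<le> n \<Longrightarrow> poly p m \<le> poly p n" for p :: "nat poly"
  by (induction p) (auto intro!: mult_mono)

text \<open>Inputs and outputs are coded by arbitrary functions of a parameter \<open>x\<close>, so that a function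
  is computed relative to the data that are at hand. The size of the output is bounded separately,
  because a tree can be exponentially larger than the time it takes to build it.\<close>

definition poly_time :: "'e set \<Rightarrow> ('e \<Rightarrow> data) \<Rightarrow> ('e \<Rightarrow> data) \<Rightarrow> bool" where
  "poly_time D i f \<longleftrightarrow> (\<exists>c (p :: nat poly). \<forall>x\<in>D.
     computes_in c (poly p (size (i x))) (i x) (f x) \<and> size (f x) \<le> poly p (size (i x)))"

lemma computes_in_mono: "computes_in c m x y \<Longrightarrow> m \<le> n \<Longrightarrow> computes_in c n x y"
  by (metis computes_in_iff runs_mono)

lemma poly_timeI:
  fixes p q :: "nat poly"
  assumes "\<And>x. x \<in> D \<Longrightarrow> computes_in c (poly p (size (i x))) (i x) (f x)"
    and "\<And>x. x \<in> D \<Longrightarrow> size (f x) \<le> poly q (size (i x))"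
  shows "poly_time D i f"
  unfolding poly_time_def
proof (intro exI ballI conjI)
  fix x assume "x \<in> D"
  show "computes_in c (poly (p + q) (size (i x))) (i x) (f x)"
    by (rule computes_in_mono[OF assms(1)[OF \<open>x \<in> D\<close>]]) simp
  show "size (f x) \<le> poly (p + q) (size (i x))"
    using assms(2)[OF \<open>x \<in> D\<close>] by simp
qed

lemma poly_time_mono: "poly_time D' i f \<Longrightarrow> D \<subseteq> D' \<Longrightarrow> poly_time D i f"
  unfolding poly_time_def by (meson subsetD)

lemma poly_time_cong: "(\<And>x. x \<in> D \<Longrightarrow> f x = g x) \<Longrightarrow> poly_time D i f \<longleftrightarrow> poly_time D i g"
  unfolding poly_time_def by (metis (no_types, lifting))

lemma poly_time_expr:
  assumes "\<And>x. x \<in> D \<Longrightarrow> eval_expr e (initial_store (i x)) = f x"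
    and "\<And>x. x \<in> D \<Longrightarrow> size (f x) \<le> poly q (size (i x))"
  shows "poly_time D i f"
proof (rule poly_timeI[where p = "[:1 + expr_cost e:]" and q = q])
  fix x assume "x \<in> D"
  then show "computes_in (Assign 0 e) (poly [:1 + expr_cost e:] (size (i x))) (i x) (f x)"
    unfolding computes_in_iff using runs_Assign[of 0 e "initial_store (i x)"] assms(1) by auto
qed (use assms in auto)

lemma poly_time_input: "poly_time D i i"
  by (rule poly_time_expr[where e = "Var 0" and q = "[:0, 1:]"]) (auto simp: initial_store_def)

lemma poly_time_const: "poly_time D i (\<lambda>_. k)"
proof -
  obtain e where e: "\<And>s. eval_expr e s = k"
  proof -
    have "\<exists>e. \<forall>s. eval_expr e s = k"
    proof (induction k)
      case Atom
      then show ?case by (intro exI[of _ Nil_E]) simp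
    next
      case (Pair a b)
      then obtain e f where "\<forall>s. eval_expr e s = a" "\<forall>s. eval_expr f s = b" by auto
      then show ?case by (intro exI[of _ "Cons_E e f"]) simp
    qed
    then show ?thesis using that by blast
  qed
  then show ?thesis by (intro poly_time_expr[where e = e and q = "[:size k:]"]) auto
qed

text \<open>Here the separate bound on output sizes is used: the second program is polynomial in the
  size of the intermediate datum, which the first bounds by a polynomial in the input size.
  \<open>D'\<close> only has to contain the arguments that arise.\<close>

lemma poly_time_comp:
  assumes "poly_time D i (\<lambda>x. j (h x))" "poly_time D' j g" "\<And>x. x \<in> D \<Longrightarrow> h x \<in> D'"
  shows "poly_time D i (\<lambda>x. g (h x))"
proof -
  obtain c p where c: "\<And>x. x \<in> D \<Longrightarrow> computes_in c (poly p (size (i x))) (i x) (j (h x))"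
      "\<And>x. x \<in> D \<Longrightarrow> size (j (h x)) \<le> poly p (size (i x))"
    using assms(1) by (auto simp: poly_time_def)
  obtain d q where d: "\<And>x. x \<in> D' \<Longrightarrow> computes_in d (poly q (size (j x))) (j x) (g x)"
      "\<And>x. x \<in> D' \<Longrightarrow> size (g x) \<le> poly q (size (j x))"
    using assms(2) by (auto simp: poly_time_def)
  have le: "poly q (size (j (h x))) \<le> poly (pcompose q p) (size (i x))" if "x \<in> D" for x
    using c(2)[OF that] by (simp add: poly_pcompose poly_nat_mono)
  define b where "b = Seq (Seq c (clear (max (com_bound c) (com_bound d)))) d"
  show ?thesis
  proof (rule poly_timeI[where p = "p + pcompose q p + [:4 + 3 * max (com_bound c) (com_bound d):]"
        and q = "pcompose q p"])
    fix x assume x: "x \<in> D"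
    let ?n = "max (com_bound c) (com_bound d)"
    obtain s where s: "runs c (poly p (size (i x))) (initial_store (i x)) s" "s 0 = j (h x)"
        "\<And>v. com_bound c < v \<Longrightarrow> s v = Atom"
      using runs_in_store[of c _ "initial_store (i x)"] c(1)[OF x]
      by (auto simp: initial_store_def)
    have "(\<lambda>v. if 1 \<le> v \<and> v \<le> ?n then Atom else s v) = initial_store (j (h x))"
      using s(2,3) by (auto simp: initial_store_def fun_eq_iff not_le)
    then have *: "runs (Seq c (clear ?n)) (1 + poly p (size (i x)) + (2 + 3 * ?n))
        (initial_store (i x)) (initial_store (j (h x)))"
      using runs_Seq[OF s(1) runs_clear[of ?n s]] by simp
    obtain s' where s': "runs d (poly q (size (j (h x)))) (initial_store (j (h x))) s'"
        "s' 0 = g (h x)"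
      using d(1)[OF assms(3)[OF x]] by (auto simp: computes_in_iff)
    have "runs b (poly (p + pcompose q p + [:4 + 3 * ?n:]) (size (i x))) (initial_store (i x)) s'"
      unfolding b_def by (rule runs_mono[OF runs_Seq[OF * s'(1)]]) (use le[OF x] in simp)
    with s'(2) show "computes_in b (poly (p + pcompose q p + [:4 + 3 * ?n:]) (size (i x))) (i x) (g (h x))"
      by (auto simp: computes_in_iff)
  next
    fix x assume "x \<in> D"
    then show "size (g (h x)) \<le> poly (pcompose q p) (size (i x))"
      using d(2) assms(3) le le_trans by blast
  qed
qed

lemma poly_time_Pair:
  assumes "poly_time D i f" "poly_time D i g"
  shows "poly_time D i (\<lambda>x. Pair (f x) (g x))"
proof -
  obtain c p where c: "\<And>x. x \<in> D \<Longrightarrow> computes_in c (poly p (size (i x))) (i x) (f x)"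
      "\<And>x. x \<in> D \<Longrightarrow> size (f x) \<le> poly p (size (i x))"
    using assms(1) by (auto simp: poly_time_def)
  obtain d q where d: "\<And>x. x \<in> D \<Longrightarrow> computes_in d (poly q (size (i x))) (i x) (g x)"
      "\<And>x. x \<in> D \<Longrightarrow> size (g x) \<le> poly q (size (i x))"
    using assms(2) by (auto simp: poly_time_def)
  define n where "n = Suc (max (com_bound c) (com_bound d))"
  define b where "b = Seq (Assign n (Var 0)) (Seq (call c) (Seq (Assign (Suc n) (Var 0))
    (Seq (Assign 0 (Var n)) (Seq (call d) (Assign 0 (Cons_E (Var (Suc n)) (Var 0)))))))"
  show ?thesis
  \<comment> \<open>The four assignments take 2 + 2 + 2 + 4 steps, the five \<open>Seq\<close> one
    step each: 15 in total.\<close>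
  proof (rule poly_timeI[where p = "p + q + [:15 + call_cost c + call_cost d:]"
        and q = "p + q + [:1:]"])
    fix x assume x: "x \<in> D"
    define s1 where "s1 = (initial_store (i x))(n := i x)"
    define s2 where "s2 = s1(0 := f x)"
    define s3 where "s3 = s2(Suc n := f x)"
    define s4 where "s4 = s3(0 := i x)"
    define s5 where "s5 = s4(0 := g x)"
    define s6 where "s6 = s5(0 := Pair (f x) (g x))"
    have n: "n \<noteq> 0" by (simp add: n_def)
    have 1: "runs (Assign n (Var 0)) 2 (initial_store (i x)) s1"
      using runs_Assign[of n "Var 0" "initial_store (i x)"]
      by (simp add: s1_def initial_store_def eval_nat_numeral)
    have 2: "runs (call c) (poly p (size (i x)) + call_cost c) s1 s2"
      unfolding s2_def using n
      by (intro runs_call) (auto simp: s1_def initial_store_def n_def c(1)[OF x])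
    have 3: "runs (Assign (Suc n) (Var 0)) 2 s2 s3"
      using runs_Assign[of "Suc n" "Var 0" s2] by (simp add: s3_def s2_def eval_nat_numeral)
    have 4: "runs (Assign 0 (Var n)) 2 s3 s4"
      using runs_Assign[of 0 "Var n" s3] n
      by (simp add: s4_def s3_def s2_def s1_def eval_nat_numeral)
    have 5: "runs (call d) (poly q (size (i x)) + call_cost d) s4 s5"
      unfolding s5_def using n
      by (intro runs_call)
        (auto simp: s1_def s2_def s3_def s4_def initial_store_def n_def d(1)[OF x])
    have 6: "runs (Assign 0 (Cons_E (Var (Suc n)) (Var 0))) 4 s5 s6"
      using runs_Assign[of 0 "Cons_E (Var (Suc n)) (Var 0)" s5] n
      by (simp add: s6_def s5_def s4_def s3_def eval_nat_numeral)
    have "runs b (poly (p + q + [:15 + call_cost c + call_cost d:]) (size (i x))) (initial_store (i x)) s6"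
      unfolding b_def
      by (rule runs_mono[OF runs_Seq[OF 1 runs_Seq[OF 2 runs_Seq[OF 3 runs_Seq[OF 4 runs_Seq[OF 5 6]]]]]])
        simp
    then show "computes_in b (poly (p + q + [:15 + call_cost c + call_cost d:]) (size (i x))) (i x)
        (Pair (f x) (g x))"
      by (auto simp: computes_in_iff s6_def)
  next
    fix x assume "x \<in> D"
    then show "size (Pair (f x) (g x)) \<le> poly (p + q + [:1:]) (size (i x))"
      using c(2) d(2) by (simp add: add_mono)
  qed
qed

definition enc_bool :: "bool \<Rightarrow> data" where
  "enc_bool b = (if b then Pair Atom Atom else Atom)"

text \<open>Each branch has to be correct only where the test selects it. This matters for functions
  such as \<open>hd\<close> or the vertex cover program, which are under control only if the test
  has succeeded.\<close>

lemma poly_time_If: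
  assumes "poly_time D i (\<lambda>x. enc_bool (b x))"
    and "poly_time {x\<in>D. b x} i (\<lambda>x. e (f x))"
    and "poly_time {x\<in>D. \<not> b x} i (\<lambda>x. e (g x))"
  shows "poly_time D i (\<lambda>x. e (if b x then f x else g x))"
proof -
  obtain c p where c: "\<And>x. x \<in> D \<Longrightarrow> computes_in c (poly p (size (i x))) (i x) (enc_bool (b x))"
    using assms(1) by (auto simp: poly_time_def)
  obtain d q where d: "\<And>x. x \<in> D \<Longrightarrow> b x \<Longrightarrow> computes_in d (poly q (size (i x))) (i x) (e (f x))"
      "\<And>x. x \<in> D \<Longrightarrow> b x \<Longrightarrow> size (e (f x)) \<le> poly q (size (i x))"
    using assms(2) by (auto simp: poly_time_def)
  obtain d' q' where d': "\<And>x. x \<in> D \<Longrightarrow> \<not> b x \<Longrightarrow> computes_in d' (poly q' (size (i x))) (i x) (e (g x))"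
      "\<And>x. x \<in> D \<Longrightarrow> \<not> b x \<Longrightarrow> size (e (g x)) \<le> poly q' (size (i x))"
    using assms(3) by (auto simp: poly_time_def)
  define n where "n = Suc (max (com_bound c) (max (com_bound d) (com_bound d')))"
  define a where "a = Seq (Assign n (Var 0)) (Seq (call c) (Seq (Assign (Suc n) (Var 0))
    (Seq (Assign 0 (Var n)) (If (Var (Suc n)) d d'))))"
  show ?thesis
  proof (rule poly_timeI[where p = "p + q + q' + [:12 + call_cost c:]" and q = "q + q'"])
    fix x assume x: "x \<in> D"
    define s1 where "s1 = (initial_store (i x))(n := i x)"
    define s2 where "s2 = s1(0 := enc_bool (b x))"
    define s3 where "s3 = s2(Suc n := enc_bool (b x))"
    define s4 where "s4 = s3(0 := i x)"
    have n: "n \<noteq> 0" by (simp add: n_def)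
    have 1: "runs (Assign n (Var 0)) 2 (initial_store (i x)) s1"
      using runs_Assign[of n "Var 0" "initial_store (i x)"]
      by (simp add: s1_def initial_store_def eval_nat_numeral)
    have 2: "runs (call c) (poly p (size (i x)) + call_cost c) s1 s2"
      unfolding s2_def using n
      by (intro runs_call) (auto simp: s1_def initial_store_def n_def c(1)[OF x])
    have 3: "runs (Assign (Suc n) (Var 0)) 2 s2 s3"
      using runs_Assign[of "Suc n" "Var 0" s2] by (simp add: s3_def s2_def eval_nat_numeral)
    have 4: "runs (Assign 0 (Var n)) 2 s3 s4"
      using runs_Assign[of 0 "Var n" s3] n
      by (simp add: s4_def s3_def s2_def s1_def eval_nat_numeral)
    have s4: "s4 0 = i x" "s4 (Suc n) = enc_bool (b x)" "\<And>v. 0 < v \<Longrightarrow> v < n \<Longrightarrow> s4 v = Atom"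
      by (auto simp: s4_def s3_def s2_def s1_def initial_store_def)
    have "\<exists>s5. runs (If (Var (Suc n)) d d') (2 + (poly q (size (i x)) + poly q' (size (i x)))) s4 s5 \<and>
        s5 0 = e (if b x then f x else g x)"
    proof (cases "b x")
      case True
      obtain s5 where s5: "runs d (poly q (size (i x))) s4 s5" "s5 0 = e (f x)"
        using runs_in_store[of d "poly q (size (i x))" s4 "e (f x)"] d(1)[OF x True] s4
        by (metis le_imp_less_Suc max.cobounded1 max.coboundedI2 n_def order.trans)
      then have "runs d (poly q (size (i x)) + poly q' (size (i x))) s4 s5"
        by (auto elim: runs_mono)
      then have "runs (If (Var (Suc n)) d d')
          (1 + expr_cost (Var (Suc n)) + (poly q (size (i x)) + poly q' (size (i x)))) s4 s5"
        by (intro runs_If) (use True s4 in \<open>simp add: enc_bool_def\<close>)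
      with s5 True show ?thesis by (auto simp: eval_nat_numeral)
    next
      case False
      obtain s5 where s5: "runs d' (poly q' (size (i x))) s4 s5" "s5 0 = e (g x)"
        using runs_in_store[of d' "poly q' (size (i x))" s4 "e (g x)"] d'(1)[OF x False] s4
        by (metis le_imp_less_Suc max.cobounded2 max.coboundedI2 n_def order.trans)
      then have "runs d' (poly q (size (i x)) + poly q' (size (i x))) s4 s5"
        by (auto elim: runs_mono)
      then have "runs (If (Var (Suc n)) d d')
          (1 + expr_cost (Var (Suc n)) + (poly q (size (i x)) + poly q' (size (i x)))) s4 s5"
        by (intro runs_If) (use False s4 in \<open>simp add: enc_bool_def\<close>)
      with s5 False show ?thesis by (auto simp: eval_nat_numeral)
    qed
    then obtain s5 where s5: "runs (If (Var (Suc n)) d d') (2 + (poly q (size (i x)) + poly q' (size (i x)))) s4 s5"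
        "s5 0 = e (if b x then f x else g x)" by blast
    have "runs a (poly (p + q + q' + [:12 + call_cost c:]) (size (i x))) (initial_store (i x)) s5"
      unfolding a_def
      by (rule runs_mono[OF runs_Seq[OF 1 runs_Seq[OF 2 runs_Seq[OF 3 runs_Seq[OF 4 s5(1)]]]]]) simp
    then show "computes_in a (poly (p + q + q' + [:12 + call_cost c:]) (size (i x))) (i x)
        (e (if b x then f x else g x))"
      using s5(2) by (auto simp: computes_in_iff)
  next
    fix x assume "x \<in> D"
    then show "size (e (if b x then f x else g x)) \<le> poly (q + q') (size (i x))"
      using d(2) d'(2) by (auto simp: trans_le_add1 trans_le_add2)
  qed
qed

section \<open>Iteration over lists\<close>

lemma enc_list_eq_Atom_iff: "enc_list f xs = Atom \<longleftrightarrow> xs = []"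
  by (cases xs) auto

lemma length_le_size_enc_list: "length xs \<le> size (enc_list f xs)"
  by (induction xs) auto

lemma size_le_size_enc_list: "x \<in> set xs \<Longrightarrow> size (f x) \<le> size (enc_list f xs)"
  by (induction xs) auto

text \<open>The variables \<open>n\<close>, \<open>n + 1\<close> and \<open>n + 2\<close>, out of
  reach of \<open>c\<close>, hold the fixed parameter, the unread list and the current state. Per
  round, 20 leaves room for 15 steps of bookkeeping and 2 for the loop test. The bound
  \<open>m\<close> concerns only states that occur after a prefix of \<open>xs\<close>.\<close>

lemma runs_fold:
  fixes c :: com and eb :: "'b \<Rightarrow> data" and es :: "'s \<Rightarrow> data"
  defines "n \<equiv> Suc (com_bound c)"
  defines "body \<equiv> Seq (Assign 0 (Cons_E (Var n) (Cons_E (Hd_E (Var (n + 1))) (Var (n + 2)))))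
    (Seq (call c) (Seq (Assign (n + 2) (Var 0)) (Assign (n + 1) (Tl_E (Var (n + 1))))))"
  assumes "\<And>pre b suf. xs = pre @ b # suf \<Longrightarrow>
      computes_in c m (Pair X (Pair (eb b) (es (fold f pre st)))) (es (f b (fold f pre st)))"
    and "\<And>v. 0 < v \<Longrightarrow> v < n \<Longrightarrow> s v = Atom"
    and "s n = X" "s (n + 1) = enc_list eb xs" "s (n + 2) = es st"
  shows "\<exists>s'. runs (While (Var (n + 1)) body) (length xs * (m + call_cost c + 20) + 2) s s' \<and>
    s' (n + 2) = es (fold f xs st)"
  using assms(3-)
proof (induction xs arbitrary: st s)
  case Nil
  show ?case
    using runs_While_False[of "Var (n + 1)" s body] Nil by (auto simp: eval_nat_numeral)
next
  case (Cons b xs)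
  let ?y = "es (f b st)"
  define s1 where "s1 = s(0 := Pair X (Pair (eb b) (es st)))"
  define s2 where "s2 = s1(0 := ?y)"
  define s3 where "s3 = s2(n + 2 := ?y)"
  define s4 where "s4 = s3(n + 1 := enc_list eb xs)"
  have n: "n \<noteq> 0" by (simp add: n_def)
  have 1: "runs (Assign 0 (Cons_E (Var n) (Cons_E (Hd_E (Var (n + 1))) (Var (n + 2))))) 7 s s1"
    using runs_Assign[of 0 "Cons_E (Var n) (Cons_E (Hd_E (Var (n + 1))) (Var (n + 2)))" s] Cons.prems(3-)
    by (simp add: s1_def eval_nat_numeral)
  have 2: "runs (call c) (m + call_cost c) s1 s2"
    unfolding s2_def using Cons.prems(1)[of "[]" b xs] Cons.prems(2)
    by (intro runs_call) (auto simp: s1_def n_def)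
  have 3: "runs (Assign (n + 2) (Var 0)) 2 s2 s3"
    using runs_Assign[of "n + 2" "Var 0" s2] by (simp add: s3_def s2_def eval_nat_numeral)
  have 4: "runs (Assign (n + 1) (Tl_E (Var (n + 1)))) 3 s3 s4"
    using runs_Assign[of "n + 1" "Tl_E (Var (n + 1))" s3] Cons.prems(4) n
    by (simp add: s4_def s3_def s2_def s1_def eval_nat_numeral)
  have body: "runs body (m + call_cost c + 15) s s4"
    unfolding body_def by (rule runs_mono[OF runs_Seq[OF 1 runs_Seq[OF 2 runs_Seq[OF 3 4]]]]) simp
  have "\<exists>s'. runs (While (Var (n + 1)) body) (length xs * (m + call_cost c + 20) + 2) s4 s' \<and>
      s' (n + 2) = es (fold f xs (f b st))"
  proof (rule Cons.IH)
    fix pre b' suf assume "xs = pre @ b' # suf"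
    then show "computes_in c m (Pair X (Pair (eb b') (es (fold f pre (f b st)))))
        (es (f b' (fold f pre (f b st))))"
      using Cons.prems(1)[of "b # pre" b' suf] by simp
  qed (use Cons.prems n in \<open>auto simp: s4_def s3_def s2_def s1_def\<close>)
  then obtain s' where s': "runs (While (Var (n + 1)) body) (length xs * (m + call_cost c + 20) + 2) s4 s'"
    "s' (n + 2) = es (fold f xs (f b st))" by blast
  have "runs (While (Var (n + 1)) body) (length (b # xs) * (m + call_cost c + 20) + 2) s s'"
    by (rule runs_mono[OF runs_While_True[OF _ body s'(1)]]) (use Cons.prems(4) in auto)
  with s'(2) show ?case by auto
qed

lemma poly_time_fold_prefix:
  fixes q :: "nat poly"
  assumes l: "poly_time D i (\<lambda>x. enc_list eb (l x))"
    and s: "poly_time D i (\<lambda>x. es (s x))"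
    and step: "poly_time D' (\<lambda>e. Pair (i (fst e)) (Pair (eb (fst (snd e))) (es (snd (snd e)))))
      (\<lambda>e. es (f (fst e) (fst (snd e)) (snd (snd e))))"
    and D': "\<And>x pre b suf. x \<in> D \<Longrightarrow> l x = pre @ b # suf \<Longrightarrow> (x, b, fold (f x) pre (s x)) \<in> D'"
    and q: "\<And>x pre suf. x \<in> D \<Longrightarrow> l x = pre @ suf \<Longrightarrow>
      size (es (fold (f x) pre (s x))) \<le> poly q (size (i x))"
  shows "poly_time D i (\<lambda>x. es (fold (f x) (l x) (s x)))"
proof -
  let ?j = "\<lambda>x. Pair (i x) (Pair (enc_list eb (l x)) (es (s x)))"
  obtain c p where c: "\<And>e. e \<in> D' \<Longrightarrow>
      computes_in c (poly p (size (Pair (i (fst e)) (Pair (eb (fst (snd e))) (es (snd (snd e)))))))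
       (Pair (i (fst e)) (Pair (eb (fst (snd e))) (es (snd (snd e)))))
       (es (f (fst e) (fst (snd e)) (snd (snd e))))"
    using step by (auto simp: poly_time_def)
  define n where "n = Suc (com_bound c)"
  define body where "body = Seq (Assign 0 (Cons_E (Var n) (Cons_E (Hd_E (Var (n + 1))) (Var (n + 2)))))
    (Seq (call c) (Seq (Assign (n + 2) (Var 0)) (Assign (n + 1) (Tl_E (Var (n + 1))))))"
  define a where "a = Seq (Assign n (Hd_E (Var 0))) (Seq (Assign (n + 1) (Hd_E (Tl_E (Var 0))))
    (Seq (Assign (n + 2) (Tl_E (Tl_E (Var 0)))) (Seq (While (Var (n + 1)) body)
    (Assign 0 (Var (n + 2))))))"
  \<comment> \<open>The factor \<open>[:0, 1:]\<close> bounds the number of rounds. In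
    \<open>[:2, 1:] + q\<close> the 2 counts the two pairs around the input of a round, the linear
    part its parameter and list element, and \<open>q\<close> its state. The final 30 covers set-up,
    last test and output.\<close>
  define r where "r = [:0, 1:] * (pcompose p ([:2, 1:] + q) + [:call_cost c + 20:]) + [:30:]"
  have "poly_time D ?j (\<lambda>x. es (fold (f x) (l x) (s x)))"
  proof (rule poly_timeI[where p = r and q = q])
    fix x assume x: "x \<in> D"
    define m where "m = poly (pcompose p ([:2, 1:] + q)) (size (?j x))"
    define s1 where "s1 = (initial_store (?j x))(n := i x)"
    define s2 where "s2 = s1(n + 1 := enc_list eb (l x))"
    define s3 where "s3 = s2(n + 2 := es (s x))"
    have n: "n \<noteq> 0" by (simp add: n_def)
    have 1: "runs (Assign n (Hd_E (Var 0))) 3 (initial_store (?j x)) s1"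
      using runs_Assign[of n "Hd_E (Var 0)" "initial_store (?j x)"]
      by (simp add: s1_def initial_store_def eval_nat_numeral)
    have 2: "runs (Assign (n + 1) (Hd_E (Tl_E (Var 0)))) 4 s1 s2"
      using runs_Assign[of "n + 1" "Hd_E (Tl_E (Var 0))" s1] n
      by (simp add: s2_def s1_def initial_store_def eval_nat_numeral)
    have 3: "runs (Assign (n + 2) (Tl_E (Tl_E (Var 0)))) 4 s2 s3"
      using runs_Assign[of "n + 2" "Tl_E (Tl_E (Var 0))" s2] n
      by (simp add: s3_def s2_def s1_def initial_store_def eval_nat_numeral)
    have "\<exists>s4. runs (While (Var (n + 1)) body) (length (l x) * (m + call_cost c + 20) + 2) s3 s4 \<and>
        s4 (n + 2) = es (fold (f x) (l x) (s x))"
    proof (rule runs_fold[of "l x" c m "i x" eb es "f x" "s x" s3, folded n_def, folded body_def])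
      fix pre b suf assume l: "l x = pre @ b # suf"
      have "size (Pair (i x) (Pair (eb b) (es (fold (f x) pre (s x)))))
          \<le> poly ([:2, 1:] + q) (size (?j x))"
      proof -
        have "size (es (fold (f x) pre (s x))) \<le> poly q (size (i x))"
          by (rule q[OF x l])
        also have "\<dots> \<le> poly q (size (?j x))" by (intro poly_nat_mono) simp
        finally have "size (es (fold (f x) pre (s x))) \<le> poly q (size (?j x))" .
        moreover have "size (eb b) \<le> size (enc_list eb (l x))"
          by (rule size_le_size_enc_list) (simp add: l)
        ultimately show ?thesis by simp
      qed
      then have "poly p (size (Pair (i x) (Pair (eb b) (es (fold (f x) pre (s x)))))) \<le> m"
        unfolding m_def poly_pcompose by (rule poly_nat_mono)
      then show "computes_in c m (Pair (i x) (Pair (eb b) (es (fold (f x) pre (s x)))))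
          (es (f x b (fold (f x) pre (s x))))"
        using c[OF D'[OF x l]] by (auto elim: computes_in_mono)
    qed (use n in \<open>auto simp: s3_def s2_def s1_def initial_store_def\<close>)
    then obtain s4 where s4: "runs (While (Var (n + 1)) body) (length (l x) * (m + call_cost c + 20) + 2) s3 s4"
        "s4 (n + 2) = es (fold (f x) (l x) (s x))" by blast
    have 5: "runs (Assign 0 (Var (n + 2))) 2 s4 (s4(0 := es (fold (f x) (l x) (s x))))"
      using runs_Assign[of 0 "Var (n + 2)" s4] s4(2) by (simp add: eval_nat_numeral)
    have "length (l x) \<le> size (?j x)"
      using length_le_size_enc_list[of "l x" eb] by simp
    then have "length (l x) * (m + call_cost c + 20) \<le> size (?j x) * (m + call_cost c + 20)"
      by (rule mult_le_mono1)
    also have "size (?j x) * (m + call_cost c + 20) + 30 = poly r (size (?j x))"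
      unfolding r_def m_def by simp
    finally have time: "length (l x) * (m + call_cost c + 20) + 30 \<le> poly r (size (?j x))" by simp
    have "runs a (poly r (size (?j x))) (initial_store (?j x)) (s4(0 := es (fold (f x) (l x) (s x))))"
      unfolding a_def
      by (rule runs_mono[OF runs_Seq[OF 1 runs_Seq[OF 2 runs_Seq[OF 3 runs_Seq[OF s4(1) 5]]]]])
        (use time in simp)
    then show "computes_in a (poly r (size (?j x))) (?j x) (es (fold (f x) (l x) (s x)))"
      by (force simp: computes_in_iff)
  next
    fix x assume x: "x \<in> D"
    have "size (es (fold (f x) (l x) (s x))) \<le> poly q (size (i x))"
      using q[OF x, of "l x" "[]"] by simp
    also have "\<dots> \<le> poly q (size (?j x))" by (intro poly_nat_mono) simp
    finally show "size (es (fold (f x) (l x) (s x))) \<le> poly q (size (?j x))" .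
  qed
  moreover have "poly_time D i ?j"
    by (intro poly_time_Pair poly_time_input l s)
  ultimately show ?thesis
    using poly_time_comp[where h = "\<lambda>x. x" and j = ?j] by blast
qed

text \<open>The sizes of the intermediate states have to be bounded, here by the size of some \<open>h x\<close> that is
  itself computable: otherwise they could grow exponentially.\<close>

lemma poly_time_fold_bounded_prefix:
  assumes "poly_time D i (\<lambda>x. enc_list eb (l x))" "poly_time D i (\<lambda>x. es (s x))" "poly_time D i h"
    and h: "\<And>x pre suf. x \<in> D \<Longrightarrow> l x = pre @ suf \<Longrightarrow> size (es (fold (f x) pre (s x))) \<le> size (h x)"
    and D': "\<And>x pre b suf. x \<in> D \<Longrightarrow> l x = pre @ b # suf \<Longrightarrow> (x, b, fold (f x) pre (s x)) \<in> D'"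
    and step: "poly_time D' (\<lambda>e. Pair (i (fst e)) (Pair (eb (fst (snd e))) (es (snd (snd e)))))
      (\<lambda>e. es (f (fst e) (fst (snd e)) (snd (snd e))))"
  shows "poly_time D i (\<lambda>x. es (fold (f x) (l x) (s x)))"
proof -
  obtain q where "\<And>x. x \<in> D \<Longrightarrow> size (h x) \<le> poly q (size (i x))"
    using assms(3) by (auto simp: poly_time_def)
  with h have "\<And>x pre suf. x \<in> D \<Longrightarrow> l x = pre @ suf \<Longrightarrow>
      size (es (fold (f x) pre (s x))) \<le> poly q (size (i x))"
    by (meson le_trans)
  then show ?thesis
    by (intro poly_time_fold_prefix[OF assms(1,2) step D'])
qed

text \<open>The form for most loops: an invariant of the states supplies both the domain of the loop
  body and the size bound.\<close>

lemma poly_time_fold: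
  assumes "poly_time D i (\<lambda>x. enc_list eb (l x))" "poly_time D i (\<lambda>x. es (s x))" "poly_time D i h"
    and inv: "\<And>x. x \<in> D \<Longrightarrow> I x (s x)"
      "\<And>x b t. x \<in> D \<Longrightarrow> b \<in> set (l x) \<Longrightarrow> I x t \<Longrightarrow> I x (f x b t)"
    and h: "\<And>x t. x \<in> D \<Longrightarrow> I x t \<Longrightarrow> size (es t) \<le> size (h x)"
    and step: "poly_time {(x, b, t). x \<in> D \<and> b \<in> set (l x) \<and> I x t}
      (\<lambda>e. Pair (i (fst e)) (Pair (eb (fst (snd e))) (es (snd (snd e)))))
      (\<lambda>e. es (f (fst e) (fst (snd e)) (snd (snd e))))"
  shows "poly_time D i (\<lambda>x. es (fold (f x) (l x) (s x)))"
proof -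
  have I: "I x (fold (f x) pre (s x))" if "x \<in> D" "set pre \<subseteq> set (l x)" for x pre
    by (rule fold_invariant[where Q = "\<lambda>b. b \<in> set (l x)"]) (use inv that in auto)
  show ?thesis
    by (rule poly_time_fold_bounded_prefix[OF assms(1-3) _ _ step]) (auto intro!: I h)
qed

section \<open>Elementary operations on pairs, truth values and lists\<close>

lemma poly_time_first: "poly_time D i f \<Longrightarrow> poly_time D i (\<lambda>x. first (f x))"
proof (rule poly_time_comp[where j = "\<lambda>y. y" and D' = UNIV and g = first])
  have "size (first y) \<le> size y" for y by (cases y) auto
  then show "poly_time UNIV (\<lambda>y. y) first"
    by (intro poly_time_expr[where e = "Hd_E (Var 0)" and q = "[:0, 1:]"])
      (auto simp: initial_store_def)
qed auto

lemma poly_time_second: "poly_time D i f \<Longrightarrow> poly_time D i (\<lambda>x. second (f x))"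
proof (rule poly_time_comp[where j = "\<lambda>y. y" and D' = UNIV and g = second])
  have "size (second y) \<le> size y" for y by (cases y) auto
  then show "poly_time UNIV (\<lambda>y. y) second"
    by (intro poly_time_expr[where e = "Tl_E (Var 0)" and q = "[:0, 1:]"])
      (auto simp: initial_store_def)
qed auto

lemma poly_time_PairD:
  assumes "poly_time D i (\<lambda>x. Pair (f x) (g x))"
  shows "poly_time D i f" "poly_time D i g"
  using poly_time_first[OF assms] poly_time_second[OF assms] by auto

text \<open>In a loop body the data at hand are outer input, list element and state. This rule lifts
  outer computations into the body; the next two read the other components.\<close>

lemma poly_time_env:
  assumes "poly_time D i f" "\<And>e. e \<in> D' \<Longrightarrow> fst e \<in> D"
  shows "poly_time D' (\<lambda>e. Pair (i (fst e)) (Pair (eb (fst (snd e))) (es (snd (snd e)))))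
    (\<lambda>e. f (fst e))"
  by (rule poly_time_comp[where j = i and h = fst, OF _ assms]) (rule poly_time_PairD(1)[OF poly_time_input])

lemma poly_time_env_elem:
  "poly_time D' (\<lambda>e. Pair (i (fst e)) (Pair (eb (fst (snd e))) (es (snd (snd e)))))
    (\<lambda>e. eb (fst (snd e)))"
  by (rule poly_time_PairD(1)[OF poly_time_PairD(2)[OF poly_time_input]])

lemma poly_time_env_state:
  "poly_time D' (\<lambda>e. Pair (i (fst e)) (Pair (eb (fst (snd e))) (es (snd (snd e)))))
    (\<lambda>e. es (snd (snd e)))"
  by (rule poly_time_PairD(2)[OF poly_time_PairD(2)[OF poly_time_input]])

lemma size_enc_bool: "size (enc_bool b) = of_bool b"
  by (simp add: enc_bool_def)

lemma poly_time_True: "poly_time D i (\<lambda>x. enc_bool True)"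
  by (rule poly_time_const)

lemma poly_time_False: "poly_time D i (\<lambda>x. enc_bool False)"
  by (rule poly_time_const)

text \<open>Short-circuit evaluation: the second conjunct may rely on the first, for instance on a
  list being nonempty.\<close>

lemma poly_time_conj:
  assumes "poly_time D i (\<lambda>x. enc_bool (a x))" "poly_time {x\<in>D. a x} i (\<lambda>x. enc_bool (b x))"
  shows "poly_time D i (\<lambda>x. enc_bool (a x \<and> b x))"
proof -
  have "poly_time D i (\<lambda>x. enc_bool (if a x then b x else False))"
    by (rule poly_time_If[where e = enc_bool]) (intro poly_time_False assms)+
  then show ?thesis by (rule poly_time_cong[THEN iffD1, rotated]) auto
qed

lemma poly_time_not:
  assumes "poly_time D i (\<lambda>x. enc_bool (a x))"
  shows "poly_time D i (\<lambda>x. enc_bool (\<not> a x))"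
proof -
  have "poly_time D i (\<lambda>x. enc_bool (if a x then False else True))"
    by (rule poly_time_If[where e = enc_bool]) (intro poly_time_False poly_time_True assms)+
  then show ?thesis by (rule poly_time_cong[THEN iffD1, rotated]) auto
qed

lemma poly_time_disj:
  assumes "poly_time D i (\<lambda>x. enc_bool (a x))" "poly_time {x\<in>D. \<not> a x} i (\<lambda>x. enc_bool (b x))"
  shows "poly_time D i (\<lambda>x. enc_bool (a x \<or> b x))"
proof -
  have "poly_time D i (\<lambda>x. enc_bool (if a x then True else b x))"
    by (rule poly_time_If[where e = enc_bool]) (intro poly_time_True assms)+
  then show ?thesis by (rule poly_time_cong[THEN iffD1, rotated]) auto
qed

lemma poly_time_not_Atom:
  assumes "poly_time D i f"
  shows "poly_time D i (\<lambda>x. enc_bool (f x \<noteq> Atom))"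
proof -
  have *: "poly_time UNIV (\<lambda>y. y) (\<lambda>y. enc_bool (y \<noteq> Atom))"
  proof (rule poly_timeI[where p = "[:6:]" and q = "[:1:]"])
    fix y :: data
    let ?c = "If (Var 0) (Assign 0 (Cons_E Nil_E Nil_E)) (Assign 0 Nil_E)"
    have "runs ?c (1 + expr_cost (Var 0) + 4) (initial_store y)
        ((initial_store y)(0 := enc_bool (y \<noteq> Atom)))"
      using runs_Assign[of 0 "Cons_E Nil_E Nil_E" "initial_store y"]
        runs_Assign[of 0 "Nil_E" "initial_store y"]
      by (intro runs_If) (auto simp: initial_store_def enc_bool_def elim: runs_mono)
    then show "computes_in ?c (poly [:6:] (size y)) y (enc_bool (y \<noteq> Atom))"
      by (force simp: computes_in_iff)
  qed (simp add: enc_bool_def)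
  show ?thesis
    by (rule poly_time_comp[OF _ *]) (use assms in auto)
qed

lemma poly_time_not_Nil:
  assumes "poly_time D i (\<lambda>x. enc_list eb (l x))"
  shows "poly_time D i (\<lambda>x. enc_bool (l x \<noteq> []))"
  using poly_time_not_Atom[OF assms] by (simp add: enc_list_eq_Atom_iff)

lemma poly_time_Nil: "poly_time D i (\<lambda>x. enc_list eb [])"
  by (simp add: poly_time_const)

lemma poly_time_Cons:
  assumes "poly_time D i (\<lambda>x. eb (a x))" "poly_time D i (\<lambda>x. enc_list eb (l x))"
  shows "poly_time D i (\<lambda>x. enc_list eb (a x # l x))"
  using poly_time_Pair[OF assms] by simp

lemma poly_time_tl:
  assumes "poly_time D i (\<lambda>x. enc_list eb (l x))"
  shows "poly_time D i (\<lambda>x. enc_list eb (tl (l x)))"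
proof -
  have "second (enc_list eb l) = enc_list eb (tl l)" for l by (cases l) auto
  then show ?thesis using poly_time_second[OF assms] by simp
qed

lemma poly_time_hd:
  assumes "poly_time D i (\<lambda>x. enc_list eb (l x))" "\<And>x. x \<in> D \<Longrightarrow> l x \<noteq> []"
  shows "poly_time D i (\<lambda>x. eb (hd (l x)))"
proof -
  have "first (enc_list eb l) = eb (hd l)" if "l \<noteq> []" for l using that by (cases l) auto
  then show ?thesis
    using assms(2) by (intro poly_time_cong[THEN iffD1, OF _ poly_time_first[OF assms(1)]]) auto
qed

lemma size_enc_list_tl: "size (enc_list f (tl l)) \<le> size (enc_list f l)"
  by (cases l) auto

lemma size_enc_list: "size (enc_list f xs) = (\<Sum>x\<leftarrow>xs. Suc (size (f x)))"
  by (induction xs) auto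

lemma size_enc_list_append: "size (enc_list f (xs @ ys)) = size (enc_list f xs) + size (enc_list f ys)"
  by (simp add: size_enc_list)

lemma size_enc_list_rev: "size (enc_list f (rev xs)) = size (enc_list f xs)"
  by (simp add: size_enc_list rev_map[symmetric])

lemma size_enc_list_filter: "size (enc_list f (filter P xs)) \<le> size (enc_list f xs)"
  by (induction xs) auto

text \<open>The source of the size bounds for the loops on graphs: their states consist of distinct
  lists drawn from a known list of vertices. Hence the distinctness in all later invariants.\<close>

lemma size_enc_list_mono:
  assumes "distinct xs" "distinct ys" "set xs \<subseteq> set ys"
  shows "size (enc_list f xs) \<le> size (enc_list f ys)"
  unfolding size_enc_list using assms
  by (simp add: sum_list_distinct_conv_sum_set sum_mono2)

text \<open>Lengths are compared without arithmetic: one list loses an element for each element of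
  the other.\<close>

lemma poly_time_drop_length:
  assumes "poly_time D i (\<lambda>x. enc_list ea (xs x))" "poly_time D i (\<lambda>x. enc_list eb (ys x))"
  shows "poly_time D i (\<lambda>x. enc_list eb (drop (length (xs x)) (ys x)))"
proof -
  have *: "fold (\<lambda>_. tl) l ys = drop (length l) ys" for l ys
    by (induction l arbitrary: ys) (auto simp: drop_Suc)
  have "poly_time D i (\<lambda>x. enc_list eb (fold (\<lambda>_. tl) (xs x) (ys x)))"
    by (rule poly_time_fold[where h = "\<lambda>x. enc_list eb (ys x)" and
        I = "\<lambda>x t. size (enc_list eb t) \<le> size (enc_list eb (ys x))"])
      (auto intro: assms poly_time_tl poly_time_env_state le_trans[OF size_enc_list_tl])
  then show ?thesis unfolding * .
qed

lemma poly_time_length_less: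
  assumes "poly_time D i (\<lambda>x. enc_list ea (xs x))" "poly_time D i (\<lambda>x. enc_list eb (ys x))"
  shows "poly_time D i (\<lambda>x. enc_bool (length (xs x) < length (ys x)))"
  using poly_time_not_Nil[OF poly_time_drop_length[OF assms]] by (simp add: not_le)

lemma poly_time_length_le:
  assumes "poly_time D i (\<lambda>x. enc_list ea (xs x))" "poly_time D i (\<lambda>x. enc_list eb (ys x))"
  shows "poly_time D i (\<lambda>x. enc_bool (length (xs x) \<le> length (ys x)))"
  using poly_time_not[OF poly_time_length_less[OF assms(2,1)]] by (simp add: not_less)

section \<open>Equality of numbers, membership and list operations\<close>

fun bits :: "nat \<Rightarrow> bool list" where
  "bits n = (if n = 0 then [] else odd n # bits (n div 2))"

declare bits.simps [simp del]

lemma enc_nat_eq_bits: "enc_nat n = enc_list enc_bool (bits n)"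
proof (induction n rule: bits.induct)
  case (1 n)
  show ?case
    by (subst enc_nat.simps, subst bits.simps) (use 1 in \<open>auto simp: enc_bool_def[of True] enc_bool_def[of False]\<close>)
qed

lemma bits_inject: "bits m = bits n \<longleftrightarrow> m = n"
proof
  assume "bits m = bits n"
  then show "m = n"
  proof (induction m arbitrary: n rule: bits.induct)
    case (1 m)
    show ?case
    proof (cases "m = 0 \<or> n = 0")
      case True
      with 1(2) show ?thesis by (subst (asm) (1 2) bits.simps) (auto split: if_splits)
    next
      case False
      with 1(2) have "odd m = odd n" "bits (m div 2) = bits (n div 2)"
        by (subst (asm) (1 2) bits.simps; simp)+
      with 1(1) False have "m div 2 = n div 2" by blast
      with \<open>odd m = odd n\<close> show ?thesis by (metis bit_eq_rec)
    qed
  qed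
qed simp

lemma poly_time_bool_eq:
  assumes "poly_time D i (\<lambda>x. enc_bool (a x))" "poly_time D i (\<lambda>x. enc_bool (b x))"
  shows "poly_time D i (\<lambda>x. enc_bool (a x = b x))"
proof -
  have "poly_time D i (\<lambda>x. enc_bool (if a x then b x else \<not> b x))"
    by (rule poly_time_If[where e = enc_bool])
      (auto intro: poly_time_not assms poly_time_mono[OF assms(2)])
  then show ?thesis by (rule poly_time_cong[THEN iffD1, rotated]) auto
qed

text \<open>A single pass over \<open>xs\<close> consumes \<open>ys\<close> and keeps a flag for
  agreement so far. The lists are equal iff the flag survives and nothing of \<open>ys\<close> is
  left over.\<close>

lemma poly_time_bools_eq:
  fixes D :: "'a set"
  assumes "poly_time D i (\<lambda>x. enc_list enc_bool (xs x))" "poly_time D i (\<lambda>x. enc_list enc_bool (ys x))"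
  shows "poly_time D i (\<lambda>x. enc_bool (xs x = ys x))"
proof -
  let ?f = "\<lambda>b t. (fst t \<and> snd t \<noteq> [] \<and> hd (snd t) = b, tl (snd t))"
  let ?es = "\<lambda>t. Pair (enc_bool (fst t)) (enc_list enc_bool (snd t))"
  have *: "fold ?f xs (ok, ys) = (ok \<and> take (length xs) ys = xs, drop (length xs) ys)"
    for ok :: bool and xs ys :: "bool list"
  proof (induction xs arbitrary: ok ys)
    case (Cons b xs)
    then show ?case by (cases ys) auto
  qed simp
  have "poly_time D i (\<lambda>x. ?es (fold ?f (xs x) (True, ys x)))"
  proof (rule poly_time_fold[where h = "\<lambda>x. Pair (enc_bool True) (enc_list enc_bool (ys x))" and
        I = "\<lambda>x t. size (enc_list enc_bool (snd t)) \<le> size (enc_list enc_bool (ys x))" and s = "\<lambda>x. (True, ys x)"])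
    let ?D = "{(x, b, t). x \<in> D \<and> b \<in> set (xs x) \<and>
        size (enc_list enc_bool (snd t)) \<le> size (enc_list enc_bool (ys x))}"
    let ?j = "\<lambda>e. Pair (i (fst e)) (Pair (enc_bool (fst (snd e))) (?es (snd (snd e))))"
    have fst: "poly_time D' ?j (\<lambda>e. enc_bool (fst (snd (snd e))))"
      and snd: "poly_time D' ?j (\<lambda>e. enc_list enc_bool (snd (snd (snd e))))"
      for D' :: "('a \<times> bool \<times> bool \<times> bool list) set"
      by (rule poly_time_PairD[OF poly_time_env_state])+
    show "poly_time ?D ?j
       (\<lambda>e. ?es (fst (snd (snd e)) \<and> snd (snd (snd e)) \<noteq> [] \<and> hd (snd (snd (snd e))) = fst (snd e),
           tl (snd (snd (snd e)))))"
      unfolding fst_conv snd_conv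
      by (intro poly_time_Pair poly_time_conj poly_time_bool_eq fst poly_time_not_Nil[where eb = enc_bool] poly_time_hd
          poly_time_tl snd poly_time_env_elem) auto
  next
    show "poly_time D i (\<lambda>x. ?es (True, ys x))"
      "poly_time D i (\<lambda>x. Pair (enc_bool True) (enc_list enc_bool (ys x)))"
      unfolding fst_conv snd_conv by (intro poly_time_Pair poly_time_True assms)+
  next
    fix x and b :: bool and t :: "bool \<times> bool list"
    assume t: "size (enc_list enc_bool (snd t)) \<le> size (enc_list enc_bool (ys x))"
    then show "size (enc_list enc_bool (snd (fst t \<and> snd t \<noteq> [] \<and> hd (snd t) = b, tl (snd t))))
        \<le> size (enc_list enc_bool (ys x))"
      using size_enc_list_tl[of enc_bool "snd t"] by simp
    show "size (?es t) \<le> size (Pair (enc_bool True) (enc_list enc_bool (ys x)))"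
      using t by (auto simp: size_enc_bool)
  qed (use assms in auto)
  then have "poly_time D i (\<lambda>x. ?es (take (length (xs x)) (ys x) = xs x, drop (length (xs x)) (ys x)))"
    by (simp only: * simp_thms)
  from poly_time_PairD[OF this]
  have "poly_time D i (\<lambda>x. enc_bool (take (length (xs x)) (ys x) = xs x))"
    "poly_time D i (\<lambda>x. enc_list enc_bool (drop (length (xs x)) (ys x)))" by simp_all
  then have "poly_time D i (\<lambda>x. enc_bool (take (length (xs x)) (ys x) = xs x \<and>
      \<not> drop (length (xs x)) (ys x) \<noteq> []))"
    by (intro poly_time_conj poly_time_not poly_time_not_Nil[where eb = enc_bool])
      (auto elim: poly_time_mono)
  moreover have "take (length xs) ys = xs \<and> \<not> drop (length xs) ys \<noteq> [] \<longleftrightarrow> xs = ys"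
    for xs ys :: "bool list"
    by auto
  ultimately show ?thesis by (simp only:)
qed

lemma poly_time_nat_eq:
  assumes "poly_time D i (\<lambda>x. enc_nat (a x))" "poly_time D i (\<lambda>x. enc_nat (b x))"
  shows "poly_time D i (\<lambda>x. enc_bool (a x = b x))"
  using poly_time_bools_eq[of D i "\<lambda>x. bits (a x)" "\<lambda>x. bits (b x)"] assms
  by (simp add: enc_nat_eq_bits bits_inject)

lemma poly_time_member:
  assumes "poly_time D i (\<lambda>x. enc_nat (a x))" "poly_time D i (\<lambda>x. enc_list enc_nat (l x))"
  shows "poly_time D i (\<lambda>x. enc_bool (a x \<in> set (l x)))"
proof -
  have *: "fold (\<lambda>b t. t \<or> a = b) l t \<longleftrightarrow> t \<or> a \<in> set l" for a :: nat and l t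
    by (induction l arbitrary: t) auto
  have "poly_time D i (\<lambda>x. enc_bool (fold (\<lambda>b t. t \<or> a x = b) (l x) False))"
    by (rule poly_time_fold[where h = "\<lambda>x. enc_bool True" and I = "\<lambda>_ _. True"])
      (auto intro!: assms poly_time_False poly_time_True poly_time_disj poly_time_nat_eq
        poly_time_env_state poly_time_env_elem poly_time_env[OF assms(1)] simp: size_enc_bool)
  then show ?thesis by (simp add: *)
qed

text \<open>Lists can only be built by adding in front, so a loop reverses what it copies; order is
  restored by a second reversal.\<close>

lemma poly_time_rev_append:
  assumes "poly_time D i (\<lambda>x. enc_list eb (xs x))" "poly_time D i (\<lambda>x. enc_list eb (ys x))"
  shows "poly_time D i (\<lambda>x. enc_list eb (rev (xs x) @ ys x))"
proof -
  have "poly_time D i (\<lambda>x. enc_list eb (fold (\<lambda>b t. b # t) (xs x) (ys x)))"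
  proof (rule poly_time_fold_bounded_prefix[where D' = UNIV and
        h = "\<lambda>x. Pair (enc_list eb (xs x)) (enc_list eb (ys x))"])
    fix x pre suf assume "xs x = pre @ suf"
    then show "size (enc_list eb (fold (\<lambda>b t. b # t) pre (ys x)))
        \<le> size (Pair (enc_list eb (xs x)) (enc_list eb (ys x)))"
      by (simp add: fold_Cons_rev size_enc_list_append size_enc_list_rev)
  qed (auto intro!: assms poly_time_Pair poly_time_Cons poly_time_env_elem poly_time_env_state
      simp del: enc_list.simps)
  then show ?thesis by (simp add: fold_Cons_rev)
qed

lemma poly_time_rev:
  assumes "poly_time D i (\<lambda>x. enc_list eb (xs x))"
  shows "poly_time D i (\<lambda>x. enc_list eb (rev (xs x)))"
  using poly_time_rev_append[OF assms poly_time_Nil] by simp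

lemma poly_time_append:
  assumes "poly_time D i (\<lambda>x. enc_list eb (xs x))" "poly_time D i (\<lambda>x. enc_list eb (ys x))"
  shows "poly_time D i (\<lambda>x. enc_list eb (xs x @ ys x))"
  using poly_time_rev_append[OF poly_time_rev[OF assms(1)] assms(2)] by simp

lemma poly_time_filter:
  fixes D :: "'a set" and eb :: "'b \<Rightarrow> data"
  assumes "poly_time D i (\<lambda>x. enc_list eb (l x))"
    and "poly_time {(x, b). x \<in> D \<and> b \<in> set (l x)} (\<lambda>e. Pair (i (fst e)) (eb (snd e)))
      (\<lambda>e. enc_bool (Q (fst e) (snd e)))"
  shows "poly_time D i (\<lambda>x. enc_list eb (filter (Q x) (l x)))"
proof -
  have *: "fold (\<lambda>b t. if Q b then b # t else t) l t = rev (filter Q l) @ t" for Q and l t :: "'b list"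
    by (induction l arbitrary: t) auto
  have "poly_time D i (\<lambda>x. enc_list eb (fold (\<lambda>b t. if Q x b then b # t else t) (l x) []))"
  proof (rule poly_time_fold_bounded_prefix[where h = "\<lambda>x. enc_list eb (l x)" and
        D' = "{(x, b, t). x \<in> D \<and> b \<in> set (l x)}"])
    fix x pre suf assume "l x = pre @ suf"
    then show "size (enc_list eb (fold (\<lambda>b t. if Q x b then b # t else t) pre [])) \<le> size (enc_list eb (l x))"
      by (simp add: * size_enc_list_append size_enc_list_rev trans_le_add1 size_enc_list_filter)
  next
    let ?j = "\<lambda>e. Pair (i (fst e)) (Pair (eb (fst (snd e))) (enc_list eb (snd (snd e))))"
    let ?D' = "{(x, b, t). x \<in> D \<and> b \<in> set (l x)} :: ('a \<times> 'b \<times> 'b list) set"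
    have "poly_time ?D' ?j (\<lambda>e. enc_bool (Q (fst (fst e, fst (snd e))) (snd (fst e, fst (snd e)))))"
      by (rule poly_time_comp[OF _ assms(2), where h = "\<lambda>e. (fst e, fst (snd e))"])
        (auto intro!: poly_time_Pair poly_time_env_elem poly_time_env[OF poly_time_input, of _ UNIV])
    then show "poly_time ?D' ?j
       (\<lambda>e. enc_list eb (if Q (fst e) (fst (snd e)) then fst (snd e) # snd (snd e) else snd (snd e)))"
      by (intro poly_time_If[where e = "enc_list eb"] poly_time_Cons poly_time_env_elem poly_time_env_state)
        simp
  qed (auto intro: assms poly_time_const)
  then have "poly_time D i (\<lambda>x. enc_list eb (rev (filter (Q x) (l x))))"
    by (simp add: *)
  from poly_time_rev[OF this] show ?thesis by simp
qed

lemma poly_time_filter_env: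
  assumes "poly_time D i f" "\<And>e. e \<in> D' \<Longrightarrow> fst e \<in> D"
  shows "poly_time D' (\<lambda>e. Pair (i (fst e)) (eb (snd e))) (\<lambda>e. f (fst e))"
  by (rule poly_time_comp[where j = i and h = fst, OF _ assms]) (rule poly_time_PairD(1)[OF poly_time_input])

lemma poly_time_filter_elem: "poly_time D' (\<lambda>e. Pair (i (fst e)) (eb (snd e))) (\<lambda>e. eb (snd e))"
  by (rule poly_time_PairD(2)[OF poly_time_input])

lemma poly_time_insert:
  assumes "poly_time D i (\<lambda>x. enc_nat (a x))" "poly_time D i (\<lambda>x. enc_list enc_nat (l x))"
  shows "poly_time D i (\<lambda>x. enc_list enc_nat (List.insert (a x) (l x)))"
  unfolding List.insert_def
  by (rule poly_time_If[where e = "enc_list enc_nat"])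
    (auto intro: poly_time_member poly_time_Cons poly_time_mono[OF assms(1)]
      poly_time_mono[OF assms(2)] assms simp del: enc_list.simps)

section \<open>The algorithm\<close>

text \<open>Both orientations of each edge, so that the members form the adjacency relation. The
  reversal is what a loop adding in front produces.\<close>

definition arcs :: "('a \<times> 'a) list \<Rightarrow> ('a \<times> 'a) list" where
  "arcs es = rev (map prod.swap es) @ es"

definition grow :: "('a \<times> 'a) list \<Rightarrow> 'a list \<Rightarrow> 'a list \<Rightarrow> 'a list" where
  "grow d X = fold (\<lambda>a t. if fst a \<in> set t \<and> snd a \<in> set X \<and> snd a \<notin> set t then snd a # t else t) d"

text \<open>\<open>d\<close> occurs twice: as the arcs scanned in each pass, and as the counter of
  passes.\<close>

definition component :: "('a \<times> 'a) list \<Rightarrow> 'a list \<Rightarrow> 'a \<Rightarrow> 'a list" where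
  "component d X u = fold (\<lambda>_. grow d X) d [u]"

text \<open>In a connected graph each component that remains after removal of a vertex contains a
  neighbour of it, so the arcs within \<open>R\<close> propose every pair of a vertex and such a
  component. The empty list means that nothing has been proposed yet; a component is never
  empty.\<close>

definition smaller_component ::
    "(nat \<times> nat) list \<Rightarrow> nat list \<Rightarrow> nat \<times> nat \<Rightarrow> nat \<times> nat list \<Rightarrow> nat \<times> nat list" where
  "smaller_component d R a t =
     (if fst a \<in> set R \<and> snd a \<in> set R \<and>
       (snd t = [] \<or> length (component d (removeAll (fst a) R) (snd a)) < length (snd t))
      then (fst a, component d (removeAll (fst a) R) (snd a)) else t)"

definition smallest_component :: "(nat \<times> nat) list \<Rightarrow> nat list \<Rightarrow> nat \<times> nat list" where
  "smallest_component d R = fold (smaller_component d R) d (0, [])"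

text \<open>A state \<open>(R, P, W)\<close> consists of the remaining vertices, the vertices chosen so far, and
  vertices that are chosen or dominated from the part of the graph already removed.\<close>

type_synonym state = "nat list \<times> nat list \<times> nat list"

text \<open>\<open>solve\<close> stands for the given vertex cover algorithm.\<close>

definition cover :: "(nat list \<Rightarrow> (nat \<times> nat) list \<Rightarrow> nat list) \<Rightarrow>
    (nat \<times> nat) list \<Rightarrow> nat list \<Rightarrow> nat list \<Rightarrow> nat list" where
  "cover solve es A W = solve A
     (filter (\<lambda>e. fst e \<in> set A \<and> snd e \<in> set A \<and> \<not> (fst e \<in> set W \<and> snd e \<in> set W)) es)"

text \<open>\<open>X\<^sub>3\<close> is tried first because at equal cost it also settles the
  domination of \<open>v\<close>; \<open>X\<^sub>2\<close> comes next because it spends nothing on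
  \<open>v\<close>.\<close>

definition reduce :: "nat list \<Rightarrow> nat list \<Rightarrow> nat list \<Rightarrow> nat list \<Rightarrow> nat \<Rightarrow> nat list \<Rightarrow>
    nat list \<Rightarrow> nat list \<Rightarrow> state" where
  "reduce R P W C v X\<^sub>1 X\<^sub>2 X\<^sub>3 =
     (if length X\<^sub>3 \<le> length X\<^sub>1 then (filter (\<lambda>w. w \<notin> set C) R, X\<^sub>3 @ P, List.insert v W)
      else if length X\<^sub>2 \<le> length X\<^sub>1 then (filter (\<lambda>w. w \<notin> set C) R, X\<^sub>2 @ P, W)
      else (filter (\<lambda>w. w \<notin> set C) R, List.insert v (X\<^sub>1 @ P), W))"

text \<open>Without a component the state stays as it is, so the number of rounds can be fixed
  beforehand. If \<open>v\<close> was chosen earlier, \<open>B\<close> drops it, the three queries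
  coincide, and the first case of \<open>reduce\<close> applies.\<close>

definition step :: "(nat list \<Rightarrow> (nat \<times> nat) list \<Rightarrow> nat list) \<Rightarrow> (nat \<times> nat) list \<Rightarrow> state \<Rightarrow> state" where
  "step solve es t =
     (let R = fst t; P = fst (snd t); W = snd (snd t);
        v = fst (smallest_component (arcs es) R); C = snd (smallest_component (arcs es) R);
        A = filter (\<lambda>w. w \<notin> set P) C; B = filter (\<lambda>w. w \<notin> set P) (v # C)
      in if C = [] then t
         else reduce R P W C v (cover solve es A W) (cover solve es B (List.insert v W))
           (cover solve es B W))"

text \<open>The one vertex left has no neighbours to dominate it, hence has to be taken unless it is
  already chosen or dominated.\<close>

definition finish :: "state \<Rightarrow> nat list" where
  "finish t = filter (\<lambda>v. v \<notin> set (fst (snd t)) \<and> v \<notin> set (snd (snd t))) (fst t) @ fst (snd t)"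

definition algorithm :: "(nat list \<Rightarrow> (nat \<times> nat) list \<Rightarrow> nat list) \<Rightarrow>
    nat list \<Rightarrow> (nat \<times> nat) list \<Rightarrow> nat list" where
  "algorithm solve vs es = finish (fold (\<lambda>_. step solve es) vs (vs, [], []))"

section \<open>Running time of the algorithm\<close>

abbreviation "enc_nats \<equiv> enc_list enc_nat"
abbreviation "enc_edges \<equiv> enc_list enc_edge"

lemma poly_time_edge:
  assumes "poly_time D i (\<lambda>x. enc_edge (a x))"
  shows "poly_time D i (\<lambda>x. enc_nat (fst (a x)))" "poly_time D i (\<lambda>x. enc_nat (snd (a x)))"
  using poly_time_PairD[OF assms[unfolded enc_edge_def]] by auto

lemma poly_time_arcs:
  assumes "poly_time D i (\<lambda>x. enc_edges (es x))"
  shows "poly_time D i (\<lambda>x. enc_edges (arcs (es x)))"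
proof -
  have *: "fold (\<lambda>e t. (snd e, fst e) # t) xs t = rev (map prod.swap xs) @ t"
    for xs t :: "(nat \<times> nat) list"
    by (induction xs arbitrary: t) (auto simp: prod.swap_def)
  have swap: "size (enc_edges (map prod.swap xs)) = size (enc_edges xs)" for xs
    by (induction xs) (auto simp: enc_edge_def)
  have "poly_time D i (\<lambda>x. enc_edges (fold (\<lambda>e t. (snd e, fst e) # t) (es x) (es x)))"
  proof (rule poly_time_fold_bounded_prefix[where D' = UNIV and
        h = "\<lambda>x. Pair (enc_edges (es x)) (enc_edges (es x))"])
    fix x pre suf assume "es x = pre @ suf"
    then show "size (enc_edges (fold (\<lambda>e t. (snd e, fst e) # t) pre (es x)))
        \<le> size (Pair (enc_edges (es x)) (enc_edges (es x)))"
      by (simp add: * size_enc_list_append size_enc_list_rev swap)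
  next
    let ?j = "\<lambda>e. Pair (i (fst e)) (Pair (enc_edge (fst (snd e))) (enc_edges (snd (snd e))))"
    have "poly_time UNIV ?j (\<lambda>e. enc_edge (snd (fst (snd e)), fst (fst (snd e))))"
      unfolding enc_edge_def[of "(_, _)"] fst_conv snd_conv
      by (intro poly_time_Pair poly_time_edge poly_time_env_elem)
    then show "poly_time UNIV ?j (\<lambda>e. enc_edges ((snd (fst (snd e)), fst (fst (snd e))) # snd (snd e)))"
      by (intro poly_time_Cons poly_time_env_state)
  qed (auto intro: assms poly_time_Pair)
  then show ?thesis by (simp add: * arcs_def)
qed

lemma grow_invariant:
  assumes "distinct t" "set t \<subseteq> set X"
  shows "distinct (grow d X t) \<and> set (grow d X t) \<subseteq> set X"
  unfolding grow_def
  by (rule fold_invariant[where Q = "\<lambda>_. True"]) (use assms in auto)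

lemma component_invariant:
  assumes "u \<in> set X"
  shows "distinct (component d X u) \<and> set (component d X u) \<subseteq> set X"
  unfolding component_def
  by (rule fold_invariant[where Q = "\<lambda>_. True"]) (use assms grow_invariant in auto)

lemma poly_time_grow:
  assumes d: "poly_time D i (\<lambda>x. enc_edges (d x))"
    and X: "poly_time D i (\<lambda>x. enc_nats (X x))"
    and t: "poly_time D i (\<lambda>x. enc_nats (t x))"
    and inv: "\<And>x. x \<in> D \<Longrightarrow> distinct (X x) \<and> distinct (t x) \<and> set (t x) \<subseteq> set (X x)"
  shows "poly_time D i (\<lambda>x. enc_nats (grow (d x) (X x) (t x)))"
  unfolding grow_def
proof (rule poly_time_fold[OF d, where h = "\<lambda>x. enc_nats (X x)" and I = "\<lambda>x t. distinct t \<and> set t \<subseteq> set (X x)"])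
  let ?D = "{(x, b, t). x \<in> D \<and> b \<in> set (d x) \<and> distinct t \<and> set t \<subseteq> set (X x)}"
  let ?j = "\<lambda>e. Pair (i (fst e)) (Pair (enc_edge (fst (snd e))) (enc_nats (snd (snd e))))"
  show "poly_time ?D ?j (\<lambda>e. enc_nats (if fst (fst (snd e)) \<in> set (snd (snd e)) \<and>
      snd (fst (snd e)) \<in> set (X (fst e)) \<and> snd (fst (snd e)) \<notin> set (snd (snd e))
      then snd (fst (snd e)) # snd (snd e) else snd (snd e)))"
    by (intro poly_time_If[where e = enc_nats] poly_time_conj poly_time_not poly_time_member
        poly_time_Cons poly_time_edge poly_time_env_elem poly_time_env_state poly_time_env[OF X]) auto
qed (use inv t X in \<open>auto intro: size_enc_list_mono\<close>)

lemma poly_time_component: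
  assumes d: "poly_time D i (\<lambda>x. enc_edges (d x))"
    and X: "poly_time D i (\<lambda>x. enc_nats (X x))"
    and u: "poly_time D i (\<lambda>x. enc_nat (u x))"
    and inv: "\<And>x. x \<in> D \<Longrightarrow> distinct (X x) \<and> u x \<in> set (X x)"
  shows "poly_time D i (\<lambda>x. enc_nats (component (d x) (X x) (u x)))"
  unfolding component_def
proof (rule poly_time_fold[OF d, where h = "\<lambda>x. enc_nats (X x)" and I = "\<lambda>x t. distinct t \<and> set t \<subseteq> set (X x)"])
  let ?D = "{(x, b, t). x \<in> D \<and> b \<in> set (d x) \<and> distinct t \<and> set t \<subseteq> set (X x)}"
  let ?j = "\<lambda>e. Pair (i (fst e)) (Pair (enc_edge (fst (snd e))) (enc_nats (snd (snd e))))"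
  show "poly_time ?D ?j (\<lambda>e. enc_nats (grow (d (fst e)) (X (fst e)) (snd (snd e))))"
    by (intro poly_time_grow poly_time_env_state poly_time_env[OF X] poly_time_env[OF d])
      (use inv in auto)
  show "poly_time D i (\<lambda>x. enc_nats [u x])"
    by (intro poly_time_Cons u poly_time_Nil)
next
  fix x and b :: "nat \<times> nat" and t assume "distinct t \<and> set t \<subseteq> set (X x)"
  then show "distinct (grow (d x) (X x) t) \<and> set (grow (d x) (X x) t) \<subseteq> set (X x)"
    using grow_invariant by blast
qed (use inv X in \<open>auto intro: size_enc_list_mono\<close>)

lemma poly_time_removeAll:
  assumes a: "poly_time D i (\<lambda>x. enc_nat (a x))" and l: "poly_time D i (\<lambda>x. enc_nats (l x))"
  shows "poly_time D i (\<lambda>x. enc_nats (removeAll (a x) (l x)))"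
proof -
  have "poly_time D i (\<lambda>x. enc_nats (filter (\<lambda>b. a x \<noteq> b) (l x)))"
  proof (rule poly_time_filter[OF l])
    show "poly_time {(x, b). x \<in> D \<and> b \<in> set (l x)} (\<lambda>e. Pair (i (fst e)) (enc_nat (snd e)))
        (\<lambda>e. enc_bool (a (fst e) \<noteq> snd e))"
      by (intro poly_time_not poly_time_nat_eq poly_time_filter_env[OF a] poly_time_filter_elem) auto
  qed
  then show ?thesis by (simp add: removeAll_filter_not_eq)
qed

lemma poly_time_filter_notin:
  assumes l: "poly_time D i (\<lambda>x. enc_nats (l x))" and l': "poly_time D i (\<lambda>x. enc_nats (l' x))"
  shows "poly_time D i (\<lambda>x. enc_nats (filter (\<lambda>w. w \<notin> set (l' x)) (l x)))"
  by (rule poly_time_filter[OF l])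
    (intro poly_time_not poly_time_member poly_time_filter_env[OF l'] poly_time_filter_elem, auto)

definition enc_choice :: "nat \<times> nat list \<Rightarrow> data" where
  "enc_choice t = Pair (enc_nat (fst t)) (enc_nats (snd t))"

lemma poly_time_choice:
  assumes "poly_time D i (\<lambda>x. enc_choice (f x))"
  shows "poly_time D i (\<lambda>x. enc_nat (fst (f x)))" "poly_time D i (\<lambda>x. enc_nats (snd (f x)))"
  using poly_time_PairD[OF assms[unfolded enc_choice_def]] by auto

definition valid_choice :: "nat list \<Rightarrow> nat \<times> nat list \<Rightarrow> bool" where
  "valid_choice R t \<longleftrightarrow>
     t = (0, []) \<or> fst t \<in> set R \<and> distinct (snd t) \<and> set (snd t) \<subseteq> set R - {fst t}"

lemma valid_smaller_component:
  assumes "valid_choice R t" "fst a \<noteq> snd a"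
  shows "valid_choice R (smaller_component d R a t)"
  using assms component_invariant[of "snd a" "removeAll (fst a) R" d]
  by (auto simp: valid_choice_def smaller_component_def)

lemma valid_smallest_component:
  assumes "\<And>a. a \<in> set d \<Longrightarrow> fst a \<noteq> snd a"
  shows "valid_choice R (smallest_component d R)"
  unfolding smallest_component_def
  by (rule fold_invariant[where Q = "\<lambda>a. a \<in> set d"])
    (use assms in \<open>force intro: valid_smaller_component simp: valid_choice_def[of _ "(0, [])"]\<close>)+

lemma poly_time_smallest_component:
  assumes d: "poly_time D i (\<lambda>x. enc_edges (d x))"
    and R: "poly_time D i (\<lambda>x. enc_nats (R x))"
    and inv: "\<And>x. x \<in> D \<Longrightarrow> distinct (R x)" "\<And>x a. x \<in> D \<Longrightarrow> a \<in> set (d x) \<Longrightarrow> fst a \<noteq> snd a"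
  shows "poly_time D i (\<lambda>x. enc_choice (smallest_component (d x) (R x)))"
  unfolding smallest_component_def
proof (rule poly_time_fold[OF d, where h = "\<lambda>x. Pair (enc_nats (R x)) (enc_nats (R x))" and
      I = "\<lambda>x t. valid_choice (R x) t"])
  let ?D = "{(x, b, t). x \<in> D \<and> b \<in> set (d x) \<and> valid_choice (R x) t}"
  let ?j = "\<lambda>e. Pair (i (fst e)) (Pair (enc_edge (fst (snd e))) (enc_choice (snd (snd e))))"
  let ?c = "\<lambda>e. component (d (fst e)) (removeAll (fst (fst (snd e))) (R (fst e))) (snd (fst (snd e)))"
  let ?b = "\<lambda>e. fst (fst (snd e)) \<in> set (R (fst e)) \<and> snd (fst (snd e)) \<in> set (R (fst e)) \<and>
      (snd (snd (snd e)) = [] \<or> length (?c e) < length (snd (snd (snd e))))"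
  have c: "poly_time D' ?j (\<lambda>e. enc_nats (?c e))"
    if "D' \<subseteq> {e\<in>?D. snd (fst (snd e)) \<in> set (R (fst e))}" for D'
  proof (rule poly_time_mono[OF _ that])
    show "poly_time {e\<in>?D. snd (fst (snd e)) \<in> set (R (fst e))} ?j (\<lambda>e. enc_nats (?c e))"
      by (intro poly_time_component poly_time_removeAll poly_time_env[OF R] poly_time_env[OF d]
          poly_time_edge poly_time_env_elem) (use inv in \<open>auto simp: distinct_removeAll\<close>, (metis fst_conv snd_conv)+)
  qed
  have t: "poly_time D' ?j (\<lambda>e. enc_choice (snd (snd e)))" for D'
    by (rule poly_time_env_state)
  have nil: "poly_time D' ?j (\<lambda>e. enc_bool (snd (snd (snd e)) = []))" for D'
    using poly_time_not[OF poly_time_not_Nil[OF poly_time_choice(2)[OF t]]] by simp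
  have b: "poly_time ?D ?j (\<lambda>e. enc_bool (?b e))"
    by (intro poly_time_conj poly_time_member poly_time_edge poly_time_env_elem poly_time_disj nil
        poly_time_length_less[where ea = enc_nat and eb = enc_nat] c poly_time_choice(2) t poly_time_env[OF R]) auto
  have "poly_time {e\<in>?D. ?b e} ?j (\<lambda>e. enc_choice (fst (fst (snd e)), ?c e))"
    unfolding enc_choice_def fst_conv snd_conv
    by (intro poly_time_Pair poly_time_edge poly_time_env_elem[where es = enc_choice, unfolded enc_choice_def]
        c[unfolded enc_choice_def]) auto
  then show "poly_time ?D ?j (\<lambda>e. enc_choice (smaller_component (d (fst e)) (R (fst e)) (fst (snd e)) (snd (snd e))))"
    unfolding smaller_component_def by (intro poly_time_If[where e = enc_choice] b t)
  show "poly_time D i (\<lambda>x. enc_choice (0, []))" by (rule poly_time_const)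
next
  fix x t
  assume "x \<in> D" "valid_choice (R x) t"
  then show "size (enc_choice t) \<le> size (Pair (enc_nats (R x)) (enc_nats (R x)))"
    using inv(1) size_le_size_enc_list[of "fst t" "R x" enc_nat]
      size_enc_list_mono[of "snd t" "R x" enc_nat]
    by (fastforce simp: valid_choice_def enc_choice_def enc_nat.simps[of 0] intro: add_mono)
next
  fix x a t
  assume "x \<in> D" "a \<in> set (d x)" "valid_choice (R x) t"
  then show "valid_choice (R x) (smaller_component (d x) (R x) a t)"
    by (intro valid_smaller_component inv(2))
qed (auto intro: poly_time_Pair R simp: valid_choice_def)

definition enc_state :: "state \<Rightarrow> data" where
  "enc_state t = Pair (enc_nats (fst t)) (Pair (enc_nats (fst (snd t))) (enc_nats (snd (snd t))))"

lemma poly_time_state: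
  assumes "poly_time D i (\<lambda>x. enc_state (f x))"
  shows "poly_time D i (\<lambda>x. enc_nats (fst (f x)))" "poly_time D i (\<lambda>x. enc_nats (fst (snd (f x))))"
    "poly_time D i (\<lambda>x. enc_nats (snd (snd (f x))))"
  using poly_time_PairD[OF assms[unfolded enc_state_def]]
    poly_time_PairD[OF poly_time_PairD(2)[OF assms[unfolded enc_state_def]]] by auto

definition valid_state :: "nat list \<Rightarrow> state \<Rightarrow> bool" where
  "valid_state vs t \<longleftrightarrow>
     distinct (fst t) \<and> set (fst t) \<subseteq> set vs \<and>
     distinct (fst (snd t)) \<and> set (fst (snd t)) \<subseteq> set vs \<and>
     distinct (snd (snd t)) \<and> set (snd (snd t)) \<subseteq> set vs"

text \<open>The covers avoid \<open>P\<close>, so the lists of chosen vertices stay distinct and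
  their encodings small.\<close>

lemma valid_reduce:
  assumes "valid_state vs (R, P, W)" "v \<in> set vs"
    "\<And>X. X \<in> {X\<^sub>1, X\<^sub>2, X\<^sub>3} \<Longrightarrow> distinct X \<and> set X \<subseteq> set vs - set P"
  shows "valid_state vs (reduce R P W C v X\<^sub>1 X\<^sub>2 X\<^sub>3)"
  using assms(1,2) assms(3)[of X\<^sub>1] assms(3)[of X\<^sub>2] assms(3)[of X\<^sub>3]
  by (auto simp: valid_state_def reduce_def)

lemma arcs_irreflexive:
  "(\<And>e. e \<in> set es \<Longrightarrow> fst e \<noteq> snd e) \<Longrightarrow> a \<in> set (arcs es) \<Longrightarrow> fst a \<noteq> snd a"
  by (force simp: arcs_def)

text \<open>A query is a pair of lists of vertices and edges. Queries and instances are restricted to sets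
  \<open>Q\<close> and \<open>D\<close>, since nothing is known of the given algorithm outside its class of graphs.\<close>

locale vertex_cover_solver =
  fixes solve :: "nat list \<Rightarrow> (nat \<times> nat) list \<Rightarrow> nat list"
    and Q D :: "(nat list \<times> (nat \<times> nat) list) set"
  assumes poly_time_solve: "poly_time Q (\<lambda>q. Pair (enc_nats (fst q)) (enc_edges (snd q)))
      (\<lambda>q. enc_nats (solve (fst q) (snd q)))"
    and distinct_solve: "q \<in> Q \<Longrightarrow> distinct (solve (fst q) (snd q))"
    and set_solve: "q \<in> Q \<Longrightarrow> set (solve (fst q) (snd q)) \<subseteq> set (fst q)"
    and query: "x \<in> D \<Longrightarrow> distinct A \<Longrightarrow> set A \<subseteq> set (fst x) \<Longrightarrow>
      (A, filter (\<lambda>e. fst e \<in> set A \<and> snd e \<in> set A \<and> \<not> (fst e \<in> set W \<and> snd e \<in> set W)) (snd x)) \<in> Q"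
    and irreflexive: "x \<in> D \<Longrightarrow> e \<in> set (snd x) \<Longrightarrow> fst e \<noteq> snd e"
    and distinct_verts: "x \<in> D \<Longrightarrow> distinct (fst x)"
begin

lemma cover_distinct_subset:
  assumes "x \<in> D" "distinct A" "set A \<subseteq> set (fst x)"
  shows "distinct (cover solve (snd x) A W)" "set (cover solve (snd x) A W) \<subseteq> set A"
  using distinct_solve[OF query[OF assms]] set_solve[OF query[OF assms]] by (auto simp: cover_def)

lemma poly_time_cover:
  assumes es: "poly_time D' i (\<lambda>x. enc_edges (es x))"
    and A: "poly_time D' i (\<lambda>x. enc_nats (A x))"
    and W: "poly_time D' i (\<lambda>x. enc_nats (W x))"
    and D': "\<And>x. x \<in> D' \<Longrightarrow> distinct (A x) \<and> (\<exists>vs. (vs, es x) \<in> D \<and> set (A x) \<subseteq> set vs)"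
  shows "poly_time D' i (\<lambda>x. enc_nats (cover solve (es x) (A x) (W x)))"
proof -
  let ?F = "\<lambda>x e. fst e \<in> set (A x) \<and> snd e \<in> set (A x) \<and> \<not> (fst e \<in> set (W x) \<and> snd e \<in> set (W x))"
  have "poly_time D' i (\<lambda>x. enc_edges (filter (?F x) (es x)))"
  proof (rule poly_time_filter[OF es])
    let ?D = "{(x, e). x \<in> D' \<and> e \<in> set (es x)}"
    show "poly_time ?D (\<lambda>e. Pair (i (fst e)) (enc_edge (snd e))) (\<lambda>e. enc_bool (?F (fst e) (snd e)))"
      by (intro poly_time_conj poly_time_not poly_time_member poly_time_edge
          poly_time_filter_elem poly_time_filter_env[OF A] poly_time_filter_env[OF W]) auto
  qed
  then have "poly_time D' i (\<lambda>x. Pair (enc_nats (A x)) (enc_edges (filter (?F x) (es x))))"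
    by (intro poly_time_Pair A)
  then have "poly_time D' i (\<lambda>x. enc_nats (solve (fst (A x, filter (?F x) (es x)))
      (snd (A x, filter (?F x) (es x)))))"
    by (intro poly_time_comp[OF _ poly_time_solve, where h = "\<lambda>x. (A x, filter (?F x) (es x))"])
      (use D' query in fastforce)+
  then show ?thesis by (simp add: cover_def)
qed

lemma poly_time_reduce:
  assumes "poly_time D' i (\<lambda>x. enc_nats (R x))" "poly_time D' i (\<lambda>x. enc_nats (P x))"
    "poly_time D' i (\<lambda>x. enc_nats (W x))" "poly_time D' i (\<lambda>x. enc_nats (C x))"
    "poly_time D' i (\<lambda>x. enc_nat (v x))" "poly_time D' i (\<lambda>x. enc_nats (X\<^sub>1 x))"
    "poly_time D' i (\<lambda>x. enc_nats (X\<^sub>2 x))" "poly_time D' i (\<lambda>x. enc_nats (X\<^sub>3 x))"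
  shows "poly_time D' i (\<lambda>x. enc_state (reduce (R x) (P x) (W x) (C x) (v x) (X\<^sub>1 x) (X\<^sub>2 x) (X\<^sub>3 x)))"
proof -
  have "poly_time D' i (\<lambda>x. enc_state (filter (\<lambda>w. w \<notin> set (C x)) (R x), X\<^sub>3 x @ P x, List.insert (v x) (W x)))"
    "poly_time D' i (\<lambda>x. enc_state (filter (\<lambda>w. w \<notin> set (C x)) (R x), X\<^sub>2 x @ P x, W x))"
    "poly_time D' i (\<lambda>x. enc_state (filter (\<lambda>w. w \<notin> set (C x)) (R x), List.insert (v x) (X\<^sub>1 x @ P x), W x))"
    unfolding enc_state_def fst_conv snd_conv
    by (intro poly_time_Pair poly_time_filter_notin poly_time_append poly_time_insert assms)+
  note states = this[THEN poly_time_mono]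
  have "poly_time D' i (\<lambda>x. enc_bool (length (X\<^sub>3 x) \<le> length (X\<^sub>1 x)))"
    "poly_time D' i (\<lambda>x. enc_bool (length (X\<^sub>2 x) \<le> length (X\<^sub>1 x)))"
    by (intro poly_time_length_le[where ea = enc_nat and eb = enc_nat] assms)+
  note tests = this[THEN poly_time_mono]
  show ?thesis
    unfolding reduce_def
    by (intro poly_time_If[where e = enc_state] tests states) auto
qed

lemma valid_step:
  assumes "x \<in> D" "valid_state (fst x) t"
  shows "valid_state (fst x) (step solve (snd x) t)"
proof -
  obtain R P W where t: "t = (R, P, W)" by (cases t)
  obtain v C where vC: "smallest_component (arcs (snd x)) R = (v, C)" by fastforce
  have valid: "valid_choice R (v, C)"
    using valid_smallest_component[of "arcs (snd x)" R] arcs_irreflexive[OF irreflexive[OF assms(1)]] vC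
    by auto
  show ?thesis
  proof (cases "C = []")
    case True
    then show ?thesis using assms(2) by (simp add: step_def t vC)
  next
    case False
    let ?A = "filter (\<lambda>w. w \<notin> set P) C" and ?B = "filter (\<lambda>w. w \<notin> set P) (v # C)"
    have A: "distinct ?A" "set ?A \<subseteq> set (fst x) - set P" and B: "distinct ?B" "set ?B \<subseteq> set (fst x) - set P"
      and v: "v \<in> set (fst x)"
      using valid False assms(2) by (auto simp: valid_choice_def valid_state_def t)
    have cover: "distinct (cover solve (snd x) Y W') \<and> set (cover solve (snd x) Y W') \<subseteq> set (fst x) - set P"
      if "distinct Y" "set Y \<subseteq> set (fst x) - set P" for Y W'
      using cover_distinct_subset[OF assms(1) that(1), of W'] that(2) by blast
    have "valid_state (fst x) (reduce R P W C v (cover solve (snd x) ?A W)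
        (cover solve (snd x) ?B (List.insert v W)) (cover solve (snd x) ?B W))"
      using assms(2) v cover[OF A] cover[OF B] unfolding t by (intro valid_reduce) auto
    with False show ?thesis by (simp add: step_def t vC Let_def del: filter.simps)
  qed
qed

lemma poly_time_step:
  assumes es: "poly_time D' i (\<lambda>x. enc_edges (es x))"
    and t: "poly_time D' i (\<lambda>x. enc_state (t x))"
    and D': "\<And>x. x \<in> D' \<Longrightarrow> \<exists>vs. (vs, es x) \<in> D \<and> valid_state vs (t x)"
  shows "poly_time D' i (\<lambda>x. enc_state (step solve (es x) (t x)))"
proof -
  let ?c = "\<lambda>x. smallest_component (arcs (es x)) (fst (t x))"
  let ?P = "\<lambda>x. fst (snd (t x))" and ?W = "\<lambda>x. snd (snd (t x))"
  let ?A = "\<lambda>x. filter (\<lambda>w. w \<notin> set (?P x)) (snd (?c x))"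
  let ?B = "\<lambda>x. filter (\<lambda>w. w \<notin> set (?P x)) (fst (?c x) # snd (?c x))"
  have irr: "fst a \<noteq> snd a" if "x \<in> D'" "a \<in> set (arcs (es x))" for x a
    using D'[OF that(1)] arcs_irreflexive[of "es x" a] that irreflexive by fastforce
  have c: "poly_time D' i (\<lambda>x. enc_choice (?c x))"
    by (intro poly_time_smallest_component poly_time_arcs es poly_time_state t)
      (use D' irr in \<open>auto simp: valid_state_def\<close>)
  note c' = poly_time_choice[OF c]
  have nonempty: "poly_time D' i (\<lambda>x. enc_bool (snd (?c x) \<noteq> []))"
    by (intro poly_time_not_Nil[where eb = enc_nat] c')
  \<comment> \<open>Only on \<open>D''\<close> is \<open>v\<close> known to be a vertex; without a
    component it may be the default 0, and the queries could leave \<open>Q\<close>.\<close>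
  define D'' where "D'' = {x\<in>D'. snd (?c x) \<noteq> []}"
  have D'': "D'' \<subseteq> D'" by (auto simp: D''_def)
  have ex: "\<exists>vs. (vs, es x) \<in> D \<and> set (?A x) \<subseteq> set vs \<and> set (?B x) \<subseteq> set vs \<and> distinct (?A x) \<and> distinct (?B x)"
    if x: "x \<in> D''" for x
  proof -
    obtain vs where "(vs, es x) \<in> D" "valid_state vs (t x)" using D' x D'' by (meson subsetD)
    moreover have "valid_choice (fst (t x)) (?c x)"
      by (rule valid_smallest_component) (use irr x D'' in blast)
    ultimately show ?thesis using x
      by (intro exI[of _ vs]) (auto simp: D''_def valid_choice_def valid_state_def)
  qed
  note basic = es[THEN poly_time_mono, OF D''] poly_time_state[OF t, THEN poly_time_mono, OF D'']
    c'[THEN poly_time_mono, OF D'']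
  have "poly_time D'' i (\<lambda>x. enc_state (reduce (fst (t x)) (?P x) (?W x) (snd (?c x)) (fst (?c x))
      (cover solve (es x) (?A x) (?W x)) (cover solve (es x) (?B x) (List.insert (fst (?c x)) (?W x)))
      (cover solve (es x) (?B x) (?W x))))"
    by (intro poly_time_reduce poly_time_cover poly_time_filter_notin poly_time_Cons poly_time_insert
        basic) (use ex in blast)+
  then have "poly_time D' i (\<lambda>x. enc_state (if snd (?c x) \<noteq> [] then
      reduce (fst (t x)) (?P x) (?W x) (snd (?c x)) (fst (?c x))
      (cover solve (es x) (?A x) (?W x)) (cover solve (es x) (?B x) (List.insert (fst (?c x)) (?W x)))
      (cover solve (es x) (?B x) (?W x)) else t x))"
    unfolding D''_def
    by (intro poly_time_If[where e = enc_state] nonempty poly_time_mono[OF t]) auto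
  moreover have "(if snd (?c x) \<noteq> [] then
      reduce (fst (t x)) (?P x) (?W x) (snd (?c x)) (fst (?c x))
      (cover solve (es x) (?A x) (?W x)) (cover solve (es x) (?B x) (List.insert (fst (?c x)) (?W x)))
      (cover solve (es x) (?B x) (?W x)) else t x) = step solve (es x) (t x)" for x
    by (simp only: step_def Let_def split: if_splits) simp
  ultimately show ?thesis by (simp only:)
qed

lemma poly_time_finish:
  assumes "poly_time D' i (\<lambda>x. enc_state (t x))"
  shows "poly_time D' i (\<lambda>x. enc_nats (finish (t x)))"
  unfolding finish_def
proof (intro poly_time_append poly_time_state assms poly_time_filter)
  show "poly_time {(x, b). x \<in> D' \<and> b \<in> set (fst (t x))} (\<lambda>e. Pair (i (fst e)) (enc_nat (snd e)))
      (\<lambda>e. enc_bool (snd e \<notin> set (fst (snd (t (fst e)))) \<and> snd e \<notin> set (snd (snd (t (fst e))))))"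
    by (intro poly_time_conj poly_time_not poly_time_member poly_time_filter_elem
        poly_time_filter_env[OF poly_time_state(2)[OF assms]]
        poly_time_filter_env[OF poly_time_state(3)[OF assms]]) auto
qed

lemma valid_init: "x \<in> D \<Longrightarrow> valid_state (fst x) (fst x, [], [])"
  using distinct_verts by (simp add: valid_state_def)

lemma poly_time_algorithm:
  "poly_time D (\<lambda>x. Pair (enc_nats (fst x)) (enc_edges (snd x)))
     (\<lambda>x. enc_nats (algorithm solve (fst x) (snd x)))"
proof -
  let ?i = "\<lambda>x. Pair (enc_nats (fst x)) (enc_edges (snd x))"
  have vs: "poly_time D ?i (\<lambda>x. enc_nats (fst x))" and es: "poly_time D ?i (\<lambda>x. enc_edges (snd x))"
    by (rule poly_time_PairD[OF poly_time_input])+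
  have "poly_time D ?i (\<lambda>x. enc_state (fold (\<lambda>_. step solve (snd x)) (fst x) (fst x, [], [])))"
  proof (rule poly_time_fold[OF vs, where I = "\<lambda>x. valid_state (fst x)" and
        h = "\<lambda>x. Pair (enc_nats (fst x)) (Pair (enc_nats (fst x)) (enc_nats (fst x)))"])
    show "poly_time D ?i (\<lambda>x. enc_state (fst x, [], []))"
      unfolding enc_state_def fst_conv snd_conv by (intro poly_time_Pair poly_time_Nil vs)
    show "poly_time D ?i (\<lambda>x. Pair (enc_nats (fst x)) (Pair (enc_nats (fst x)) (enc_nats (fst x))))"
      by (intro poly_time_Pair vs)
    show "poly_time {(x, b, t). x \<in> D \<and> b \<in> set (fst x) \<and> valid_state (fst x) t}
        (\<lambda>e. Pair (?i (fst e)) (Pair (enc_nat (fst (snd e))) (enc_state (snd (snd e)))))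
        (\<lambda>e. enc_state (step solve (snd (fst e)) (snd (snd e))))"
      by (intro poly_time_step poly_time_env[OF es] poly_time_env_state) auto
    show "size (enc_state t) \<le> size (Pair (enc_nats (fst x)) (Pair (enc_nats (fst x)) (enc_nats (fst x))))"
      if "x \<in> D" "valid_state (fst x) t" for x t
      using that distinct_verts[OF that(1)]
      by (auto simp: enc_state_def valid_state_def intro!: add_mono size_enc_list_mono)
  qed (auto intro: valid_init valid_step)
  then show ?thesis unfolding algorithm_def by (rule poly_time_finish)
qed

end

section \<open>Simultaneous domination\<close>

text \<open>The walk is cut off at its first arrival in \<open>w\<close>; \<open>b\<close> is the
  vertex just before.\<close>

lemma rtrancl_exit:
  assumes "(y, w) \<in> (Restr A R)\<^sup>*" "y \<noteq> w"
  obtains b where "(y, b) \<in> (Restr A (R - {w}))\<^sup>*" "(b, w) \<in> A" "b \<in> R - {w}"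
proof -
  have "y \<noteq> w \<longrightarrow> (\<exists>b. (y, b) \<in> (Restr A (R - {w}))\<^sup>* \<and> (b, w) \<in> A \<and> b \<in> R - {w})"
    using assms(1)
  proof (induction rule: converse_rtrancl_induct)
    case (step y z)
    show ?case
    proof (cases "z = w")
      case True
      with step.hyps show ?thesis by blast
    next
      case False
      then obtain b where "(z, b) \<in> (Restr A (R - {w}))\<^sup>*" "(b, w) \<in> A" "b \<in> R - {w}"
        using step.IH by blast
      with False step.hyps show ?thesis
        by (metis (no_types, lifting) DiffI IntD1 IntD2 IntI SigmaE2 SigmaI converse_rtrancl_into_rtrancl singletonD)
    qed
  qed simp
  with assms(2) that show ?thesis by blast
qed

lemma rtrancl_Restr_mem: "(x, y) \<in> (Restr A X)\<^sup>* \<Longrightarrow> x \<in> X \<Longrightarrow> y \<in> X"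
  by (induction rule: rtrancl_induct) auto

lemma rtrancl_Restr_mono: "(x, y) \<in> (Restr A X)\<^sup>* \<Longrightarrow> A \<subseteq> B \<Longrightarrow> X \<subseteq> Y \<Longrightarrow> (x, y) \<in> (Restr B Y)\<^sup>*"
  by (erule rtrancl_mono[THEN subsetD, rotated]) auto

lemma rtrancl_Restr_sym: "sym A \<Longrightarrow> (x, y) \<in> (Restr A X)\<^sup>* \<Longrightarrow> (y, x) \<in> (Restr A X)\<^sup>*"
  by (rule symD[OF sym_rtrancl]) (auto simp: sym_def)

lemma sym_adjacent: "sym (adjacent G)"
  by (auto simp: sym_def adjacent_def insert_commute)

lemma adjacent_subset: "simple_graph G \<Longrightarrow> adjacent G \<subseteq> verts G \<times> verts G"
  by (auto simp: adjacent_def simple_graph_def)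

lemma adjacent_irrefl: "simple_graph G \<Longrightarrow> (v, v) \<notin> adjacent G"
  by (auto simp: adjacent_def simple_graph_def)

lemma Restr_adjacent: "simple_graph G \<Longrightarrow> Restr (adjacent G) (verts G) = adjacent G"
  using adjacent_subset by blast

lemma finite_edges: "simple_graph G \<Longrightarrow> finite (edges G)"
  by (rule finite_subset[of _ "Pow (verts G)"]) (auto simp: simple_graph_def)

text \<open>The remaining edges of the cycle join the two ends of the removed one.\<close>

lemma connected_graph_remove_cycle_edge:
  assumes "connected_graph T" "is_cycle T xs"
  shows "connected_graph (T\<lparr>edges := edges T - {{last xs, hd xs}}\<rparr>)"
proof -
  let ?T = "T\<lparr>edges := edges T - {{last xs, hd xs}}\<rparr>"
  have len: "length xs \<ge> 3" and dist: "distinct xs"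
    and path: "\<And>i. Suc i < length xs \<Longrightarrow> (xs ! i, xs ! Suc i) \<in> adjacent T"
    using assms(2) by (auto simp: is_cycle_def)
  have ends: "hd xs = xs ! 0" "last xs = xs ! (length xs - 1)"
    using len by (cases xs; simp add: last_conv_nth)+
  have "(xs ! 0, xs ! i) \<in> (adjacent ?T)\<^sup>*" if "i < length xs" for i
    using that
  proof (induction i)
    case (Suc i)
    \<comment> \<open>A consecutive pair equal to the closing edge would, the entries being
      distinct, force a cycle of length 2.\<close>
    have ne: "{xs ! i, xs ! Suc i} \<noteq> {last xs, hd xs}"
    proof
      assume "{xs ! i, xs ! Suc i} = {last xs, hd xs}"
      then consider "xs ! Suc i = xs ! 0" | "xs ! i = xs ! 0" "xs ! Suc i = xs ! (length xs - 1)"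
        unfolding ends by (auto simp: doubleton_eq_iff)
      then show False
      proof cases
        case 1
        then have "Suc i = 0" using nth_eq_iff_index_eq[OF dist Suc.prems, of 0] len by linarith
        then show False by simp
      next
        case 2
        then have "i = 0" "Suc i = length xs - 1"
          using nth_eq_iff_index_eq[OF dist, of i 0] Suc.prems len
            nth_eq_iff_index_eq[OF dist Suc.prems, of "length xs - 1"] by linarith+
        then show False using len by simp
      qed
    qed
    have "(xs ! i, xs ! Suc i) \<in> adjacent ?T"
      using path[OF Suc.prems] ne unfolding adjacent_def by simp
    with Suc show ?case by (meson Suc_lessD rtrancl.rtrancl_into_rtrancl)
  qed simp
  then have hl: "(hd xs, last xs) \<in> (adjacent ?T)\<^sup>*" unfolding ends using len by simp
  have lh: "(last xs, hd xs) \<in> (adjacent ?T)\<^sup>*"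
    by (rule symD[OF sym_rtrancl[OF sym_adjacent] hl])
  have "adjacent T \<subseteq> (adjacent ?T)\<^sup>*"
  proof (rule subrelI)
    fix a b assume ab: "(a, b) \<in> adjacent T"
    show "(a, b) \<in> (adjacent ?T)\<^sup>*"
    proof (cases "{a, b} = {last xs, hd xs}")
      case True
      then have "a = last xs \<and> b = hd xs \<or> a = hd xs \<and> b = last xs" by (simp add: doubleton_eq_iff)
      then show ?thesis using hl lh by metis
    next
      case False
      with ab have "(a, b) \<in> adjacent ?T" by (simp add: adjacent_def)
      then show ?thesis by (rule r_into_rtrancl)
    qed
  qed
  then have "(adjacent T)\<^sup>* \<subseteq> (adjacent ?T)\<^sup>*"
    using rtrancl_subset_rtrancl by blast
  with assms(1) show ?thesis
    unfolding connected_graph_def by (simp add: subset_iff)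
qed

text \<open>A connected spanning subgraph with the fewest edges has no cycle, because a cycle edge
  could be dropped.\<close>

lemma spanning_tree_exists:
  assumes "simple_graph G" "connected_graph G"
  obtains T where "spanning_tree T G"
proof -
  let ?P = "\<lambda>F. F \<subseteq> edges G \<and> connected_graph (G\<lparr>edges := F\<rparr>)"
  have "?P (edges G)" using assms by simp
  from ex_has_least_nat[of ?P, OF this, of card]
  obtain F where F: "?P F" and least: "\<And>F'. ?P F' \<Longrightarrow> card F \<le> card F'" by blast
  let ?T = "G\<lparr>edges := F\<rparr>"
  have "\<not> is_cycle ?T xs" for xs
  proof
    assume xs: "is_cycle ?T xs"
    let ?e = "{last xs, hd xs}"
    have "?P (F - {?e})"
      using connected_graph_remove_cycle_edge[OF conjunct2[OF F] xs] F by auto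
    moreover have "?e \<in> F" using xs by (auto simp: is_cycle_def adjacent_def)
    moreover have "finite F" using F finite_edges[OF assms(1)] finite_subset by blast
    ultimately show False using least[of "F - {?e}"] card_Diff1_less[of F ?e] by linarith
  qed
  then have "spanning_tree ?T G"
    using F assms(1) by (auto simp: spanning_tree_def tree_def simple_graph_def)
  then show ?thesis by (rule that)
qed

text \<open>With \<open>R\<close> the vertex set of \<open>G\<close>: \<open>S\<close> contains all neighbours of \<open>z\<close> in some component of
  \<open>G - z\<close>, so every spanning tree has an edge between \<open>z\<close> and \<open>S\<close>.\<close>

definition dominated :: "'a rel \<Rightarrow> 'a set \<Rightarrow> 'a set \<Rightarrow> 'a \<Rightarrow> bool" where
  "dominated A R S z \<longleftrightarrow>
     (\<exists>u\<in>R - {z}. \<forall>w. (z, w) \<in> A \<longrightarrow> (u, w) \<in> (Restr A (R - {z}))\<^sup>* \<longrightarrow> w \<in> S)"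

text \<open>The subproblem left on \<open>R\<close>. \<open>P\<close> also contains vertices removed
  earlier, hence the intersection with \<open>R\<close>; vertices in \<open>W\<close> are exempt
  from domination.\<close>

definition feasible :: "'a rel \<Rightarrow> 'a set \<Rightarrow> 'a set \<Rightarrow> 'a set \<Rightarrow> 'a set \<Rightarrow> bool" where
  "feasible A R P W S \<longleftrightarrow> S \<subseteq> R \<and> P \<inter> R \<subseteq> S \<and> (\<forall>z\<in>R - S - W. dominated A R S z)"

lemma dominated_mono: "dominated A R S z \<Longrightarrow> S \<inter> R \<subseteq> S' \<Longrightarrow> dominated A R S' z"
  unfolding dominated_def using rtrancl_Restr_mem[where A = A and X = "R - {z}"] by fast

text \<open>Otherwise every component of \<open>G - z\<close> has a neighbour of \<open>z\<close>
  outside \<open>S\<close>. The graph \<open>?H\<close> without the edges between \<open>z\<close>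
  and \<open>S\<close> is then connected, and a spanning tree of it fails to dominate
  \<open>z\<close>.\<close>

lemma dominated_if_simultaneous_dominating_set:
  assumes G: "simple_graph G" and sds: "simultaneous_dominating_set G S" and z: "z \<in> verts G - S"
  shows "dominated (adjacent G) (verts G) S z"
proof (rule ccontr)
  let ?A = "adjacent G" and ?V = "verts G"
  assume "\<not> dominated ?A ?V S z"
  then have nbr: "\<exists>w. (z, w) \<in> ?A \<and> (u, w) \<in> (Restr ?A (?V - {z}))\<^sup>* \<and> w \<notin> S" if "u \<in> ?V - {z}" for u
    using that by (auto simp: dominated_def)
  let ?H = "G\<lparr>edges := {e\<in>edges G. \<not> (z \<in> e \<and> e \<inter> S \<noteq> {})}\<rparr>"
  have to_z: "(u, z) \<in> (adjacent ?H)\<^sup>*" if u: "u \<in> ?V" for u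
  proof (cases "u = z")
    case False
    then obtain w where w: "(z, w) \<in> ?A" "(u, w) \<in> (Restr ?A (?V - {z}))\<^sup>*" "w \<notin> S"
      using nbr u by blast
    have "Restr ?A (?V - {z}) \<subseteq> adjacent ?H" by (auto simp: adjacent_def)
    with w(2) have "(u, w) \<in> (adjacent ?H)\<^sup>*" using rtrancl_mono by blast
    moreover have "(w, z) \<in> adjacent ?H" using w(1,3) z by (auto simp: adjacent_def insert_commute)
    ultimately show ?thesis by (rule rtrancl_into_rtrancl)
  qed simp
  have "(u, v) \<in> (adjacent ?H)\<^sup>*" if "u \<in> ?V" "v \<in> ?V" for u v
    using to_z[OF that(1)] symD[OF sym_rtrancl[OF sym_adjacent] to_z[OF that(2)]] by (rule rtrancl_trans)
  then have conn: "connected_graph ?H" using z unfolding connected_graph_def by force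
  have "simple_graph ?H" using G by (simp add: simple_graph_def)
  from spanning_tree_exists[OF this conn] obtain T where T: "spanning_tree T ?H" .
  then have T': "spanning_tree T G" by (auto simp: spanning_tree_def)
  then have "dominating_set T S" using sds by (simp add: simultaneous_dominating_set_def)
  moreover have "z \<in> verts T - S" using T' z by (simp add: spanning_tree_def)
  ultimately obtain s where "s \<in> S" "{z, s} \<in> edges T"
    by (auto simp: dominating_set_def adjacent_def)
  moreover have "edges T \<subseteq> {e\<in>edges G. \<not> (z \<in> e \<and> e \<inter> S \<noteq> {})}"
    using T by (simp add: spanning_tree_def)
  ultimately show False by blast
qed

text \<open>Let \<open>u\<close> witness \<open>dominated\<close>. The walk from \<open>u\<close> to
  \<open>z\<close> in the tree arrives at \<open>z\<close> from a vertex in the component of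
  \<open>u\<close> in \<open>G - z\<close>, and the neighbours of \<open>z\<close> there are all in
  \<open>S\<close>.\<close>

lemma dominated_in_spanning_tree:
  assumes "spanning_tree T G" "dominated (adjacent G) (verts G) S z" "z \<in> verts G"
  shows "\<exists>s\<in>S. (z, s) \<in> adjacent T"
proof -
  let ?V = "verts G"
  have T: "simple_graph T" "connected_graph T" "verts T = ?V" "adjacent T \<subseteq> adjacent G"
    using assms(1) by (auto simp: spanning_tree_def tree_def adjacent_def)
  obtain u where u: "u \<in> ?V - {z}"
    "\<And>w. (z, w) \<in> adjacent G \<Longrightarrow> (u, w) \<in> (Restr (adjacent G) (?V - {z}))\<^sup>* \<Longrightarrow> w \<in> S"
    using assms(2) by (auto simp: dominated_def)
  have "(u, z) \<in> (Restr (adjacent T) ?V)\<^sup>*"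
    using T u(1) assms(3) Restr_adjacent[OF T(1)] by (auto simp: connected_graph_def)
  then obtain b where b: "(u, b) \<in> (Restr (adjacent T) (?V - {z}))\<^sup>*" "(b, z) \<in> adjacent T"
    using u(1) by (auto elim: rtrancl_exit)
  then have zb: "(z, b) \<in> adjacent T" using sym_adjacent by (metis symD)
  moreover have "b \<in> S"
    using u(2)[of b] zb T(4) rtrancl_Restr_mono[OF b(1) T(4) order_refl] by blast
  ultimately show ?thesis by blast
qed

lemma simultaneous_dominating_set_iff_feasible:
  assumes "simple_graph G"
  shows "simultaneous_dominating_set G S \<longleftrightarrow> feasible (adjacent G) (verts G) {} {} S"
proof
  assume "simultaneous_dominating_set G S"
  then show "feasible (adjacent G) (verts G) {} {} S"
    using dominated_if_simultaneous_dominating_set[OF assms, of S]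
    by (simp add: feasible_def) (simp add: simultaneous_dominating_set_def)
next
  assume "feasible (adjacent G) (verts G) {} {} S"
  then show "simultaneous_dominating_set G S"
    using dominated_in_spanning_tree
    by (fastforce simp: feasible_def simultaneous_dominating_set_def dominating_set_def spanning_tree_def)
qed

section \<open>Removing a leaf component\<close>

text \<open>Vertex covers of \<open>(G - U) - E(G[W])\<close> with \<open>U\<close> the complement
  of \<open>Y\<close>, phrased for the adjacency relation so that the exchange arguments need no
  graph records.\<close>

definition is_cover :: "'a rel \<Rightarrow> 'a set \<Rightarrow> 'a set \<Rightarrow> 'a set \<Rightarrow> bool" where
  "is_cover A Y W X \<longleftrightarrow> X \<subseteq> Y \<and> (\<forall>a\<in>Y. \<forall>b\<in>Y. (a, b) \<in> A \<longrightarrow> \<not> (a \<in> W \<and> b \<in> W) \<longrightarrow> a \<in> X \<or> b \<in> X)"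

definition is_min_cover :: "'a rel \<Rightarrow> 'a set \<Rightarrow> 'a set \<Rightarrow> 'a set \<Rightarrow> bool" where
  "is_min_cover A Y W X \<longleftrightarrow> is_cover A Y W X \<and> (\<forall>X'. is_cover A Y W X' \<longrightarrow> card X \<le> card X')"

lemma is_min_cover_subset: "is_min_cover A Y W X \<Longrightarrow> X \<subseteq> Y"
  by (simp add: is_min_cover_def is_cover_def)

text \<open>\<open>C\<close> is a component of \<open>G[R] - v\<close>, of minimum size over all choices of \<open>v\<close>, so that no vertex of
  \<open>C\<close> is a cut vertex of \<open>G[R]\<close>.\<close>

locale leaf =
  fixes A :: "'a rel" and R :: "'a set" and v u :: 'a and C :: "'a set"
  assumes sym: "sym A" and irrefl: "\<And>x. (x, x) \<notin> A" and finite: "finite R"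
    and connected: "\<And>x y. x \<in> R \<Longrightarrow> y \<in> R \<Longrightarrow> (x, y) \<in> (Restr A R)\<^sup>*"
    and v: "v \<in> R" and u: "u \<in> R" and vu: "(v, u) \<in> A"
    and C: "C = {w. (u, w) \<in> (Restr A (R - {v}))\<^sup>*}"
    and minimal: "\<And>a b. a \<in> R \<Longrightarrow> b \<in> R \<Longrightarrow> (a, b) \<in> A \<Longrightarrow>
      card C \<le> card {w. (b, w) \<in> (Restr A (R - {a}))\<^sup>*}"
begin

lemma u_C: "u \<in> C" by (simp add: C)

lemma u_neq_v: "u \<noteq> v" using vu irrefl by blast

lemma C_subset: "C \<subseteq> R - {v}"
  unfolding C using u u_neq_v by (auto dest: rtrancl_Restr_mem)

lemma v_notin_C: "v \<notin> C" using C_subset by blast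

lemma C_closed: "x \<in> C \<Longrightarrow> (x, y) \<in> A \<Longrightarrow> y \<in> R \<Longrightarrow> y \<noteq> v \<Longrightarrow> y \<in> C"
  using C_subset by (fastforce simp: C intro: rtrancl_into_rtrancl)

lemma C_closed': "y \<in> C \<Longrightarrow> (x, y) \<in> A \<Longrightarrow> x \<in> R \<Longrightarrow> x \<noteq> v \<Longrightarrow> x \<in> C"
  using C_closed sym by (metis symD)

lemma C_to_v: "x \<in> C \<Longrightarrow> (x, v) \<in> (Restr A (insert v C))\<^sup>*"
proof -
  assume "x \<in> C"
  then have "(u, x) \<in> (Restr A (R - {v}))\<^sup>*" by (simp add: C)
  then show ?thesis
  proof (induction rule: rtrancl_induct)
    case base
    then show ?case using vu sym u_C by (auto intro!: r_into_rtrancl dest: symD)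
  next
    case (step y z)
    then have "y \<in> C" "z \<in> C" by (auto simp: C intro: rtrancl_into_rtrancl)
    with step sym have "(z, y) \<in> Restr A (insert v C)" by (auto dest: symD)
    from this step.IH show ?case by (rule converse_rtrancl_into_rtrancl)
  qed
qed

text \<open>Contracting \<open>C\<close> to \<open>v\<close> turns paths into paths outside \<open>C\<close>.\<close>

definition retract :: "'a \<Rightarrow> 'a" where
  "retract x = (if x \<in> C then v else x)"

lemma retract_path:
  assumes "(x, y) \<in> (Restr A X)\<^sup>*" "v \<in> X" "X \<subseteq> R"
  shows "(retract x, retract y) \<in> (Restr A (X - C))\<^sup>*"
  using assms(1)
proof (induction rule: rtrancl_induct)
  case (step y z)
  \<comment> \<open>An edge with an end in \<open>C\<close> has its other end in \<open>C\<close> or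
    at \<open>v\<close>, so contraction makes it a single vertex; every other edge is kept.\<close>
  have "retract y = retract z \<or> (retract y, retract z) \<in> Restr A (X - C)"
    using step.hyps(2) C_closed[of y z] C_closed'[of z y] assms(2,3) v_notin_C
    by (auto simp: retract_def)
  with step.IH show ?case by (metis rtrancl.rtrancl_into_rtrancl)
qed simp

lemma connected_rest:
  assumes "x \<in> R - C" "y \<in> R - C"
  shows "(x, y) \<in> (Restr A (R - C))\<^sup>*"
  using retract_path[OF connected[of x y] v] assms by (simp add: retract_def)

text \<open>If \<open>v\<close> could not reach \<open>y\<close> without \<open>w\<close>, the
  component \<open>?D\<close> of \<open>y\<close> would be disjoint from \<open>R - C\<close>, which
  is connected, contains \<open>v\<close> and avoids \<open>w\<close>. So \<open>?D\<close> would
  lie in \<open>C\<close> without \<open>w\<close>, contradicting minimality.\<close>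

lemma noncut:
  assumes w: "w \<in> C" and "x \<in> R - {w}" "y \<in> R - {w}"
  shows "(x, y) \<in> (Restr A (R - {w}))\<^sup>*"
proof -
  have v_to: "(v, y) \<in> (Restr A (R - {w}))\<^sup>*" if y: "y \<in> R - {w}" for y
  proof (rule ccontr)
    assume not: "(v, y) \<notin> (Restr A (R - {w}))\<^sup>*"
    let ?D = "{z. (y, z) \<in> (Restr A (R - {w}))\<^sup>*}"
    have "z \<in> C" if "z \<in> ?D" for z
    proof (rule ccontr)
      assume "z \<notin> C"
      moreover have "z \<in> R" using that y rtrancl_Restr_mem by fast
      ultimately have "(v, z) \<in> (Restr A (R - C))\<^sup>*"
        using connected_rest v v_notin_C by blast
      then have "(v, z) \<in> (Restr A (R - {w}))\<^sup>*"
        by (rule rtrancl_Restr_mono) (use w in auto)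
      with that not rtrancl_Restr_sym[OF sym] show False by (auto intro: rtrancl_trans)
    qed
    moreover have "w \<notin> ?D" using y rtrancl_Restr_mem by fast
    ultimately have "?D \<subset> C" using w by blast
    moreover have "finite C" using C_subset finite finite_subset by blast
    ultimately have "card ?D < card C" by (simp add: psubset_card_mono)
    \<comment> \<open>\<open>minimal\<close> speaks of components at neighbours of the removed
      vertex, so \<open>?D\<close> has to be presented as the component of a neighbour
      \<open>b\<close> of \<open>w\<close>.\<close>
    obtain b where b: "(y, b) \<in> (Restr A (R - {w}))\<^sup>*" "(b, w) \<in> A" "b \<in> R - {w}"
      using connected[of y w] y w C_subset by (auto elim: rtrancl_exit)
    have "{z. (b, z) \<in> (Restr A (R - {w}))\<^sup>*} = ?D"
      using b(1) rtrancl_Restr_sym[OF sym b(1)] by (auto intro: rtrancl_trans)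
    then show False
      using minimal[of w b] b w C_subset sym \<open>card ?D < card C\<close> by (auto dest: symD)
  qed
  show ?thesis
    using rtrancl_Restr_sym[OF sym v_to[OF assms(2)]] v_to[OF assms(3)] by (rule rtrancl_trans)
qed

text \<open>By \<open>noncut\<close> only one component remains when \<open>w\<close> is removed. So
  an unchosen \<open>w\<close> needs all its neighbours, which turns domination on \<open>C\<close>
  into a vertex cover condition.\<close>

lemma dominated_C:
  assumes "w \<in> C"
  shows "dominated A R S w \<longleftrightarrow> (\<forall>y\<in>R. (w, y) \<in> A \<longrightarrow> y \<in> S)"
proof
  assume "dominated A R S w"
  then obtain x where x: "x \<in> R - {w}"
    "\<And>y. (w, y) \<in> A \<Longrightarrow> (x, y) \<in> (Restr A (R - {w}))\<^sup>* \<Longrightarrow> y \<in> S"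
    by (auto simp: dominated_def)
  show "\<forall>y\<in>R. (w, y) \<in> A \<longrightarrow> y \<in> S"
  proof (intro ballI impI)
    fix y assume "y \<in> R" "(w, y) \<in> A"
    moreover from this have "y \<in> R - {w}" using irrefl by blast
    ultimately show "y \<in> S" using x noncut[OF assms] by blast
  qed
next
  assume *: "\<forall>y\<in>R. (w, y) \<in> A \<longrightarrow> y \<in> S"
  \<comment> \<open>Some vertex besides \<open>w\<close> is needed as witness of the component;
    \<open>v\<close> always serves.\<close>
  have v': "v \<in> R - {w}" using v assms v_notin_C by auto
  have "y \<in> S" if "(w, y) \<in> A" "(v, y) \<in> (Restr A (R - {w}))\<^sup>*" for y
    using rtrancl_Restr_mem[OF that(2) v'] that(1) * by simp
  with v' show "dominated A R S w" unfolding dominated_def by blast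
qed

text \<open>\<open>C\<close> hangs on \<open>v\<close>, which survives the removal of
  \<open>z\<close>. Contracting \<open>C\<close> to \<open>v\<close> therefore matches the
  components with and without \<open>C\<close>, and \<open>z\<close> has no neighbour in
  \<open>C\<close>.\<close>

lemma dominated_rest:
  assumes z: "z \<in> R - C" "z \<noteq> v"
  shows "dominated A R S z \<longleftrightarrow> dominated A (R - C) S z"
proof
  assume "dominated A R S z"
  then obtain x where x: "x \<in> R - {z}"
    "\<And>w. (z, w) \<in> A \<Longrightarrow> (x, w) \<in> (Restr A (R - {z}))\<^sup>* \<Longrightarrow> w \<in> S"
    by (auto simp: dominated_def)
  have "(x, retract x) \<in> (Restr A (R - {z}))\<^sup>*"
    using rtrancl_Restr_mono[OF C_to_v, of x A "R - {z}"] z v C_subset by (auto simp: retract_def)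
  moreover have "(retract x, w) \<in> (Restr A (R - {z}))\<^sup>*" if "(retract x, w) \<in> (Restr A (R - C - {z}))\<^sup>*" for w
    by (rule rtrancl_Restr_mono[OF that]) auto
  ultimately have "w \<in> S" if "(z, w) \<in> A" "(retract x, w) \<in> (Restr A (R - C - {z}))\<^sup>*" for w
    using x(2) that by (meson rtrancl_trans)
  moreover have "retract x \<in> R - C - {z}" using x(1) z v v_notin_C by (auto simp: retract_def)
  ultimately show "dominated A (R - C) S z" by (auto simp: dominated_def)
next
  assume "dominated A (R - C) S z"
  then obtain x where x: "x \<in> R - C - {z}"
    "\<And>w. (z, w) \<in> A \<Longrightarrow> (x, w) \<in> (Restr A (R - C - {z}))\<^sup>* \<Longrightarrow> w \<in> S"
    by (auto simp: dominated_def)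
  have "w \<in> S" if w: "(z, w) \<in> A" "(x, w) \<in> (Restr A (R - {z}))\<^sup>*" for w
  proof -
    have "w \<notin> C" using C_closed'[of w z] w(1) z by auto
    moreover have "(retract x, retract w) \<in> (Restr A (R - {z} - C))\<^sup>*"
      by (rule retract_path[OF w(2)]) (use v z in auto)
    ultimately have "(x, w) \<in> (Restr A (R - C - {z}))\<^sup>*"
      using x(1) by (simp add: retract_def Diff_insert2[symmetric] Diff_insert[symmetric] set_diff_eq conj_commute conj_left_commute)
    with x(2) w(1) show ?thesis by blast
  qed
  with x(1) show "dominated A R S z" by (auto simp: dominated_def)
qed

text \<open>No edge joins \<open>C\<close> to \<open>R - C - {v}\<close>, so the components left
  after removal of \<open>v\<close> are \<open>C\<close> and those of
  \<open>R - C - {v}\<close>.\<close>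

lemma dominated_v: "dominated A R S v \<longleftrightarrow> (\<forall>y\<in>C. (v, y) \<in> A \<longrightarrow> y \<in> S) \<or> dominated A (R - C) S v"
proof
  assume "dominated A R S v"
  then obtain x where x: "x \<in> R - {v}"
    "\<And>w. (v, w) \<in> A \<Longrightarrow> (x, w) \<in> (Restr A (R - {v}))\<^sup>* \<Longrightarrow> w \<in> S"
    by (auto simp: dominated_def)
  show "(\<forall>y\<in>C. (v, y) \<in> A \<longrightarrow> y \<in> S) \<or> dominated A (R - C) S v"
  proof (cases "x \<in> C")
    case True
    then have "(x, u) \<in> (Restr A (R - {v}))\<^sup>*" using rtrancl_Restr_sym[OF sym] by (simp add: C)
    then have "(x, y) \<in> (Restr A (R - {v}))\<^sup>*" if "y \<in> C" for y
      using that by (auto simp: C intro: rtrancl_trans)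
    with x(2) show ?thesis by blast
  next
    case False
    have "(x, w) \<in> (Restr A (R - {v}))\<^sup>*" if "(x, w) \<in> (Restr A (R - C - {v}))\<^sup>*" for w
      by (rule rtrancl_Restr_mono[OF that]) auto
    with x False have "dominated A (R - C) S v" unfolding dominated_def by blast
    then show ?thesis ..
  qed
next
  assume "(\<forall>y\<in>C. (v, y) \<in> A \<longrightarrow> y \<in> S) \<or> dominated A (R - C) S v"
  then show "dominated A R S v"
  proof
    assume "\<forall>y\<in>C. (v, y) \<in> A \<longrightarrow> y \<in> S"
    then show ?thesis using u u_neq_v by (auto simp: dominated_def C)
  next
    assume "dominated A (R - C) S v"
    then obtain x where x: "x \<in> R - C - {v}"
      "\<And>w. (v, w) \<in> A \<Longrightarrow> (x, w) \<in> (Restr A (R - C - {v}))\<^sup>* \<Longrightarrow> w \<in> S"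
      by (auto simp: dominated_def)
    have "w \<notin> C \<and> (x, w) \<in> (Restr A (R - C - {v}))\<^sup>*" if "(x, w) \<in> (Restr A (R - {v}))\<^sup>*" for w
      using that
    proof (induction rule: rtrancl_induct)
      case (step y z)
      then have "z \<notin> C" using C_closed'[of z y] by auto
      with step show ?case by (auto intro: rtrancl_into_rtrancl)
    qed (use x in simp)
    with x show ?thesis unfolding dominated_def by blast
  qed
qed

text \<open>The condition falls apart into one on \<open>C\<close>, one on the rest and one on
  \<open>v\<close>; the two sides interact only through \<open>v\<close>. This is what permits
  exchanging the part of a solution on \<open>C\<close>.\<close>

lemma feasible_iff:
  "feasible A R P W S \<longleftrightarrow> S \<subseteq> R \<and> P \<inter> R \<subseteq> S \<and>
     (\<forall>w\<in>C - S - W. \<forall>y\<in>R. (w, y) \<in> A \<longrightarrow> y \<in> S) \<and>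
     (\<forall>z\<in>R - C - {v} - S - W. dominated A (R - C) S z) \<and>
     (v \<notin> S \<longrightarrow> v \<notin> W \<longrightarrow> (\<forall>y\<in>C. (v, y) \<in> A \<longrightarrow> y \<in> S) \<or> dominated A (R - C) S v)"
  (is "?l \<longleftrightarrow> ?r")
proof -
  have "(\<forall>z\<in>R - S - W. dominated A R S z) \<longleftrightarrow>
      (\<forall>w\<in>C - S - W. dominated A R S w) \<and> (\<forall>z\<in>R - C - {v} - S - W. dominated A R S z) \<and>
      (v \<notin> S \<longrightarrow> v \<notin> W \<longrightarrow> dominated A R S v)"
    using C_subset v by blast
  moreover have "(\<forall>w\<in>C - S - W. dominated A R S w) \<longleftrightarrow>
      (\<forall>w\<in>C - S - W. \<forall>y\<in>R. (w, y) \<in> A \<longrightarrow> y \<in> S)"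
    using dominated_C by blast
  moreover have "(\<forall>z\<in>R - C - {v} - S - W. dominated A R S z) \<longleftrightarrow>
      (\<forall>z\<in>R - C - {v} - S - W. dominated A (R - C) S z)"
    using dominated_rest by blast
  ultimately show ?thesis
    unfolding feasible_def dominated_v by (simp only:)
qed

end

text \<open>The cost of a solution is \<open>card (S \<union> P)\<close>, as \<open>P\<close> keeps
  the chosen vertices already removed. Extending \<open>S'\<close> by \<open>P' \<inter> R\<close>
  gives the same union with \<open>P\<close> as \<open>S' \<union> P'\<close>, so the cost carries
  over in this direction by itself.\<close>

definition reduces :: "'a rel \<Rightarrow> 'a set \<Rightarrow> 'a set \<Rightarrow> 'a set \<Rightarrow> 'a set \<Rightarrow> 'a set \<Rightarrow> 'a set \<Rightarrow> bool" where
  "reduces A R P W R' P' W' \<longleftrightarrow> P \<subseteq> P' \<and> P' \<subseteq> P \<union> R \<and>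
     (\<forall>S'. feasible A R' P' W' S' \<longrightarrow> feasible A R P W (S' \<union> P' \<inter> R)) \<and>
     (\<forall>S. feasible A R P W S \<longrightarrow> (\<exists>S'. feasible A R' P' W' S' \<and> card (S' \<union> P') \<le> card (S \<union> P)))"

lemma reducesI:
  assumes "P \<subseteq> P'" "P' \<subseteq> P \<union> R"
    and "\<And>S'. feasible A R' P' W' S' \<Longrightarrow> feasible A R P W (S' \<union> P' \<inter> R)"
    and "\<And>S. feasible A R P W S \<Longrightarrow> \<exists>S'. feasible A R' P' W' S' \<and> card (S' \<union> P') \<le> card (S \<union> P)"
  shows "reduces A R P W R' P' W'"
  using assms unfolding reduces_def by blast

lemma is_coverI:
  "X \<subseteq> Y \<Longrightarrow> (\<And>a b. a \<in> Y \<Longrightarrow> b \<in> Y \<Longrightarrow> (a, b) \<in> A \<Longrightarrow> \<not> (a \<in> W \<and> b \<in> W) \<Longrightarrow> a \<in> X \<or> b \<in> X) \<Longrightarrow>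
    is_cover A Y W X"
  unfolding is_cover_def by blast

lemma is_coverD:
  "is_cover A Y W X \<Longrightarrow> a \<in> Y \<Longrightarrow> b \<in> Y \<Longrightarrow> (a, b) \<in> A \<Longrightarrow> \<not> (a \<in> W \<and> b \<in> W) \<Longrightarrow> a \<in> X \<or> b \<in> X"
  unfolding is_cover_def by blast

section \<open>Exchange arguments for the three partial solutions\<close>

context leaf
begin

text \<open>By \<open>dominated_rest\<close>, the vertices outside \<open>C\<close> other than
  \<open>v\<close> stay dominated when \<open>C\<close> is removed. Only \<open>v\<close> may have
  relied on \<open>C\<close> and needs a new reason.\<close>

lemma feasible_restI:
  assumes S: "feasible A R P W S" and "W \<subseteq> W'" "T \<subseteq> R - C" "S \<inter> (R - C) \<subseteq> T" "P' \<inter> (R - C) \<subseteq> T"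
    and v: "v \<in> T \<or> v \<in> W' \<or> dominated A (R - C) S v"
  shows "feasible A (R - C) P' W' T"
  unfolding feasible_def
proof (intro conjI ballI)
  fix z assume z: "z \<in> R - C - T - W'"
  have "dominated A (R - C) S z"
  proof (cases "z = v")
    case True
    with v z show ?thesis by blast
  next
    case False
    moreover have "z \<in> R - C" "z \<notin> S" "z \<notin> W" using z assms(2,4) by blast+
    ultimately show ?thesis using S unfolding feasible_iff by blast
  qed
  then show "dominated A (R - C) T z" using assms(4) by (rule dominated_mono)
qed (use assms in auto)

text \<open>An uncovered edge that counts has an end outside both \<open>W\<close> and
  \<open>S\<close>; such a vertex of \<open>C\<close> needs all its neighbours in \<open>S\<close>,
  the other end included.\<close>

lemma is_cover_C:
  assumes "feasible A R P W S"
  shows "is_cover A (C - P) W (S \<inter> C - P)"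
proof (rule is_coverI)
  fix a b assume ab: "a \<in> C - P" "b \<in> C - P" "(a, b) \<in> A" "\<not> (a \<in> W \<and> b \<in> W)"
  moreover have "(b, a) \<in> A" using ab(3) sym by (rule symD[rotated])
  ultimately have "a \<in> S \<or> b \<in> S"
    using assms C_subset unfolding feasible_iff by blast
  with ab show "a \<in> S \<inter> C - P \<or> b \<in> S \<inter> C - P" by blast
qed blast

text \<open>Serves both queries that include \<open>v\<close>: \<open>W' = insert v W\<close> when
  \<open>v\<close> is merely unchosen, and \<open>W' = W\<close> when \<open>C\<close> has to
  dominate it.\<close>

lemma is_cover_insert:
  assumes S: "feasible A R P W S" and "v \<notin> S"
    and nbrs: "\<And>y. y \<in> C \<Longrightarrow> (v, y) \<in> A \<Longrightarrow> y \<notin> S \<Longrightarrow> y \<in> W' \<and> v \<in> W'" and "W \<subseteq> W'"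
  shows "is_cover A (insert v C - P) W' (S \<inter> C - P)"
proof (rule is_coverI)
  fix a b assume ab: "a \<in> insert v C - P" "b \<in> insert v C - P" "(a, b) \<in> A" "\<not> (a \<in> W' \<and> b \<in> W')"
  have ba: "(b, a) \<in> A" using ab(3) sym by (rule symD[rotated])
  consider "a \<in> C" "b \<in> C" | "a = v" "b \<in> C" | "a \<in> C" "b = v"
    using ab irrefl by blast
  then show "a \<in> S \<inter> C - P \<or> b \<in> S \<inter> C - P"
  proof cases
    case 1
    then show ?thesis using is_coverD[OF is_cover_C[OF S], of a b] ab \<open>W \<subseteq> W'\<close> by blast
  next
    case 2
    then show ?thesis using nbrs[of b] ab by blast
  next
    case 3
    then show ?thesis using nbrs[of a] ab ba by blast
  qed
qed blast

text \<open>The additional vertex \<open>v\<close> of \<open>W'\<close> is not an end of any edge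
  inside \<open>C - P\<close>, so the same edges count there.\<close>

lemma is_cover_remove_v:
  assumes "is_cover A (insert v C - P) W' X" "W' \<subseteq> insert v W"
  shows "is_cover A (C - P) W (X - {v})"
proof (rule is_coverI)
  show "X - {v} \<subseteq> C - P" using assms(1) by (auto simp: is_cover_def)
next
  fix a b assume ab: "a \<in> C - P" "b \<in> C - P" "(a, b) \<in> A" "\<not> (a \<in> W \<and> b \<in> W)"
  then have "a \<noteq> v" "b \<noteq> v" using v_notin_C by auto
  then show "a \<in> X - {v} \<or> b \<in> X - {v}"
    using is_coverD[OF assms(1), of a b] ab assms(2) by blast
qed

text \<open>The cost of trading the part \<open>S \<inter> C - P\<close> of a solution for
  \<open>X\<close>, written additively to avoid truncated subtraction.\<close>

lemma card_reduced:
  assumes S: "feasible A R P W S" and "finite P"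
  shows "card (S \<inter> (R - C) \<union> (P \<union> X)) + card (S \<inter> C - P) \<le> card (S \<union> P) + card X"
proof -
  have "finite S" using S finite finite_subset by (auto simp: feasible_def)
  have "card (S \<inter> (R - C) \<union> P) + card (S \<inter> C - P) = card (S \<inter> (R - C) \<union> P \<union> (S \<inter> C - P))"
    using \<open>finite S\<close> \<open>finite P\<close> by (intro card_Un_disjoint[symmetric]) auto
  also have "\<dots> \<le> card (S \<union> P)"
    using \<open>finite S\<close> \<open>finite P\<close> by (intro card_mono) auto
  finally have "card (S \<inter> (R - C) \<union> P) + card (S \<inter> C - P) \<le> card (S \<union> P)" .
  moreover have "card (S \<inter> (R - C) \<union> (P \<union> X)) \<le> card (S \<inter> (R - C) \<union> P) + card X"
    by (metis Un_assoc card_Un_le)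
  ultimately show ?thesis by linarith
qed

text \<open>An optimal solution on \<open>C\<close> costs \<open>card X\<^sub>1\<close> if \<open>v\<close> is chosen, \<open>card X\<^sub>2\<close> if it is not, and
  \<open>card X\<^sub>3\<close> if in addition \<open>C\<close> is to dominate \<open>v\<close>. As choosing \<open>v\<close> costs one more vertex,
  which of these solutions to use does not depend on the rest of the graph.\<close>

context
  fixes P W X\<^sub>1 X\<^sub>2 X\<^sub>3 :: "'a set"
  assumes P: "finite P"
    and X\<^sub>1: "is_min_cover A (C - P) W X\<^sub>1"
    and X\<^sub>2: "is_min_cover A (insert v C - P) (insert v W) X\<^sub>2"
    and X\<^sub>3: "is_min_cover A (insert v C - P) W X\<^sub>3"
begin

lemma cover_subset: "X\<^sub>1 \<subseteq> C - P" "X\<^sub>2 \<subseteq> insert v C - P" "X\<^sub>3 \<subseteq> insert v C - P"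
  using X\<^sub>1 X\<^sub>2 X\<^sub>3 by (auto simp: is_min_cover_def is_cover_def)

lemma finite_cover: "is_min_cover A (insert v C - P) W' X \<Longrightarrow> finite X"
  using finite_subset[OF C_subset] finite
  by (auto simp: is_min_cover_def is_cover_def intro: finite_subset[of X "insert v C - P"])

text \<open>Dropping \<open>v\<close> would leave a cover of \<open>C - P\<close> smaller than the
  minimum \<open>X\<^sub>1\<close>. So a cover that gets fixed because it is as cheap as
  \<open>X\<^sub>1\<close> lies in \<open>C\<close> and does not choose \<open>v\<close>.\<close>

lemma v_notin_cover:
  assumes "is_min_cover A (insert v C - P) W' X" "W' \<subseteq> insert v W" "card X \<le> card X\<^sub>1"
  shows "v \<notin> X"
proof
  assume "v \<in> X"
  have "card X\<^sub>1 \<le> card (X - {v})"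
    using is_cover_remove_v assms(1,2) X\<^sub>1 unfolding is_min_cover_def by blast
  also have "\<dots> < card X" using \<open>v \<in> X\<close> finite_cover[OF assms(1)] by (rule card_Diff1_less[rotated])
  finally show False using assms(3) by simp
qed

lemma card_cover_le: "feasible A R P W S \<Longrightarrow> card X\<^sub>1 \<le> card (S \<inter> C - P)"
  using is_cover_C X\<^sub>1 unfolding is_min_cover_def by blast

text \<open>If \<open>v\<close> is unchosen, an unchosen neighbour \<open>y\<close> in
  \<open>C\<close> must belong to \<open>W\<close>, since otherwise it would need all its
  neighbours, among them \<open>v\<close>.\<close>

lemma card_cover_le_not_chosen: "feasible A R P W S \<Longrightarrow> v \<notin> S \<Longrightarrow> card X\<^sub>2 \<le> card (S \<inter> C - P)"
proof -
  assume S: "feasible A R P W S" "v \<notin> S"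
  have "is_cover A (insert v C - P) (insert v W) (S \<inter> C - P)"
  proof (rule is_cover_insert[OF S])
    fix y assume "y \<in> C" "(v, y) \<in> A" "y \<notin> S"
    moreover from this sym have "(y, v) \<in> A" by (auto dest: symD)
    ultimately show "y \<in> insert v W \<and> v \<in> insert v W"
      using S v unfolding feasible_iff by blast
  qed blast
  with X\<^sub>2 show ?thesis unfolding is_min_cover_def by blast
qed

lemma card_cover_le_dominated:
  assumes "feasible A R P W S" "v \<notin> S" "\<And>y. y \<in> C \<Longrightarrow> (v, y) \<in> A \<Longrightarrow> y \<in> S"
  shows "card X\<^sub>3 \<le> card (S \<inter> C - P)"
  using is_cover_insert[OF assms(1,2), of W] assms(3) X\<^sub>3 unfolding is_min_cover_def by blast

text \<open>Common to the three cases. Premise \<open>C\<close> says that the edges at vertices of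
  \<open>C\<close> not yet dominated are covered; \<open>nbrs\<close> says that \<open>v\<close> is
  newly exempted only if it is chosen anyway or all its neighbours in \<open>C\<close> are.\<close>

lemma feasible_extend:
  assumes S': "feasible A (R - C) P' W' S'" and P': "P \<subseteq> P'" "W' \<subseteq> insert v W"
    and C: "\<And>w y. w \<in> C - W - P' \<Longrightarrow> y \<in> insert v C - P' - S' \<Longrightarrow> (w, y) \<in> A \<Longrightarrow> False"
    and nbrs: "\<And>y. v \<notin> S' \<Longrightarrow> v \<in> W' - W \<Longrightarrow> y \<in> C - P' \<Longrightarrow> (v, y) \<in> A \<Longrightarrow> False"
  shows "feasible A R P W (S' \<union> P' \<inter> R)"
proof -
  let ?S = "S' \<union> P' \<inter> R"
  have S'_sub: "S' \<subseteq> R - C" "P' \<inter> (R - C) \<subseteq> S'" using S' by (auto simp: feasible_def)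
  have dom: "dominated A (R - C) ?S z" if "z \<in> R - C - S' - W'" for z
    using S' that by (auto simp: feasible_def intro: dominated_mono)
  have "?S \<subseteq> R" "P \<inter> R \<subseteq> ?S" using S'_sub P' by auto
  moreover have "y \<in> ?S" if w: "w \<in> C - ?S - W" and y: "y \<in> R" "(w, y) \<in> A" for w y
  proof (rule ccontr)
    assume "y \<notin> ?S"
    moreover have "y \<in> insert v C" using C_closed w y by blast
    moreover have "w \<notin> P'" using w C_subset by blast
    ultimately show False using C[of w y] w y by blast
  qed
  moreover have "dominated A (R - C) ?S z" if "z \<in> R - C - {v} - ?S - W" for z
    using dom[of z] that P'(2) by blast
  moreover have "(\<forall>y\<in>C. (v, y) \<in> A \<longrightarrow> y \<in> ?S) \<or> dominated A (R - C) ?S v" if "v \<notin> ?S" "v \<notin> W"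
  proof (cases "v \<in> W'")
    case True
    then have "y \<in> P'" if "y \<in> C" "(v, y) \<in> A" for y
      using nbrs[of y] that \<open>v \<notin> ?S\<close> \<open>v \<notin> W\<close> by blast
    then show ?thesis using C_subset by blast
  next
    case False
    then show ?thesis using dom[of v] that v v_notin_C by blast
  qed
  ultimately show ?thesis unfolding feasible_iff by blast
qed

text \<open>Every solution spends at least \<open>card X\<^sub>1\<close> on \<open>C\<close>, so
  replacing its part there by \<open>X\<^sub>3\<close> costs nothing and relieves the rest of
  dominating \<open>v\<close>.\<close>

lemma reduces_dominated:
  assumes "card X\<^sub>3 \<le> card X\<^sub>1"
  shows "reduces A R P W (R - C) (P \<union> X\<^sub>3) (insert v W)"
proof (rule reducesI)
  have X: "X\<^sub>3 \<subseteq> C" using v_notin_cover[OF X\<^sub>3 _ assms] cover_subset(3) by blast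
  then show "P \<union> X\<^sub>3 \<subseteq> P \<union> R" using C_subset by blast
  have cover: "is_cover A (insert v C - P) W X\<^sub>3" using X\<^sub>3 by (simp add: is_min_cover_def)
  show "feasible A R P W (S' \<union> (P \<union> X\<^sub>3) \<inter> R)" if S': "feasible A (R - C) (P \<union> X\<^sub>3) (insert v W) S'" for S'
  proof (rule feasible_extend[OF S'])
    show False if "w \<in> C - W - (P \<union> X\<^sub>3)" "y \<in> insert v C - (P \<union> X\<^sub>3) - S'" "(w, y) \<in> A" for w y
      using is_coverD[OF cover, of w y] that by blast
    show False if "v \<notin> S'" "v \<in> insert v W - W" "y \<in> C - (P \<union> X\<^sub>3)" "(v, y) \<in> A" for y
    proof -
      have "v \<notin> P" using S' \<open>v \<notin> S'\<close> v v_notin_C by (auto simp: feasible_def)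
      then show False using is_coverD[OF cover, of v y] that X v_notin_C by blast
    qed
  qed blast+
  show "\<exists>S'. feasible A (R - C) (P \<union> X\<^sub>3) (insert v W) S' \<and> card (S' \<union> (P \<union> X\<^sub>3)) \<le> card (S \<union> P)"
    if S: "feasible A R P W S" for S
  proof (intro exI conjI)
    show "feasible A (R - C) (P \<union> X\<^sub>3) (insert v W) (S \<inter> (R - C))"
      by (rule feasible_restI[OF S]) (use X S in \<open>auto simp: feasible_def\<close>)
    show "card (S \<inter> (R - C) \<union> (P \<union> X\<^sub>3)) \<le> card (S \<union> P)"
      using card_reduced[OF S P, of X\<^sub>3] card_cover_le[OF S] assms by linarith
  qed
qed blast

text \<open>If \<open>v\<close> is chosen, exempt or dominated from the rest, trading for
  \<open>X\<^sub>2\<close> costs nothing. If \<open>v\<close> relies on \<open>C\<close>, at least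
  \<open>card X\<^sub>3\<close> is spent there, and the vertex saved by \<open>X\<^sub>2\<close>
  pays for \<open>v\<close> itself.\<close>

lemma reduces_not_chosen:
  assumes "card X\<^sub>1 < card X\<^sub>3" "card X\<^sub>2 \<le> card X\<^sub>1"
  shows "reduces A R P W (R - C) (P \<union> X\<^sub>2) W"
proof (rule reducesI)
  have X: "X\<^sub>2 \<subseteq> C" using v_notin_cover[OF X\<^sub>2 _ assms(2)] cover_subset(2) by blast
  then show "P \<union> X\<^sub>2 \<subseteq> P \<union> R" using C_subset by blast
  have cover: "is_cover A (insert v C - P) (insert v W) X\<^sub>2" using X\<^sub>2 by (simp add: is_min_cover_def)
  show "feasible A R P W (S' \<union> (P \<union> X\<^sub>2) \<inter> R)" if S': "feasible A (R - C) (P \<union> X\<^sub>2) W S'" for S'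
  proof (rule feasible_extend[OF S'])
    show False if "w \<in> C - W - (P \<union> X\<^sub>2)" "y \<in> insert v C - (P \<union> X\<^sub>2) - S'" "(w, y) \<in> A" for w y
      using is_coverD[OF cover, of w y] that v_notin_C by blast
  qed blast+
  show "\<exists>S'. feasible A (R - C) (P \<union> X\<^sub>2) W S' \<and> card (S' \<union> (P \<union> X\<^sub>2)) \<le> card (S \<union> P)"
    if S: "feasible A R P W S" for S
  proof (cases "v \<in> S \<or> v \<in> W \<or> dominated A (R - C) S v")
    case True
    have "feasible A (R - C) (P \<union> X\<^sub>2) W (S \<inter> (R - C))"
      by (rule feasible_restI[OF S]) (use X S True v v_notin_C in \<open>auto simp: feasible_def\<close>)
    moreover have "card (S \<inter> (R - C) \<union> (P \<union> X\<^sub>2)) \<le> card (S \<union> P)"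
      using card_reduced[OF S P, of X\<^sub>2] card_cover_le[OF S] assms by linarith
    ultimately show ?thesis by blast
  next
    case False
    then have "\<forall>y\<in>C. (v, y) \<in> A \<longrightarrow> y \<in> S" using S unfolding feasible_iff by blast
    then have le: "card X\<^sub>3 \<le> card (S \<inter> C - P)" using card_cover_le_dominated[OF S] False by blast
    have "feasible A (R - C) (P \<union> X\<^sub>2) W (insert v (S \<inter> (R - C)))"
      by (rule feasible_restI[OF S]) (use X S v v_notin_C in \<open>auto simp: feasible_def\<close>)
    moreover have "card (insert v (S \<inter> (R - C)) \<union> (P \<union> X\<^sub>2)) \<le> card (S \<union> P)"
    proof -
      have "card (insert v (S \<inter> (R - C)) \<union> (P \<union> X\<^sub>2)) \<le> Suc (card (S \<inter> (R - C) \<union> (P \<union> X\<^sub>2)))"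
        by (simp add: card_insert_le_m1)
      also have "\<dots> \<le> card (S \<union> P)"
        using card_reduced[OF S P, of X\<^sub>2] le assms by linarith
      finally show ?thesis .
    qed
    ultimately show ?thesis by blast
  qed
qed blast

text \<open>A solution with \<open>v\<close> spends at least \<open>card X\<^sub>1\<close> on
  \<open>C\<close> besides \<open>v\<close>; one without \<open>v\<close> spends at least
  \<open>card X\<^sub>2\<close>, hence one more than \<open>card X\<^sub>1\<close>. Taking
  \<open>v\<close> together with \<open>X\<^sub>1\<close> is never worse.\<close>

lemma reduces_chosen:
  assumes "card X\<^sub>1 < card X\<^sub>3" "card X\<^sub>1 < card X\<^sub>2"
  shows "reduces A R P W (R - C) (insert v (P \<union> X\<^sub>1)) W"
proof (rule reducesI)
  show "insert v (P \<union> X\<^sub>1) \<subseteq> P \<union> R" using cover_subset(1) C_subset v by blast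
  have cover: "is_cover A (C - P) W X\<^sub>1" using X\<^sub>1 by (simp add: is_min_cover_def)
  show "feasible A R P W (S' \<union> insert v (P \<union> X\<^sub>1) \<inter> R)"
    if S': "feasible A (R - C) (insert v (P \<union> X\<^sub>1)) W S'" for S'
  proof (rule feasible_extend[OF S'])
    show False if "w \<in> C - W - insert v (P \<union> X\<^sub>1)" "y \<in> insert v C - insert v (P \<union> X\<^sub>1) - S'" "(w, y) \<in> A" for w y
      using is_coverD[OF cover, of w y] that by blast
  qed blast+
  show "\<exists>S'. feasible A (R - C) (insert v (P \<union> X\<^sub>1)) W S' \<and> card (S' \<union> insert v (P \<union> X\<^sub>1)) \<le> card (S \<union> P)"
    if S: "feasible A R P W S" for S
  proof (intro exI conjI)
    show "feasible A (R - C) (insert v (P \<union> X\<^sub>1)) W (insert v (S \<inter> (R - C)))"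
      by (rule feasible_restI[OF S]) (use S v v_notin_C cover_subset(1) in \<open>auto simp: feasible_def\<close>)
    have le: "card (S \<inter> (R - C) \<union> (P \<union> X\<^sub>1)) + card (S \<inter> C - P) \<le> card (S \<union> P) + card X\<^sub>1"
      by (rule card_reduced[OF S P])
    have eq: "insert v (S \<inter> (R - C)) \<union> insert v (P \<union> X\<^sub>1) = insert v (S \<inter> (R - C) \<union> (P \<union> X\<^sub>1))"
      by blast
    show "card (insert v (S \<inter> (R - C)) \<union> insert v (P \<union> X\<^sub>1)) \<le> card (S \<union> P)"
    proof (cases "v \<in> S")
      case True
      then have "insert v (S \<inter> (R - C) \<union> (P \<union> X\<^sub>1)) = S \<inter> (R - C) \<union> (P \<union> X\<^sub>1)"
        using v v_notin_C by blast
      then show ?thesis using le card_cover_le[OF S] by (simp only: eq)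
    next
      case False
      have "card (insert v (S \<inter> (R - C) \<union> (P \<union> X\<^sub>1))) \<le> Suc (card (S \<inter> (R - C) \<union> (P \<union> X\<^sub>1)))"
        by (simp add: card_insert_le_m1)
      then show ?thesis
        unfolding eq using le card_cover_le_not_chosen[OF S False] assms by linarith
    qed
  qed
qed blast

end

end

section \<open>Correctness of the algorithm\<close>

lemma grow_Cons: "grow (a # d) X t =
    grow d X (if fst a \<in> set t \<and> snd a \<in> set X \<and> snd a \<notin> set t then snd a # t else t)"
  by (simp add: grow_def)

lemma subset_grow: "set t \<subseteq> set (grow d X t)"
proof (induction d arbitrary: t)
  case (Cons a d)
  show ?case
    using Cons[of "if fst a \<in> set t \<and> snd a \<in> set X \<and> snd a \<notin> set t then snd a # t else t"]
    unfolding grow_Cons by (auto split: if_splits)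
qed (simp add: grow_def)

text \<open>One pass adds at least all direct successors. It may add more, as vertices found during
  a pass are used at once.\<close>

lemma grow_closed: "(a, b) \<in> set d \<Longrightarrow> a \<in> set t \<Longrightarrow> b \<in> set X \<Longrightarrow> b \<in> set (grow d X t)"
proof (induction d arbitrary: t)
  case (Cons c d)
  let ?t = "if fst c \<in> set t \<and> snd c \<in> set X \<and> snd c \<notin> set t then snd c # t else t"
  show ?case
  proof (cases "c = (a, b)")
    case True
    then have "b \<in> set ?t" using Cons.prems by simp
    from subsetD[OF subset_grow this] show ?thesis unfolding grow_Cons .
  next
    case False
    have "b \<in> set (grow d X ?t)" by (rule Cons.IH) (use False Cons.prems in simp_all)
    then show ?thesis unfolding grow_Cons .
  qed
qed simp

lemma grow_reachable:
  assumes "u \<in> set X" "set t \<subseteq> {w. (u, w) \<in> (Restr (set d) (set X))\<^sup>*}"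
  shows "set (grow d X t) \<subseteq> {w. (u, w) \<in> (Restr (set d) (set X))\<^sup>*}"
  unfolding grow_def
proof (rule fold_invariant[where Q = "\<lambda>a. a \<in> set d"])
  fix a t assume a: "a \<in> set d" and t: "set t \<subseteq> {w. (u, w) \<in> (Restr (set d) (set X))\<^sup>*}"
  have "(u, snd a) \<in> (Restr (set d) (set X))\<^sup>*" if "fst a \<in> set t" "snd a \<in> set X"
  proof -
    have r: "(u, fst a) \<in> (Restr (set d) (set X))\<^sup>*" using t that(1) by blast
    then have "(fst a, snd a) \<in> Restr (set d) (set X)"
      using a that(2) rtrancl_Restr_mem[OF r assms(1)] by (cases a) auto
    with r show ?thesis by (rule rtrancl_into_rtrancl)
  qed
  with t show "set (if fst a \<in> set t \<and> snd a \<in> set X \<and> snd a \<notin> set t then snd a # t else t)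
      \<subseteq> {w. (u, w) \<in> (Restr (set d) (set X))\<^sup>*}"
    by auto
qed (use assms in auto)

lemma fold_const_funpow: "fold (\<lambda>_. f) xs = f ^^ length xs"
  by (induction xs) (auto simp: funpow_Suc_right simp del: funpow.simps)

lemma set_component:
  assumes "u \<in> set X"
  shows "set (component d X u) = {w. (u, w) \<in> (Restr (set d) (set X))\<^sup>*}" (is "_ = {w. (u, w) \<in> ?r\<^sup>*}")
proof
  show "set (component d X u) \<subseteq> {w. (u, w) \<in> ?r\<^sup>*}"
    unfolding component_def
    by (rule fold_invariant[where Q = "\<lambda>_. True"], simp, use assms in simp)
      (rule grow_reachable[OF assms])
next
  have reach: "w \<in> set ((grow d X ^^ n) [u])" if "(u, w) \<in> ?r ^^ n" for n w
    using that
  proof (induction n arbitrary: w)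
    case (Suc n)
    then obtain y where "(u, y) \<in> ?r ^^ n" "(y, w) \<in> ?r" by auto
    then show ?case using Suc.IH[of y] grow_closed[of y w d _ X] by simp
  qed simp
  have mono: "set ((grow d X ^^ m) t) \<subseteq> set ((grow d X ^^ n) t)" if "m \<le> n" for m n t
    using that
  proof (induction n rule: dec_induct)
    case (step n)
    then show ?case using subset_grow[of "(grow d X ^^ n) t" d X] by simp
  qed simp
  show "{w. (u, w) \<in> ?r\<^sup>*} \<subseteq> set (component d X u)"
  proof
    fix w assume "w \<in> {w. (u, w) \<in> ?r\<^sup>*}"
    moreover have fin: "finite ?r" by simp
    ultimately obtain n where n: "n \<le> card ?r" "(u, w) \<in> ?r ^^ n"
      using rtrancl_finite_eq_relpow[OF fin] by auto
    \<comment> \<open>Walks of at most \<open>card ?r\<close> steps reach everything reachable, and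
      \<open>d\<close> lists each arc at least once; repetitions only add passes.\<close>
    have "card ?r \<le> length d"
      using card_mono[of "set d" ?r] card_length[of d] by auto
    then show "w \<in> set (component d X u)"
      using reach[OF n(2)] mono[of n "length d" "[u]"] n(1)
      by (auto simp: component_def fold_const_funpow)
  qed
qed

lemma component_neq_Nil: "u \<in> set X \<Longrightarrow> component d X u \<noteq> []"
  using set_component[of u X d] by force

text \<open>The invariant \<open>good\<close> of a search for a minimum, over the arcs scanned so
  far. Since components are nonempty, an empty result shows that no arc joins two vertices of
  \<open>R\<close>.\<close>

lemma smallest_component_cases:
  assumes "\<And>a. a \<in> set d \<Longrightarrow> fst a \<noteq> snd a"
  defines "c \<equiv> \<lambda>a R. component d (removeAll (fst a) R) (snd a)"
  shows "(\<forall>a\<in>set d. fst a \<in> set R \<longrightarrow> snd a \<in> set R \<longrightarrow> snd (smallest_component d R) \<noteq> [] \<and>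
      length (snd (smallest_component d R)) \<le> length (c a R)) \<and>
    (smallest_component d R = (0, []) \<or>
      (\<exists>a\<in>set d. fst a \<in> set R \<and> snd a \<in> set R \<and> smallest_component d R = (fst a, c a R)))"
proof -
  have c: "c a R \<noteq> []" if "a \<in> set d" "snd a \<in> set R" for a
    unfolding c_def by (rule component_neq_Nil) (use assms(1)[OF that(1)] that(2) in auto)
  define good where "good xs t \<longleftrightarrow>
      (\<forall>a\<in>set xs. fst a \<in> set R \<longrightarrow> snd a \<in> set R \<longrightarrow> snd t \<noteq> [] \<and> length (snd t) \<le> length (c a R)) \<and>
      (t = (0, []) \<or> (\<exists>a\<in>set xs. fst a \<in> set R \<and> snd a \<in> set R \<and> t = (fst a, c a R)))" for xs t
  have step: "good (xs @ [a]) (smaller_component d R a t)" if t: "good xs t" and a: "a \<in> set d" for xs a t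
  proof (cases "fst a \<in> set R \<and> snd a \<in> set R \<and> (snd t = [] \<or> length (c a R) < length (snd t))")
    case True
    then have new: "smaller_component d R a t = (fst a, c a R)"
      by (simp add: smaller_component_def c_def)
    have "length (c a R) \<le> length (c b R)" if "b \<in> set xs" "fst b \<in> set R" "snd b \<in> set R" for b
    proof -
      have "snd t \<noteq> []" "length (snd t) \<le> length (c b R)" using t that by (simp_all add: good_def)
      with True show ?thesis by simp
    qed
    then show ?thesis unfolding new good_def using True c[OF a] by simp
  next
    case False
    then have "smaller_component d R a t = t" by (auto simp: smaller_component_def c_def)
    with False t show ?thesis unfolding good_def by fastforce
  qed
  have "set xs \<subseteq> set d \<Longrightarrow> good xs (fold (smaller_component d R) xs (0, []))" for xs
    by (induction xs rule: rev_induct) (simp add: good_def, simp add: step)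
  from this[of d] show ?thesis unfolding smallest_component_def good_def by simp
qed

definition edge_set :: "('a \<times> 'a) list \<Rightarrow> 'a set set" where
  "edge_set es = set (map (\<lambda>(u, v). {u, v}) es)"

lemma mem_edge_set: "{a, b} \<in> edge_set es \<longleftrightarrow> (a, b) \<in> set es \<or> (b, a) \<in> set es"
  by (force simp: edge_set_def doubleton_eq_iff)

lemma set_arcs: "set (arcs es) = {(a, b). {a, b} \<in> edge_set es}"
  by (force simp: arcs_def mem_edge_set)

text \<open>\<open>reduces\<close> composed along a run: \<open>S \<mapsto> S \<union> P\<close> maps feasible sets of a state to simultaneous
  dominating sets, and does not lose the minimum.\<close>

definition represents :: "'a rel \<Rightarrow> 'a set \<Rightarrow> 'a set \<Rightarrow> 'a set \<Rightarrow> 'a set \<Rightarrow> bool" where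
  "represents A V R P W \<longleftrightarrow>
     (\<forall>S. feasible A R P W S \<longrightarrow> feasible A V {} {} (S \<union> P)) \<and>
     (\<forall>T. feasible A V {} {} T \<longrightarrow> (\<exists>S. feasible A R P W S \<and> card (S \<union> P) \<le> card T))"

lemma represents_reduces:
  assumes "represents A V R P W" "reduces A R P W R' P' W'"
  shows "represents A V R' P' W'"
  unfolding represents_def
proof (intro conjI allI impI)
  fix S' assume "feasible A R' P' W' S'"
  then have "feasible A R P W (S' \<union> P' \<inter> R)" using assms(2) by (simp add: reduces_def)
  then have "feasible A V {} {} (S' \<union> P' \<inter> R \<union> P)" using assms(1) by (simp add: represents_def)
  moreover have "S' \<union> P' \<inter> R \<union> P = S' \<union> P'" using assms(2) by (auto simp: reduces_def)
  ultimately show "feasible A V {} {} (S' \<union> P')" by simp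
next
  fix T assume "feasible A V {} {} T"
  then obtain S where "feasible A R P W S" "card (S \<union> P) \<le> card T"
    using assms(1) unfolding represents_def by blast
  moreover from this obtain S' where "feasible A R' P' W' S'" "card (S' \<union> P') \<le> card (S \<union> P)"
    using assms(2) unfolding reduces_def by blast
  ultimately show "\<exists>S. feasible A R' P' W' S \<and> card (S \<union> P') \<le> card T" by (meson le_trans)
qed

text \<open>Correctness for one fixed input, separated from running time and from the classes of
  graphs: \<open>solve\<close> matters only through the covers it yields.\<close>

locale sound_solver =
  fixes G :: "nat ugraph" and vs :: "nat list" and es :: "(nat \<times> nat) list"
    and solve :: "nat list \<Rightarrow> (nat \<times> nat) list \<Rightarrow> nat list"
  assumes simple: "simple_graph G" and connected: "connected_graph G"
    and vs: "distinct vs" "set vs = verts G" and es: "edge_set es = edges G"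
    and distinct_cover: "distinct Y \<Longrightarrow> set Y \<subseteq> verts G \<Longrightarrow> distinct (cover solve es Y W)"
    and min_cover: "distinct Y \<Longrightarrow> set Y \<subseteq> verts G \<Longrightarrow>
      is_min_cover (adjacent G) (set Y) (set W) (set (cover solve es Y W))"
begin

abbreviation "A \<equiv> adjacent G"

lemma arcs_eq: "set (arcs es) = A"
  by (simp add: set_arcs es adjacent_def)

lemma arcs_irrefl: "a \<in> set (arcs es) \<Longrightarrow> fst a \<noteq> snd a"
  using adjacent_irrefl[OF simple] by (cases a) (auto simp: arcs_eq)

definition invariant :: "state \<Rightarrow> bool" where
  "invariant t \<longleftrightarrow> valid_state vs t \<and> fst t \<noteq> [] \<and>
     (\<forall>x\<in>set (fst t). \<forall>y\<in>set (fst t). (x, y) \<in> (Restr A (set (fst t)))\<^sup>*) \<and>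
     represents A (verts G) (set (fst t)) (set (fst (snd t))) (set (snd (snd t)))"

lemma invariant_init: "invariant (vs, [], [])"
  using vs connected Restr_adjacent[OF simple]
  by (auto simp: invariant_def valid_state_def represents_def connected_graph_def)

lemma leaf_smallest_component:
  assumes "invariant (R, P, W)" "smallest_component (arcs es) R = (v, C)" "C \<noteq> []"
  obtains u where "leaf A (set R) v u (set C)" "distinct C"
proof -
  note cases = smallest_component_cases[of "arcs es" R, OF arcs_irrefl, simplified assms(2)]
  let ?c = "\<lambda>a. component (arcs es) (removeAll (fst a) R) (snd a)"
  have comp: "set (?c a) = {w. (snd a, w) \<in> (Restr A (set R - {fst a}))\<^sup>*}" "length (?c a) = card (set (?c a))"
    if "a \<in> A" "snd a \<in> set R" for a
  proof -
    have mem: "snd a \<in> set (removeAll (fst a) R)"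
      using arcs_irrefl[of a] that by (auto simp: arcs_eq)
    show "set (?c a) = {w. (snd a, w) \<in> (Restr A (set R - {fst a}))\<^sup>*}"
      using set_component[OF mem, of "arcs es"] by (simp add: arcs_eq)
    show "length (?c a) = card (set (?c a))"
      using component_invariant[OF mem, of "arcs es"] by (simp add: distinct_card)
  qed
  obtain u where u: "(v, u) \<in> A" "v \<in> set R" "u \<in> set R" and C: "C = ?c (v, u)"
    using cases assms(3) by (fastforce simp: arcs_eq)
  have least: "length C \<le> length (?c a)" if "a \<in> A" "fst a \<in> set R" "snd a \<in> set R" for a
    using cases that by (simp add: arcs_eq)
  have "leaf A (set R) v u (set C)"
  proof
    show "set C = {w. (u, w) \<in> (Restr A (set R - {v}))\<^sup>*}" using comp[of "(v, u)"] u C by simp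
    show "card (set C) \<le> card {w. (b, w) \<in> (Restr A (set R - {a}))\<^sup>*}"
      if "a \<in> set R" "b \<in> set R" "(a, b) \<in> A" for a b
      using least[of "(a, b)"] comp[of "(a, b)"] comp(2)[of "(v, u)"] u C that by simp
  qed (use u assms(1) sym_adjacent adjacent_irrefl[OF simple] in \<open>auto simp: invariant_def\<close>)
  moreover have "distinct C"
    using valid_smallest_component[of "arcs es" R, OF arcs_irrefl] assms(2,3) by (auto simp: valid_choice_def)
  ultimately show ?thesis by (rule that)
qed

lemma invariant_step:
  assumes inv: "invariant (R, P, W)" and vC: "smallest_component (arcs es) R = (v, C)" and "C \<noteq> []"
  shows "invariant (step solve es (R, P, W)) \<and> length (fst (step solve es (R, P, W))) < length R"
proof -
  obtain u where leaf: "leaf A (set R) v u (set C)" and dC: "distinct C"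
    by (rule leaf_smallest_component[OF assms])
  interpret leaf A "set R" v u "set C" by (rule leaf)
  let ?Y = "filter (\<lambda>w. w \<notin> set P) C" and ?Z = "filter (\<lambda>w. w \<notin> set P) (v # C)"
  let ?X1 = "cover solve es ?Y W" and ?X2 = "cover solve es ?Z (List.insert v W)" and ?X3 = "cover solve es ?Z W"
  let ?R = "filter (\<lambda>w. w \<notin> set C) R"
  have valid: "distinct R" "set R \<subseteq> verts G" "distinct P" "set P \<subseteq> verts G" "distinct W" "set W \<subseteq> verts G"
    using inv vs by (auto simp: invariant_def valid_state_def)
  have Y: "distinct ?Y" "set ?Y \<subseteq> verts G" and Z: "distinct ?Z" "set ?Z \<subseteq> verts G"
    using dC v_notin_C C_subset v valid by auto
  have sets: "set ?Y = set C - set P" "set ?Z = insert v (set C) - set P" "set ?R = set R - set C" by auto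
  have min1: "is_min_cover A (set C - set P) (set W) (set ?X1)"
    using min_cover[OF Y, of W] unfolding sets .
  have min2: "is_min_cover A (insert v (set C) - set P) (insert v (set W)) (set ?X2)"
    using min_cover[OF Z, of "List.insert v W"] unfolding sets set_insert .
  have min3: "is_min_cover A (insert v (set C) - set P) (set W) (set ?X3)"
    using min_cover[OF Z, of W] unfolding sets .
  note red = finite_set[of P] min1 min2 min3
  note dist = distinct_cover[OF Y, of W] distinct_cover[OF Z, of "List.insert v W"] distinct_cover[OF Z, of W]
  \<comment> \<open>As the lists are distinct, the lengths compared by the program are the
    cardinalities in the exchange lemmas.\<close>
  have len: "length ?X1 = card (set ?X1)" "length ?X2 = card (set ?X2)" "length ?X3 = card (set ?X3)"
    using dist[THEN distinct_card] by simp_all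
  have step: "step solve es (R, P, W) = reduce R P W C v ?X1 ?X2 ?X3"
    using assms(3) by (simp add: step_def vC Let_def del: filter.simps)
  define t where "t = reduce R P W C v ?X1 ?X2 ?X3"
  have R: "fst t = ?R" by (simp add: t_def reduce_def)
  have sub: "set ?X1 \<subseteq> verts G - set P" "set ?X2 \<subseteq> verts G - set P" "set ?X3 \<subseteq> verts G - set P"
  proof -
    have "set ?X1 \<subseteq> set C - set P" "set ?X2 \<subseteq> insert v (set C) - set P" "set ?X3 \<subseteq> insert v (set C) - set P"
      using min1[THEN is_min_cover_subset] min2[THEN is_min_cover_subset] min3[THEN is_min_cover_subset] .
    moreover have "insert v (set C) \<subseteq> verts G" using C_subset v valid(2) by blast
    ultimately show "set ?X1 \<subseteq> verts G - set P" "set ?X2 \<subseteq> verts G - set P" "set ?X3 \<subseteq> verts G - set P"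
      by blast+
  qed
  have "valid_state vs t"
    unfolding t_def
  proof (rule valid_reduce)
    show "valid_state vs (R, P, W)" using inv by (simp add: invariant_def)
    show "v \<in> set vs" using v valid(2) vs(2) by blast
    show "distinct X \<and> set X \<subseteq> set vs - set P" if "X \<in> {?X1, ?X2, ?X3}" for X
      using that dist sub vs(2) by (elim insertE) simp_all
  qed
  have reduces: "reduces A (set R) (set P) (set W) (set R - set C) (set (fst (snd t))) (set (snd (snd t)))"
  proof -
    consider "length ?X3 \<le> length ?X1"
      | "\<not> length ?X3 \<le> length ?X1" "length ?X2 \<le> length ?X1"
      | "\<not> length ?X3 \<le> length ?X1" "\<not> length ?X2 \<le> length ?X1" by blast
    then show ?thesis
    proof cases
      case 1
      then have "t = (?R, ?X3 @ P, List.insert v W)" by (simp only: t_def reduce_def if_True)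
      then have "set (fst (snd t)) = set P \<union> set ?X3" "set (snd (snd t)) = insert v (set W)"
        by (simp_all only: fst_conv snd_conv set_append set_insert Un_commute)
      then show ?thesis using reduces_dominated[OF red] 1 len by (simp only:)
    next
      case 2
      then have "t = (?R, ?X2 @ P, W)" by (simp only: t_def reduce_def if_True if_False)
      then have "set (fst (snd t)) = set P \<union> set ?X2" "set (snd (snd t)) = set W"
        by (simp_all only: fst_conv snd_conv set_append Un_commute)
      then show ?thesis using reduces_not_chosen[OF red] 2 len by (simp only: not_le)
    next
      case 3
      then have "t = (?R, List.insert v (?X1 @ P), W)" by (simp only: t_def reduce_def if_False)
      then have "set (fst (snd t)) = insert v (set P \<union> set ?X1)" "set (snd (snd t)) = set W"
        by (simp_all only: fst_conv snd_conv set_append set_insert Un_commute)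
      then show ?thesis using reduces_chosen[OF red] 3 len by (simp only: not_le)
    qed
  qed
  have "represents A (verts G) (set R) (set P) (set W)" using inv by (simp add: invariant_def)
  from represents_reduces[OF this reduces]
  have "represents A (verts G) (set ?R) (set (fst (snd t))) (set (snd (snd t)))"
    unfolding sets .
  moreover note \<open>valid_state vs t\<close>
  moreover have "\<forall>x\<in>set ?R. \<forall>y\<in>set ?R. (x, y) \<in> (Restr A (set ?R))\<^sup>*"
    unfolding sets using connected_rest by blast
  moreover have "?R \<noteq> []" using v v_notin_C sets(3) by (metis DiffI empty_iff list.set(1))
  ultimately have "invariant t" unfolding invariant_def R by blast
  moreover have "length ?R < length R"
    by (rule length_filter_less[of u]) (use u_C u in auto)
  ultimately show ?thesis unfolding step t_def[symmetric] R by blast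
qed

text \<open>Two distinct vertices of the connected remainder would give an edge, hence a nonempty
  proposal.\<close>

lemma smallest_component_Nil:
  assumes inv: "invariant (R, P, W)" and "smallest_component (arcs es) R = (v, [])"
  shows "length R = 1"
proof -
  have "x = y" if "x \<in> set R" "y \<in> set R" for x y
  proof (rule ccontr)
    assume "x \<noteq> y"
    moreover have "(x, y) \<in> (Restr A (set R))\<^sup>*" using inv that by (simp add: invariant_def)
    ultimately obtain z where "(x, z) \<in> Restr A (set R)" by (blast elim: converse_rtranclE)
    then have "(x, z) \<in> A" "x \<in> set R" "z \<in> set R" by simp_all
    moreover have "\<forall>a\<in>A. fst a \<in> set R \<longrightarrow> snd a \<in> set R \<longrightarrow> snd (smallest_component (arcs es) R) \<noteq> []"
      using conjunct1[OF smallest_component_cases[of "arcs es" R, OF arcs_irrefl]]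
      unfolding arcs_eq by blast
    ultimately show False using assms(2) by fastforce
  qed
  moreover have "R \<noteq> []" "distinct R" using inv by (auto simp: invariant_def valid_state_def)
  ultimately show ?thesis by (metis One_nat_def distinct_length_2_or_more length_0_conv length_Cons list.exhaust list.set_intros)
qed

text \<open>Each round removes a vertex until one is left and idles afterwards, hence the maximum
  with 1; as many rounds as vertices suffice.\<close>

lemma invariant_iterate:
  "invariant ((step solve es ^^ n) (vs, [], [])) \<and>
    length (fst ((step solve es ^^ n) (vs, [], []))) \<le> max 1 (length vs - n)"
proof (induction n)
  case (Suc n)
  obtain R P W where t: "(step solve es ^^ n) (vs, [], []) = (R, P, W)" by (metis prod_cases3)
  obtain v C where vC: "smallest_component (arcs es) R = (v, C)" by fastforce
  show ?case
  proof (cases "C = []")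
    case True
    then have "step solve es (R, P, W) = (R, P, W)" by (simp add: step_def vC)
    then show ?thesis
      using Suc smallest_component_Nil[of R P W v] vC True by (simp add: t)
  next
    case False
    have inv: "invariant (R, P, W)" and le: "length R \<le> max 1 (length vs - n)"
      using Suc by (simp_all add: t)
    have "length (fst (step solve es (R, P, W))) \<le> max 1 (length vs - Suc n)"
      using invariant_step[OF inv vC False] le by linarith
    then show ?thesis using invariant_step[OF inv vC False] by (simp add: t)
  qed
qed (use invariant_init in auto)

theorem algorithm_correct:
  "distinct (algorithm solve vs es) \<and>
    minimum_set simultaneous_dominating_set G (set (algorithm solve vs es))"
proof -
  obtain R P W where t: "(step solve es ^^ length vs) (vs, [], []) = (R, P, W)" by (metis prod_cases3)
  have inv: "invariant (R, P, W)" and "length R \<le> 1"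
    using invariant_iterate[of "length vs"] by (auto simp: t)
  then obtain r where R: "R = [r]" by (cases R) (auto simp: invariant_def)
  define L where "L = algorithm solve vs es"
  have L: "L = filter (\<lambda>v. v \<notin> set P \<and> v \<notin> set W) [r] @ P"
    by (simp add: L_def algorithm_def fold_const_funpow t finish_def R)
  have rep: "represents A (verts G) {r} (set P) (set W)"
    using inv by (simp add: invariant_def R)
  \<comment> \<open>Feasibility forces \<open>r\<close> into \<open>S\<close> also if it is in
    \<open>P\<close>; in every case the union with \<open>P\<close> is the returned set.\<close>
  define S where "S = (if r \<in> set P \<or> r \<notin> set W then {r} else {})"
  have "feasible A {r} (set P) (set W) S" by (auto simp: feasible_def S_def)
  then have "feasible A (verts G) {} {} (S \<union> set P)" using rep by (simp add: represents_def)
  moreover have "S \<union> set P = set L" by (auto simp: S_def L)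
  ultimately have sds: "simultaneous_dominating_set G (set L)"
    by (simp add: simultaneous_dominating_set_iff_feasible[OF simple])
  have "card (set L) \<le> card T" if T: "simultaneous_dominating_set G T" for T
  proof -
    obtain S' where S': "feasible A {r} (set P) (set W) S'" "card (S' \<union> set P) \<le> card T"
      using rep T unfolding represents_def simultaneous_dominating_set_iff_feasible[OF simple] by blast
    \<comment> \<open>\<open>dominated\<close> asks for a vertex of \<open>{r} - {r}\<close>, so a
      single remaining vertex is never dominated.\<close>
    have "r \<in> S'" if "r \<notin> set W"
      using S'(1) that by (auto simp: feasible_def dominated_def)
    then have "set L \<subseteq> S' \<union> set P" by (auto simp: L)
    moreover have "finite S'" using S'(1) finite_subset by (auto simp: feasible_def)
    ultimately have "card (set L) \<le> card (S' \<union> set P)" by (intro card_mono) auto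
    with S'(2) show ?thesis by simp
  qed
  moreover have "distinct L" using inv by (auto simp: L invariant_def valid_state_def)
  ultimately show ?thesis using sds by (simp add: minimum_set_def L_def)
qed

end

section \<open>Polynomial-time computation\<close>

definition graph_of :: "'a list \<Rightarrow> ('a \<times> 'a) list \<Rightarrow> 'a ugraph" where
  "graph_of vs es = \<lparr>verts = set vs, edges = edge_set es\<rparr>"

definition list_graph :: "'a list \<Rightarrow> ('a \<times> 'a) list \<Rightarrow> bool" where
  "list_graph vs es \<longleftrightarrow> distinct vs \<and> distinct (map (\<lambda>(u, v). {u, v}) es)"

lemma encodes_graph_of:
  "list_graph vs es \<Longrightarrow> encodes_graph (Pair (enc_nats vs) (enc_edges es)) (graph_of vs es)"
  unfolding encodes_graph_def
  by (intro exI[of _ vs] exI[of _ es]) (simp add: list_graph_def graph_of_def edge_set_def)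

lemma encodes_graphE:
  assumes "encodes_graph x G"
  obtains vs es where "list_graph vs es" "graph_of vs es = G" "x = Pair (enc_nats vs) (enc_edges es)"
proof -
  obtain vs es where *: "distinct vs" "set vs = verts G" "distinct (map (\<lambda>(u, v). {u, v}) es)"
    "set (map (\<lambda>(u, v). {u, v}) es) = edges G" "x = Pair (enc_nats vs) (enc_edges es)"
    using assms unfolding encodes_graph_def by blast
  then have "graph_of vs es = G" unfolding graph_of_def edge_set_def by (simp only:) simp
  with * show ?thesis by (intro that) (auto simp: list_graph_def)
qed

definition restrict_edges :: "(nat \<times> nat) list \<Rightarrow> nat list \<Rightarrow> nat list \<Rightarrow> (nat \<times> nat) list" where
  "restrict_edges es Y W =
     filter (\<lambda>e. fst e \<in> set Y \<and> snd e \<in> set Y \<and> \<not> (fst e \<in> set W \<and> snd e \<in> set W)) es"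

lemma list_graph_restrict: "list_graph vs es \<Longrightarrow> distinct Y \<Longrightarrow> list_graph Y (restrict_edges es Y W)"
  by (simp add: list_graph_def restrict_edges_def distinct_map_filter)

lemma edge_set_restrict:
  "edge_set (restrict_edges es Y W) = {e\<in>edge_set es. e \<subseteq> set Y \<and> \<not> e \<subseteq> set W}"
  by (force simp: edge_set_def restrict_edges_def)

text \<open>Intersecting \<open>W\<close> with \<open>Y\<close> makes it disjoint from the deleted
  vertices, as the closure hypothesis on the classes demands. The graph is not affected, because all
  edges that survive lie inside \<open>Y\<close>.\<close>

lemma graph_of_restrict:
  assumes "simple_graph (graph_of vs es)" "set Y \<subseteq> set vs"
  shows "graph_of Y (restrict_edges es Y W) =
    delete_edges (delete_vertices (graph_of vs es) (set vs - set Y))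
      (edges (induced_subgraph (graph_of vs es) (set W \<inter> set Y)))"
proof -
  have "e \<subseteq> set vs" if "e \<in> edge_set es" for e
    using assms(1) that by (auto simp: simple_graph_def graph_of_def)
  then have "{e\<in>edge_set es. e \<subseteq> set Y \<and> \<not> e \<subseteq> set W} =
      {e\<in>edge_set es. e \<inter> (set vs - set Y) = {}} - {e\<in>edge_set es. e \<subseteq> set W \<inter> set Y}"
    using assms(2) by blast
  moreover have "set Y = set vs - (set vs - set Y)" using assms(2) by blast
  ultimately show ?thesis
    by (simp add: graph_of_def edge_set_restrict delete_edges_def delete_vertices_def induced_subgraph_def)
qed

lemma vertex_cover_restrict:
  "vertex_cover (graph_of Y (restrict_edges es Y W)) X \<longleftrightarrow> is_cover (adjacent (graph_of vs es)) (set Y) (set W) X"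
proof
  assume cover: "vertex_cover (graph_of Y (restrict_edges es Y W)) X"
  show "is_cover (adjacent (graph_of vs es)) (set Y) (set W) X"
  proof (rule is_coverI)
    show "X \<subseteq> set Y" using cover by (simp add: vertex_cover_def graph_of_def)
    fix a b assume "a \<in> set Y" "b \<in> set Y" "(a, b) \<in> adjacent (graph_of vs es)" "\<not> (a \<in> set W \<and> b \<in> set W)"
    then have "{a, b} \<in> edge_set (restrict_edges es Y W)"
      unfolding edge_set_restrict by (simp add: adjacent_def graph_of_def)
    then have "{a, b} \<inter> X \<noteq> {}" using cover unfolding vertex_cover_def graph_of_def by fastforce
    then show "a \<in> X \<or> b \<in> X" by blast
  qed
next
  assume cover: "is_cover (adjacent (graph_of vs es)) (set Y) (set W) X"
  show "vertex_cover (graph_of Y (restrict_edges es Y W)) X"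
    unfolding vertex_cover_def
  proof (intro conjI ballI)
    show "X \<subseteq> verts (graph_of Y (restrict_edges es Y W))"
      using cover by (simp add: is_cover_def graph_of_def)
    fix e assume "e \<in> edges (graph_of Y (restrict_edges es Y W))"
    then have e: "e \<in> edge_set es" "e \<subseteq> set Y" "\<not> e \<subseteq> set W"
      by (simp_all add: graph_of_def edge_set_restrict)
    then obtain a b where ab: "e = {a, b}" by (auto simp: edge_set_def)
    have "(a, b) \<in> adjacent (graph_of vs es)" using e(1) by (simp add: adjacent_def graph_of_def ab)
    then have "a \<in> X \<or> b \<in> X" using is_coverD[OF cover, of a b] e(2,3) by (simp add: ab)
    then show "e \<inter> X \<noteq> {}" by (auto simp: ab)
  qed
qed

lemma minimum_vertex_cover_restrict:
  "minimum_set vertex_cover (graph_of Y (restrict_edges es Y W)) X \<longleftrightarrow>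
    is_min_cover (adjacent (graph_of vs es)) (set Y) (set W) X"
  unfolding minimum_set_def is_min_cover_def vertex_cover_restrict[of Y es W _ vs] ..

theorem theorem12:
  fixes \<H> \<G> :: "nat ugraph set"
  assumes "\<forall>G\<in>\<H>. simple_graph G"
    and "minimum_set_in_poly_time vertex_cover \<H>"
    and "\<forall>G\<in>\<G>. simple_graph G \<and> connected_graph G"
    and "\<forall>G\<in>\<G>. \<forall>U W. U \<subseteq> verts G \<and> W \<subseteq> verts G \<and> U \<inter> W = {} \<longrightarrow>
           delete_edges (delete_vertices G U) (edges (induced_subgraph G W)) \<in> \<H>"
  shows "minimum_set_in_poly_time simultaneous_dominating_set \<G>"
proof -
  define Q where "Q = {(Y, E). list_graph Y E \<and> graph_of Y E \<in> \<H>}"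
  define D where "D = {(vs, es). list_graph vs es \<and> graph_of vs es \<in> \<G>}"
  let ?i = "\<lambda>q. Pair (enc_nats (fst q)) (enc_edges (snd q))"
  obtain c p where c: "\<And>G x. G \<in> \<H> \<Longrightarrow> encodes_graph x G \<Longrightarrow>
      \<exists>y S. computes_in c (poly p (size x)) x y \<and> encodes_set y S \<and> minimum_set vertex_cover G S"
    using assms(2) unfolding minimum_set_in_poly_time_def by blast
  define good where "good Y E xs \<longleftrightarrow>
      computes_in c (poly p (size (?i (Y, E)))) (?i (Y, E)) (enc_nats xs) \<and> distinct xs \<and>
      minimum_set vertex_cover (graph_of Y E) (set xs)" for Y E xs
  \<comment> \<open>The cover found by \<open>c\<close> may depend on the order in which a graph is
    written down, so \<open>solve\<close> is a function of the lists and not of the graph. Outside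
    \<open>Q\<close> its value is arbitrary.\<close>
  define solve where "solve Y E = (SOME xs. good Y E xs)" for Y E
  have good: "good (fst q) (snd q) (solve (fst q) (snd q))" if "q \<in> Q" for q
  proof -
    obtain Y E where q: "q = (Y, E)" by (cases q)
    have "list_graph Y E" "graph_of Y E \<in> \<H>" using that by (simp_all add: Q_def q)
    from c[OF this(2) encodes_graph_of[OF this(1)]]
    have "\<exists>xs. good Y E xs" unfolding good_def encodes_set_def by auto
    then show ?thesis unfolding q solve_def fst_conv snd_conv by (rule someI_ex)
  qed
  have subset: "set (solve (fst q) (snd q)) \<subseteq> set (fst q)" if "q \<in> Q" for q
    using good[OF that] by (simp add: good_def minimum_set_def vertex_cover_def graph_of_def)
  have restrict_query: "(Y, restrict_edges (snd x) Y W) \<in> Q"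
    if x: "x \<in> D" and Y: "distinct Y" "set Y \<subseteq> set (fst x)" for x Y W
  proof -
    obtain vs es where x': "x = (vs, es)" by (cases x)
    have G: "list_graph vs es" "graph_of vs es \<in> \<G>" "simple_graph (graph_of vs es)"
      using x assms(3) by (simp_all add: D_def x')
    have "delete_edges (delete_vertices (graph_of vs es) (set vs - set Y))
      (edges (induced_subgraph (graph_of vs es) (set W \<inter> set Y))) \<in> \<H>"
      using assms(4)[rule_format, OF G(2), of "set vs - set Y" "set W \<inter> set Y"] Y(2)
      by (auto simp: graph_of_def x')
    then have "graph_of Y (restrict_edges es Y W) \<in> \<H>"
      using graph_of_restrict[OF G(3), of Y W] Y(2) by (simp add: x')
    with list_graph_restrict[OF G(1) Y(1)] show ?thesis by (simp add: Q_def x')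
  qed
  interpret vertex_cover_solver solve Q D
  proof
    show "poly_time Q ?i (\<lambda>q. enc_nats (solve (fst q) (snd q)))"
    proof (rule poly_timeI[where p = p and q = "[:0, 1:]"])
      fix q assume q: "q \<in> Q"
      show "computes_in c (poly p (size (?i q))) (?i q) (enc_nats (solve (fst q) (snd q)))"
        using good[OF q] by (simp add: good_def)
      \<comment> \<open>The hypothesis limits only the running time of \<open>c\<close>; its output
        is small because it lists distinct vertices of the query.\<close>
      have "size (enc_nats (solve (fst q) (snd q))) \<le> size (enc_nats (fst q))"
        by (rule size_enc_list_mono) (use good[OF q] subset[OF q] q in \<open>auto simp: good_def Q_def list_graph_def\<close>)
      then show "size (enc_nats (solve (fst q) (snd q))) \<le> poly [:0, 1:] (size (?i q))" by simp
    qed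
    show "distinct (solve (fst q) (snd q))" if "q \<in> Q" for q
      using good[OF that] by (simp add: good_def)
    show "set (solve (fst q) (snd q)) \<subseteq> set (fst q)" if "q \<in> Q" for q
      by (rule subset[OF that])
    show "(Y, filter (\<lambda>e. fst e \<in> set Y \<and> snd e \<in> set Y \<and> \<not> (fst e \<in> set W \<and> snd e \<in> set W)) (snd x)) \<in> Q"
      if "x \<in> D" "distinct Y" "set Y \<subseteq> set (fst x)" for x Y W
      using restrict_query[OF that, of W] unfolding restrict_edges_def .
    show "fst e \<noteq> snd e" if "x \<in> D" "e \<in> set (snd x)" for x e
    proof
      assume "fst e = snd e"
      then have "{fst e, fst e} \<in> edge_set (snd x)"
        using that(2) unfolding mem_edge_set by (metis prod.collapse)
      then have "{fst e} \<in> edge_set (snd x)" by simp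
      moreover have "simple_graph (graph_of (fst x) (snd x))" using that(1) assms(3) by (auto simp: D_def)
      ultimately show False by (fastforce simp: simple_graph_def graph_of_def)
    qed
    show "distinct (fst x)" if "x \<in> D" for x using that by (auto simp: D_def list_graph_def)
  qed
  obtain c' p' where c': "\<And>x. x \<in> D \<Longrightarrow>
      computes_in c' (poly p' (size (?i x))) (?i x) (enc_nats (algorithm solve (fst x) (snd x)))"
    using poly_time_algorithm unfolding poly_time_def by blast
  show ?thesis
    unfolding minimum_set_in_poly_time_def
  proof (rule exI[of _ c'], rule exI[of _ p'], intro ballI allI impI)
    fix G x assume G: "G \<in> \<G>" and "encodes_graph x G"
    then obtain vs es where l: "list_graph vs es" "graph_of vs es = G" "x = ?i (vs, es)"
      by (auto elim: encodes_graphE)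
    have D: "(vs, es) \<in> D" using G l by (simp add: D_def)
    have verts: "set vs = verts G" and edges: "edge_set es = edges G"
      using l(2) by (auto simp: graph_of_def)
    interpret sound_solver G vs es solve
    proof
      fix Y W :: "nat list" assume Y: "distinct Y" "set Y \<subseteq> verts G"
      have q: "(Y, restrict_edges es Y W) \<in> Q" using restrict_query[OF D] Y verts by simp
      have cover: "cover solve es Y W = solve Y (restrict_edges es Y W)"
        by (simp add: cover_def restrict_edges_def)
      show "distinct (cover solve es Y W)" using good[OF q] by (simp add: good_def cover)
      show "is_min_cover (adjacent G) (set Y) (set W) (set (cover solve es Y W))"
        using good[OF q] minimum_vertex_cover_restrict[of Y es W _ vs] by (simp add: good_def cover l(2))
    qed (use G assms(3) l verts edges in \<open>auto simp: list_graph_def\<close>)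
    have "computes_in c' (poly p' (size x)) x (enc_nats (algorithm solve vs es))"
      using c'[OF D] by (simp add: l(3))
    moreover have "encodes_set (enc_nats (algorithm solve vs es)) (set (algorithm solve vs es))"
      using algorithm_correct by (auto simp: encodes_set_def)
    ultimately show "\<exists>y S. computes_in c' (poly p' (size x)) x y \<and> encodes_set y S \<and>
        minimum_set simultaneous_dominating_set G S"
      using algorithm_correct by blast
  qed
qed

end
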